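(* Let $\Gamma$ be a set with the cardinality of the continuum and let $\{N_\gamma:\gamma\in\Gamma\}$ be a family of infinite subsets of $\mathbb{N}$ such that $N_\gamma\cap N_{\gamma'}$ is finite whenever $\gamma\ne\gamma'$. For each $\gamma\in\Gamma$ let $\phi_\gamma\in\ell_\infty$ be the characteristic function of $N_\gamma$, and let $\chi_{\mathbb{N}}\in\ell_\infty$ be the constant sequence $1$. Let $X_{\mathit{JL}}$ be the closed linear subspace of $\ell_\infty$ generated by $c_0\cup\{\phi_\gamma:\gamma\in\Gamma\}\cup\{\chi_{\mathbb{N}}\}$, with the supremum norm. Then $X_{\mathit{JL}}$ is subprojective and superprojective.
   Context: A complemented subspace of a Banach space is one that is the range of a bounded projection (in particular closed). A Banach space $X$ is subprojective if every closed infinite-dimensional subspace of $X$ contains an infinite-dimensional subspace complemented in $X$. It is superprojective if every closed infinite-codimensional subspace of $X$ is contained in an infinite-codimensional subspace complemented in $X$. *)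

theory Defs
  imports "HOL-Analysis.Analysis"
begin

text \<open>
  Complex Banach spaces have no type class in the library, so the notions below are stated over
  a complete normed field \<open>'k\<close> acting on a Banach space \<open>'a\<close>; they are used for \<open>'k = real\<close>
  and \<open>'k = complex\<close>. The Banach space to which a notion refers is a closed
  subspace \<open>X\<close> of \<open>'a\<close>, since a space that depends on parameters cannot be a type of its own.
\<close>

locale banach_over = vector_space scale
  for scale :: "'k::{real_normed_field,banach} \<Rightarrow> 'a::banach \<Rightarrow> 'a"  (infixr \<open>*k\<close> 75) +
  assumes scale_of_real: "of_real r *k x = r *\<^sub>R x"
    and norm_scale: "norm (c *k x) = norm c * norm x"
begin

definition closed_subspace :: "'a set \<Rightarrow> 'a set \<Rightarrow> bool" where
  "closed_subspace X M \<longleftrightarrow> subspace M \<and> closed M \<and> M \<subseteq> X"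

definition infinite_dim :: "'a set \<Rightarrow> bool" where
  "infinite_dim M \<longleftrightarrow> \<not> (\<exists>B. finite B \<and> M \<subseteq> span B)"

text \<open>The quotient of \<open>X\<close> by \<open>M\<close> is spanned by finitely many classes iff \<open>X\<close> is spanned by
  \<open>M\<close> together with finitely many of its elements.\<close>

definition infinite_codim :: "'a set \<Rightarrow> 'a set \<Rightarrow> bool" where
  "infinite_codim X M \<longleftrightarrow> \<not> (\<exists>B. finite B \<and> B \<subseteq> X \<and> X \<subseteq> span (M \<union> B))"

text \<open>Only the values of \<open>P\<close> on \<open>X\<close> are relevant.\<close>

definition bounded_projection :: "'a set \<Rightarrow> ('a \<Rightarrow> 'a) \<Rightarrow> bool" where
  "bounded_projection X P \<longleftrightarrow>
     P ` X \<subseteq> X \<and>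
     (\<forall>x\<in>X. \<forall>y\<in>X. P (x + y) = P x + P y) \<and>
     (\<forall>c. \<forall>x\<in>X. P (c *k x) = c *k P x) \<and>
     (\<exists>K. \<forall>x\<in>X. norm (P x) \<le> K * norm x) \<and>
     (\<forall>x\<in>X. P (P x) = P x)"

definition complemented :: "'a set \<Rightarrow> 'a set \<Rightarrow> bool" where
  "complemented X M \<longleftrightarrow> (\<exists>P. bounded_projection X P \<and> P ` X = M)"

definition subprojective :: "'a set \<Rightarrow> bool" where
  "subprojective X \<longleftrightarrow>
     (\<forall>M. closed_subspace X M \<and> infinite_dim M \<longrightarrow>
       (\<exists>L. L \<subseteq> M \<and> infinite_dim L \<and> complemented X L))"

definition superprojective :: "'a set \<Rightarrow> bool" where
  "superprojective X \<longleftrightarrow>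
     (\<forall>M. closed_subspace X M \<and> infinite_codim X M \<longrightarrow>
       (\<exists>L. M \<subseteq> L \<and> infinite_codim X L \<and> complemented X L))"

lemma closed_subspace_closure_span: "closed_subspace UNIV (closure (span S))"
proof -
  have sub: "subspace (closure (span S))"
  proof (rule subspaceI)
    show "0 \<in> closure (span S)"
      using closure_subset span_zero by blast
  next
    fix x y assume "x \<in> closure (span S)" "y \<in> closure (span S)"
    then obtain f g where "\<forall>n. f n \<in> span S" "f \<longlonglongrightarrow> x" "\<forall>n. g n \<in> span S" "g \<longlonglongrightarrow> y"
      unfolding closure_sequential by blast
    then show "x + y \<in> closure (span S)"
      unfolding closure_sequential
      by (intro exI[of _ "\<lambda>n. f n + g n"]) (auto intro: span_add tendsto_add)
  next
    fix c x assume "x \<in> closure (span S)"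
    then obtain f where f: "\<forall>n. f n \<in> span S" "f \<longlonglongrightarrow> x"
      unfolding closure_sequential by blast
    have "(\<lambda>n. c *k (f n - x)) \<longlonglongrightarrow> 0"
      by (rule tendsto_norm_zero_cancel)
        (simp add: norm_scale tendsto_mult_right_zero LIM_zero tendsto_norm_zero f(2))
    then have "(\<lambda>n. c *k f n) \<longlonglongrightarrow> c *k x"
      by (simp add: scale_right_diff_distrib LIM_zero_iff)
    then show "c *k x \<in> closure (span S)"
      unfolding closure_sequential using f(1)
      by (intro exI[of _ "\<lambda>n. c *k f n"]) (auto intro: span_scale)
  qed
  then show ?thesis by (simp add: closed_subspace_def)
qed

end

text \<open>
  As \<open>nat\<close> is discrete, \<open>nat \<Rightarrow>\<^sub>C 'k\<close> is the space of all bounded sequences, with the supremum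
  norm. The library provides only its real scalar multiplication.
\<close>

type_synonym 'k linf = "nat \<Rightarrow>\<^sub>C 'k"

context
  includes bcontfun.lifting
begin

lift_definition linf_scale :: "'k::real_normed_field \<Rightarrow> 'k linf \<Rightarrow> 'k linf" is
  "\<lambda>c f n. c * f n"
proof -
  fix c :: 'k and f :: "nat \<Rightarrow> 'k" assume "f \<in> bcontfun"
  then obtain b where "\<And>n. norm (f n) \<le> b"
    by (auto simp: bcontfun_def bounded_iff)
  then show "(\<lambda>n. c * f n) \<in> bcontfun"
    by (intro bcontfun_normI[where b = "norm c * b"]) (auto simp: norm_mult mult_left_mono)
qed

lift_definition char_seq :: "nat set \<Rightarrow> 'k::real_normed_field linf" is
  "\<lambda>A n. if n \<in> A then 1 else 0"
  by (auto simp: bcontfun_def bounded_iff intro!: exI[of _ 1])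

end

lemma norm_linf: "norm (f :: 'k::real_normed_field linf) = (SUP n. norm (apply_bcontfun f n))"
  unfolding norm_bcontfun_def dist_bcontfun.rep_eq zero_bcontfun.rep_eq by simp

text \<open>The library has this instance only for domains of class \<open>metric_space\<close>, which
  \<open>nat\<close> does not belong to.\<close>

instance bcontfun :: (topological_space, complete_space) complete_space
proof
  fix f :: "nat \<Rightarrow> ('a, 'b) bcontfun"
  assume "Cauchy f"
  then obtain g where "uniform_limit UNIV f g sequentially"
    using uniformly_convergent_eq_cauchy[of "\<lambda>_. True" f]
    unfolding Cauchy_def uniform_limit_sequentially_iff
    by (metis dist_fun_lt_imp_dist_val_lt)
  from uniform_limit_bcontfunE[OF this sequentially_bot]
  show "convergent f"
    by (metis convergentI)
qed

instance bcontfun :: (topological_space, banach) banach ..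

interpretation linf: banach_over "linf_scale :: 'k::{real_normed_field,banach} \<Rightarrow> 'k linf \<Rightarrow> 'k linf"
proof
  fix a b r and x y :: "'k linf"
  show "linf_scale a (x + y) = linf_scale a x + linf_scale a y"
    "linf_scale (a + b) x = linf_scale a x + linf_scale b x"
    "linf_scale a (linf_scale b x) = linf_scale (a * b) x"
    "linf_scale 1 x = x"
    by (rule bcontfun_eqI, simp add: linf_scale.rep_eq plus_bcontfun.rep_eq algebra_simps)+
  show "linf_scale (of_real r) x = r *\<^sub>R x"
    by (rule bcontfun_eqI) (simp add: linf_scale.rep_eq scaleR_bcontfun.rep_eq scaleR_conv_of_real)
  have le: "norm (linf_scale c z) \<le> norm c * norm z" for c and z :: "'k linf"
    by (rule norm_bound)
      (simp add: linf_scale.rep_eq norm_mult mult_left_mono norm_bounded)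
  show "norm (linf_scale a x) = norm a * norm x"
  proof (cases "a = 0")
    case True
    then have "linf_scale a x = 0"
      by (intro bcontfun_eqI) (simp add: linf_scale.rep_eq)
    then show ?thesis using True by simp
  next
    case False
    have "linf_scale (inverse a) (linf_scale a x) = x"
      using False by (intro bcontfun_eqI) (simp add: linf_scale.rep_eq)
    then have "norm x \<le> inverse (norm a) * norm (linf_scale a x)"
      using le[of "inverse a" "linf_scale a x"] by (simp add: norm_inverse)
    then have "norm a * norm x \<le> norm (linf_scale a x)"
      using False by (simp add: field_simps)
    then show ?thesis using le[of a x] by (rule antisym[rotated])
  qed
qed

definition c0 :: "'k::real_normed_field linf set" where
  "c0 = {f. apply_bcontfun f \<longlonglongrightarrow> 0}"

definition X_JL :: "'g set \<Rightarrow> ('g \<Rightarrow> nat set) \<Rightarrow> 'k::{real_normed_field,banach} linf set" where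
  "X_JL \<Gamma> N = closure (linf.span (c0 \<union> {char_seq (N \<gamma>) | \<gamma>. \<gamma> \<in> \<Gamma>} \<union> {const_bcontfun 1}))"

lemma closed_subspace_X_JL: "linf.closed_subspace UNIV (X_JL \<Gamma> N)"
  unfolding X_JL_def by (rule linf.closed_subspace_closure_span)

end

theory Submission
  imports Defs "HOL-Library.Diagonal_Subsequence"
begin

text \<open>
  Everything rests on one criterion: if bounded functionals converge pointwise on a Banach space
  \<open>X\<close> and stay away from 0 on the terms of a sequence satisfying an upper \<open>c\<^sub>0\<close>-estimate, then, after
  subtracting the limit and passing to a subsequence, functionals and sequence are almost
  biorthogonal. They give operators \<open>U: c\<^sub>0 \<rightarrow> X\<close> and \<open>V: X \<rightarrow> c\<^sub>0\<close> with \<open>VU\<close> invertible, and \<open>U (VU)\<^sup>-\<^sup>1 V\<close>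
  is a projection of infinite rank.

  A limit exists along every \<open>N \<gamma>\<close> and at infinity, so that \<open>X_JL\<close> is the space of continuous functions
  on a scattered compact space of height 3. For a subspace \<open>M\<close> of infinite dimension, a gliding hump argument, either
  for the evaluations or for the limits along the \<open>N \<gamma>\<close>, produces the sequence inside \<open>M\<close>, and the
  projection has its range in \<open>M\<close>. For \<open>M\<close> of infinite codimension there is a disjointly supported sequence
  in the unit ball at positive distance from \<open>M\<close>, since otherwise \<open>M\<close> together with a space of finite
  dimension would be dense. The Hahn-Banach theorem supplies
  functionals vanishing on \<open>M\<close>, and \<open>M\<close> lies in the kernel of the projection. To extract a
  pointwise convergent subsequence one enlarges \<open>M\<close> to the closure of \<open>c\<^sub>0 + M\<close>, if this still has
  infinite codimension; in either case a countable subset of \<open>X_JL\<close> decides the convergence.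
\<close>

section \<open>The Hahn-Banach theorem\<close>

text \<open>For uncountable \<Gamma> the space \<open>X_JL\<close> is not separable, so pointwise
  convergent subsequences of functionals do not come for free, and Sobczyk's theorem provides no
  projections. Even \<open>c0\<close> is then uncomplemented in it, although the evaluations are
  biorthogonal to its unit vectors: without pointwise convergence, \<open>V\<close> lands only in
  the bounded sequences, where \<open>VU\<close> cannot be inverted. Passing to a suitable
  subsequence is the point. For superprojectivity the functionals come from Hahn-Banach and are not
  explicit. A bounded functional vanishing on \<open>c0\<close> is nonzero on only countably many
  \<open>char_seq (N \<gamma>)\<close>. If the closure of \<open>c0 + M\<close> has infinite
  codimension, the functionals can be made to vanish on it, and this fact applies. Otherwise
  \<open>c0\<close>, \<open>M\<close> and finitely many vectors generate everything, and beyond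
  \<open>M\<close> only these vectors and the unit vectors of \<open>c0\<close> matter.\<close>

definition sublinear :: "('a::real_vector \<Rightarrow> real) \<Rightarrow> bool" where
  "sublinear p \<longleftrightarrow> (\<forall>x y. p (x + y) \<le> p x + p y) \<and> (\<forall>t\<ge>0. \<forall>x. p (t *\<^sub>R x) = t * p x)"

lemma sublinear_add: "sublinear p \<Longrightarrow> p (x + y) \<le> p x + p y"
  and sublinear_scale: "sublinear p \<Longrightarrow> t \<ge> 0 \<Longrightarrow> p (t *\<^sub>R x) = t * p x"
  by (auto simp: sublinear_def)

lemma sublinear_zero: "sublinear p \<Longrightarrow> p 0 = 0"
  using sublinear_scale[of p 0 0] by simp

lemma sublinear_lower: "sublinear p \<Longrightarrow> - p (- x) \<le> p x"
  using sublinear_add[of p x "- x"] sublinear_zero[of p] by simp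

text \<open>Lowers the value at \<open>- y\<close> to \<open>- p y\<close>; a minimal sublinear functional is therefore odd.\<close>

definition lower_along :: "'a::real_vector \<Rightarrow> ('a \<Rightarrow> real) \<Rightarrow> 'a \<Rightarrow> real" where
  "lower_along y p x = (INF t\<in>{0..}. p (x + t *\<^sub>R y) - t * p y)"

lemma lower_along_bdd:
  assumes "sublinear p"
  shows "bdd_below ((\<lambda>t. p (x + t *\<^sub>R y) - t * p y) ` {0..})"
proof (rule bdd_belowI2[where m = "- p (- x)"])
  fix t :: real assume "t \<in> {0..}"
  then have "t * p y = p (t *\<^sub>R y)"
    using sublinear_scale[OF assms] by auto
  also have "\<dots> \<le> p (x + t *\<^sub>R y) + p (- x)"
    using sublinear_add[OF assms, of "x + t *\<^sub>R y" "- x"] by simp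
  finally show "- p (- x) \<le> p (x + t *\<^sub>R y) - t * p y" by simp
qed

lemma lower_along_le:
  assumes "sublinear p" "t \<ge> 0"
  shows "lower_along y p x \<le> p (x + t *\<^sub>R y) - t * p y"
  unfolding lower_along_def
  by (rule cINF_lower[OF lower_along_bdd[OF assms(1)]]) (use assms in auto)

lemma sublinear_lower_along:
  assumes p: "sublinear p"
  shows "sublinear (lower_along y p)"
  unfolding sublinear_def
proof (intro conjI allI impI)
  fix x x'
  have key: "lower_along y p (x + x') \<le> (p (x + s *\<^sub>R y) - s * p y) + (p (x' + t *\<^sub>R y) - t * p y)"
    if "s \<ge> 0" "t \<ge> 0" for s t
  proof -
    have "lower_along y p (x + x') \<le> p ((x + s *\<^sub>R y) + (x' + t *\<^sub>R y)) - (s + t) * p y"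
      using lower_along_le[OF p, of "s + t" y "x + x'"] that by (simp add: algebra_simps)
    also have "\<dots> \<le> p (x + s *\<^sub>R y) + p (x' + t *\<^sub>R y) - (s + t) * p y"
      using sublinear_add[OF p] by simp
    finally show ?thesis by (simp add: algebra_simps)
  qed
  \<comment> \<open>Two infima are taken one after the other: over the parameter of
    \<open>x'\<close> with \<open>s\<close> fixed, then over \<open>s\<close>.\<close>
  have "lower_along y p (x + x') - (p (x + s *\<^sub>R y) - s * p y) \<le> lower_along y p x'" if "s \<ge> 0" for s
    unfolding lower_along_def[of y p x']
    by (rule cINF_greatest) (use key[OF that] in \<open>force simp: algebra_simps\<close>)+
  then have "lower_along y p (x + x') - lower_along y p x' \<le> lower_along y p x"
    unfolding lower_along_def[of y p x]
    by (intro cINF_greatest) (force simp: algebra_simps)+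
  then show "lower_along y p (x + x') \<le> lower_along y p x + lower_along y p x'" by simp
next
  fix t :: real and x assume t: "t \<ge> 0"
  have le: "lower_along y p (c *\<^sub>R z) \<le> c * lower_along y p z" if c: "c > 0" for c z
  proof -
    have "lower_along y p (c *\<^sub>R z) / c \<le> lower_along y p z"
      unfolding lower_along_def[of y p z]
    proof (rule cINF_greatest)
      fix s :: real assume "s \<in> {0..}"
      then have "lower_along y p (c *\<^sub>R z) \<le> p (c *\<^sub>R (z + s *\<^sub>R y)) - (c * s) * p y"
        using lower_along_le[OF p, of "c * s" y "c *\<^sub>R z"] c by (simp add: algebra_simps)
      then show "lower_along y p (c *\<^sub>R z) / c \<le> p (z + s *\<^sub>R y) - s * p y"
        using c sublinear_scale[OF p, of c "z + s *\<^sub>R y"]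
        by (simp add: field_simps del: scaleR_add_right)
    qed auto
    then show ?thesis using c by (simp add: field_simps)
  qed
  show "lower_along y p (t *\<^sub>R x) = t * lower_along y p x"
  proof (cases "t = 0")
    case True
    have "lower_along y p 0 = 0"
    proof (rule antisym)
      show "lower_along y p 0 \<le> 0"
        using lower_along_le[OF p, of 0 y 0] sublinear_zero[OF p] by simp
      show "0 \<le> lower_along y p 0"
        unfolding lower_along_def
        by (rule cINF_greatest) (auto simp: sublinear_scale[OF p])
    qed
    then show ?thesis using True by simp
  next
    case False
    then have "lower_along y p x \<le> inverse t * lower_along y p (t *\<^sub>R x)"
      using le[of "inverse t" "t *\<^sub>R x"] t by simp
    then show ?thesis using le[of t x] t False by (simp add: field_simps)
  qed
qed

text \<open>Minimality gives \<open>lower_along y p = p\<close> for every \<open>y\<close>; at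
  parameter 1 this yields \<open>p x \<le> p (x + y) - p y\<close>, the converse of subadditivity.
  Additivity makes \<open>p\<close> odd, which extends positive homogeneity to negative
  scalars.\<close>

lemma minimal_sublinear_linear:
  assumes p: "sublinear p" and min: "\<And>q. sublinear q \<Longrightarrow> q \<le> p \<Longrightarrow> q = p"
  shows "linear p"
proof -
  have low: "lower_along y p = p" for y
  proof (rule min[OF sublinear_lower_along[OF p]])
    show "lower_along y p \<le> p"
      using lower_along_le[OF p, of 0] by (auto simp: le_fun_def)
  qed
  have add: "p (x + y) = p x + p y" for x y
    using lower_along_le[OF p, of 1 y x] sublinear_add[OF p, of x y] unfolding low by simp
  have minus: "p (- x) = - p x" for x
    using add[of x "- x"] sublinear_zero[OF p] by simp
  have "p (c *\<^sub>R x) = c * p x" for c x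
    using sublinear_scale[OF p, of c x] sublinear_scale[OF p, of "- c" x] minus[of "c *\<^sub>R x"]
    by (cases "c \<ge> 0") auto
  then show ?thesis by (intro linearI) (auto simp: add)
qed

text \<open>Zorn's lemma is applied to sublinear functionals below \<open>p\<close>, ordered
  downwards, rather than to partial linear extensions. A chain has its pointwise infimum as bound,
  which is finite because every member is at least \<open>- p (- x)\<close> at \<open>x\<close>.
  Prescribed values are obtained afterwards through the choice of \<open>p\<close>.\<close>

theorem Hahn_Banach_sublinear:
  fixes p :: "'a::real_vector \<Rightarrow> real"
  assumes p: "sublinear p"
  obtains u where "linear u" "u \<le> p"
proof -
  define A where "A = {q. sublinear q \<and> q \<le> p}"
  define le where "le = (\<lambda>q r :: 'a \<Rightarrow> real. r \<le> q)"
  have po: "partial_order_on A (relation_of le A)"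
    unfolding le_def by (rule partial_order_on_relation_ofI) auto
  have "\<exists>m\<in>A. \<forall>a\<in>A. le m a \<longrightarrow> a = m"
  proof (rule predicate_Zorn[OF po])
    fix C assume C: "C \<in> Chains (relation_of le A)"
    then have CA: "C \<subseteq> A" and
      tot: "\<And>q r. q \<in> C \<Longrightarrow> r \<in> C \<Longrightarrow> q \<le> r \<or> r \<le> q"
      unfolding Chains_def relation_of_def le_def by auto
    show "\<exists>u\<in>A. \<forall>a\<in>C. le a u"
    proof (cases "C = {}")
      case True
      then show ?thesis using p by (auto simp: A_def)
    next
      case False
      define r where "r = (\<lambda>x. INF q\<in>C. q x)"
      have subC: "sublinear q" "q \<le> p" if "q \<in> C" for q
        using that CA by (auto simp: A_def)
      have bdd: "bdd_below ((\<lambda>q. q x) ` C)" for x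
      proof (rule bdd_belowI2)
        fix q assume "q \<in> C"
        then have "- q (- x) \<le> q x" "q (- x) \<le> p (- x)"
          using subC[of q] sublinear_lower by (auto simp: le_fun_def)
        then show "- p (- x) \<le> q x" by simp
      qed
      have r_le: "r \<le> q" if "q \<in> C" for q
        unfolding r_def le_fun_def using that bdd by (auto intro: cINF_lower)
      have "sublinear r"
        unfolding sublinear_def
      proof (intro conjI allI impI)
        fix x y
        have key: "r (x + y) \<le> q x + q' y" if qq: "q \<in> C" "q' \<in> C" for q q'
        proof -
          \<comment> \<open>Two members of a chain are comparable, so the smaller one can replace
            both before subadditivity is applied.\<close>
          obtain s where s: "s \<in> C" "s \<le> q" "s \<le> q'"
            using tot[OF qq] qq by (metis order_refl)
          then have "r (x + y) \<le> s x + s y"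
            using r_le[of s] sublinear_add[OF subC(1)[of s], of x y]
            by (auto simp: le_fun_def intro: order_trans)
          then show ?thesis using le_funD[OF s(2), of x] le_funD[OF s(3), of y] by linarith
        qed
        have "r (x + y) - q x \<le> r y" if "q \<in> C" for q
          unfolding r_def[of] using False key[OF that] r_def
          by (intro cINF_greatest) (auto simp: algebra_simps)
        then have "r (x + y) - r y \<le> r x"
          unfolding r_def using False r_def
          by (intro cINF_greatest) (auto simp: algebra_simps)
        then show "r (x + y) \<le> r x + r y" by simp
      next
        fix t :: real and x assume t: "t \<ge> 0"
        have le: "r (c *\<^sub>R z) \<le> c * r z" if "c > 0" for c z
        proof -
          have "r (c *\<^sub>R z) / c \<le> r z"
            unfolding r_def[of]
          proof (rule cINF_greatest)
            fix q assume q: "q \<in> C"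
            show "(INF q\<in>C. q (c *\<^sub>R z)) / c \<le> q z"
              using r_le[OF q] that sublinear_scale[OF subC(1)[OF q], of c z]
              unfolding r_def le_fun_def by (auto simp: field_simps dest: spec[of _ "c *\<^sub>R z"])
          qed (use False in auto)
          then show ?thesis using that by (simp add: field_simps)
        qed
        show "r (t *\<^sub>R x) = t * r x"
        proof (cases "t = 0")
          case True
          have "(\<lambda>q. q 0) ` C = {0}"
            using False subC(1) sublinear_zero by (auto simp: image_iff)
          then show ?thesis using True by (simp add: r_def)
        next
          case False
          then have "r x \<le> inverse t * r (t *\<^sub>R x)"
            using le[of "inverse t" "t *\<^sub>R x"] t by simp
          then show ?thesis using le[of t x] t False by (simp add: field_simps)
        qed
      qed
      moreover have "r \<le> p"
        using False r_le subC(2) by (meson ex_in_conv order_trans)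
      ultimately show ?thesis using r_le by (auto simp: A_def le_def)
    qed
  qed
  then obtain m where "m \<in> A" "\<And>a. a \<in> A \<Longrightarrow> a \<le> m \<Longrightarrow> a = m"
    by (auto simp: le_def)
  then have "linear m" "m \<le> p"
    by (auto simp: A_def intro!: minimal_sublinear_linear intro: order_trans)
  then show ?thesis by (rule that)
qed

lemma infdist_approx:
  assumes "M \<noteq> {}" "e > 0"
  shows "\<exists>m\<in>M. dist x m < infdist x M + e"
  using cInf_lessD[of "dist x ` M" "infdist x M + e"] assms
  by (auto simp: infdist_notempty)

lemma sublinear_infdist:
  fixes M :: "'a::real_normed_vector set"
  assumes M: "subspace M"
  shows "sublinear (\<lambda>x. infdist x M)"
proof -
  have ne: "M \<noteq> {}" using M subspace_0 by auto
  have near: "\<exists>m\<in>M. norm (x - m) < infdist x M + e" if "e > 0" for x e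
    using infdist_approx[OF ne that] by (simp add: dist_norm)
  have le: "infdist x M \<le> norm (x - m)" if "m \<in> M" for x m
    using infdist_le[OF that, of x] by (simp add: dist_norm)
  have add: "infdist (x + y) M \<le> infdist x M + infdist y M" for x y
  proof (rule field_le_epsilon)
    fix e :: real assume "e > 0"
    then obtain m n where mn: "m \<in> M" "n \<in> M" "norm (x - m) < infdist x M + e/2" "norm (y - n) < infdist y M + e/2"
      using near[of "e/2"] by (metis half_gt_zero)
    have "infdist (x + y) M \<le> norm ((x + y) - (m + n))"
      using mn subspace_add[OF M] by (intro le) auto
    also have "\<dots> \<le> norm (x - m) + norm (y - n)"
      by (metis add_diff_add norm_triangle_ineq)
    finally show "infdist (x + y) M \<le> infdist x M + infdist y M + e" using mn by simp
  qed
  have sc: "infdist (t *\<^sub>R x) M \<le> t * infdist x M" if t: "t > 0" for t x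
  proof (rule field_le_epsilon)
    fix e :: real assume "e > 0"
    then obtain m where m: "m \<in> M" "norm (x - m) < infdist x M + e / t"
      using near[of "e/t" x] t by (metis divide_pos_pos)
    have "infdist (t *\<^sub>R x) M \<le> norm (t *\<^sub>R x - t *\<^sub>R m)"
      using m subspace_scale[OF M] by (intro le) auto
    also have "\<dots> = t * norm (x - m)"
      using that by (simp flip: scaleR_diff_right)
    also have "\<dots> \<le> t * (infdist x M + e / t)"
      using m that by (intro mult_left_mono) auto
    also have "\<dots> = t * infdist x M + e" using t by (simp add: distrib_left)
    finally show "infdist (t *\<^sub>R x) M \<le> t * infdist x M + e" .
  qed
  have "infdist (t *\<^sub>R x) M = t * infdist x M" if "t \<ge> 0" for t x
  proof (cases "t = 0")
    case True
    then show ?thesis using subspace_0[OF M] by simp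
  next
    case False
    then show ?thesis
      using sc[of t x] sc[of "inverse t" "t *\<^sub>R x"] that by (simp add: field_simps)
  qed
  then show ?thesis using add by (simp add: sublinear_def)
qed

text \<open>The distance to \<open>M\<close> is sublinear, and lowering it along \<open>x\<close>
  makes the value at \<open>- x\<close> at most \<open>- infdist x M\<close>, so a linear minorant
  attains the distance at \<open>x\<close>. Domination by the distance bounds \<open>u\<close> by
  the norm and makes it vanish on \<open>M\<close>, where the distance is 0 at both \<open>m\<close>
  and \<open>- m\<close>.\<close>

theorem Hahn_Banach_infdist:
  fixes M :: "'a::real_normed_vector set"
  assumes M: "subspace M"
  obtains u where "linear u" "\<And>y. \<bar>u y\<bar> \<le> norm y" "\<And>m. m \<in> M \<Longrightarrow> u m = 0" "u x = infdist x M"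
proof -
  let ?p = "\<lambda>x. infdist x M"
  note p = sublinear_infdist[OF M]
  obtain u where u: "linear u" "u \<le> lower_along x ?p"
    using Hahn_Banach_sublinear[OF sublinear_lower_along[OF p]] by blast
  have up: "u y \<le> infdist y M" for y
    using u(2) lower_along_le[OF p, of 0 x y] by (auto simp: le_fun_def intro: order_trans)
  have "u (- x) \<le> - infdist x M"
    using u(2) lower_along_le[OF p, of 1 x "- x"] subspace_0[OF M]
    by (auto simp: le_fun_def intro: order_trans)
  then have ux: "u x = infdist x M"
    using up[of x] by (simp add: linear_neg[OF u(1)])
  have norm: "infdist y M \<le> norm y" for y
    using infdist_le[OF subspace_0[OF M], of y] by simp
  have "\<bar>u y\<bar> \<le> norm y" for y
    using up[of y] up[of "- y"] norm[of y] norm[of "- y"] linear_neg[OF u(1), of y] by simp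
  moreover have "u m = 0" if "m \<in> M" for m
    using up[of m] up[of "- m"] that subspace_neg[OF M that] linear_neg[OF u(1), of m] by simp
  ultimately show ?thesis by (rule that[OF u(1) _ _ ux])
qed

section \<open>Projections onto copies of the space of null sequences\<close>

lemma apply_linf_scale [simp]: "apply_bcontfun (linf_scale c f) n = c * apply_bcontfun f n"
  by (simp add: linf_scale.rep_eq)

lemma apply_char_seq [simp]: "apply_bcontfun (char_seq A) n = (if n \<in> A then 1 else 0)"
  by (simp add: char_seq.rep_eq)

lemma apply_linf_sum [simp]:
  "apply_bcontfun (\<Sum>i\<in>I. f i) (n::nat) = (\<Sum>i\<in>I. apply_bcontfun (f i :: 'k::real_normed_field linf) n)"
  by (induction I rule: infinite_finite_induct) (auto simp: plus_bcontfun.rep_eq)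

lemmas apply_linf_simps [simp] = plus_bcontfun.rep_eq minus_bcontfun.rep_eq uminus_bcontfun.rep_eq
  const_bcontfun.rep_eq zero_bcontfun.rep_eq

lemma norm_linf_leI: "(\<And>n. norm (apply_bcontfun f n) \<le> B) \<Longrightarrow> norm (f :: 'k::real_normed_field linf) \<le> B"
  by (rule norm_bound)

lemma Bcontfun_bounded:
  fixes f :: "nat \<Rightarrow> 'k::real_normed_field"
  assumes "\<And>n. norm (f n) \<le> B"
  shows "apply_bcontfun (Bcontfun f) = f"
  using assms by (intro Bcontfun_inverse bcontfun_normI) auto

lemma c0_apply: "f \<in> c0 \<longleftrightarrow> apply_bcontfun f \<longlonglongrightarrow> 0"
  by (simp add: c0_def)

lemma subspace_c0: "linf.subspace (c0 :: 'k::{real_normed_field,banach} linf set)"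
proof (rule linf.subspaceI)
  fix x y :: "'k linf" and c :: 'k assume xy: "x \<in> c0" 
  show "linf_scale c x \<in> c0"
    using tendsto_mult_right_zero[of "apply_bcontfun x" sequentially c] xy by (simp add: c0_apply linf_scale.rep_eq)
  show "x + y \<in> c0" if "y \<in> c0"
    using tendsto_add[of "apply_bcontfun x" 0 sequentially "apply_bcontfun y" 0] xy that
    by (simp add: c0_apply)
qed (simp add: c0_apply)

lemma closed_c0: "closed (c0 :: 'k::{real_normed_field,banach} linf set)"
  unfolding closed_sequential_limits
proof (intro allI impI, elim conjE)
  fix f and g :: "'k linf" assume f: "\<forall>n. f n \<in> c0" and lim: "f \<longlonglongrightarrow> g"
  show "g \<in> c0"
    unfolding c0_apply
  proof (rule LIMSEQ_I)
    fix e :: real assume e: "e > 0"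
    obtain m where m: "norm (f m - g) < e / 2"
      using LIMSEQ_D[OF lim, of "e/2"] e by auto
    obtain k where k: "\<And>n. n \<ge> k \<Longrightarrow> norm (apply_bcontfun (f m) n) < e / 2"
      using LIMSEQ_D[of "apply_bcontfun (f m)" 0 "e/2"] f e by (auto simp: c0_apply)
    have "norm (apply_bcontfun g n - 0) < e" if "n \<ge> k" for n
    proof -
      have "norm (apply_bcontfun (f m - g) n) < e / 2"
        using norm_bounded[of "f m - g" n] m by linarith
      then show ?thesis
        using k[OF that] norm_triangle_ineq4[of "apply_bcontfun (f m) n" "apply_bcontfun (f m - g) n"]
        by simp
    qed
    then show "\<exists>k. \<forall>n\<ge>k. norm (apply_bcontfun g n - 0) < e" by blast
  qed
qed

text \<open>Indices are spread so far apart that a chosen row is small on all earlier columns,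
  because columns tend to 0, and small on all later chosen columns, because rows are summable. Each
  side is allotted \<open>e / 2\<close>.\<close>

lemma off_diagonal_subsequence:
  fixes A :: "nat \<Rightarrow> nat \<Rightarrow> real"
  assumes nonneg: "\<And>k j. A k j \<ge> 0"
    and null: "\<And>j. (\<lambda>k. A k j) \<longlonglongrightarrow> 0"
    and sum: "\<And>k. summable (A k)"
    and e: "e > 0"
  obtains r :: "nat \<Rightarrow> nat" where "strict_mono r"
    "\<And>i F. finite F \<Longrightarrow> i \<notin> F \<Longrightarrow> (\<Sum>j\<in>F. A (r i) (r j)) \<le> e"
proof -
  \<comment> \<open>One threshold serves both demands: rows beyond \<open>h\<close> on columns up to
    \<open>m\<close>, and rows up to \<open>m\<close> on columns beyond \<open>h\<close>.\<close>
  have "\<exists>h. (\<forall>k\<ge>h. (\<Sum>j\<le>m. A k j) \<le> e / 2) \<and> (\<forall>l\<le>m. \<forall>n. (\<Sum>j\<in>{h..<n}. A l j) \<le> e / 2)" for m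
  proof -
    have "(\<lambda>k. \<Sum>j\<le>m. A k j) \<longlonglongrightarrow> 0"
      using tendsto_sum[of "{..m}" "\<lambda>j k. A k j" "\<lambda>_. 0" sequentially] null by simp
    then obtain h1 where h1: "\<And>k. k \<ge> h1 \<Longrightarrow> norm ((\<Sum>j\<le>m. A k j) - 0) < e / 2"
      using LIMSEQ_D[of _ 0 "e/2"] e by (metis half_gt_zero)
    have "\<forall>l. \<exists>h. \<forall>a\<ge>h. \<forall>b. norm (sum (A l) {a..<b}) < e / 2"
      using sum[unfolded summable_Cauchy, rule_format, of "e/2"] e by simp
    then obtain H where H: "\<And>l a b. a \<ge> H l \<Longrightarrow> norm (sum (A l) {a..<b}) < e / 2"
      by metis
    show ?thesis
    proof (intro exI[of _ "max h1 (Max (H ` {..m}))"] conjI allI impI)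
      fix k assume "max h1 (Max (H ` {..m})) \<le> k"
      then show "(\<Sum>j\<le>m. A k j) \<le> e / 2" using h1[of k] by simp
    next
      fix l n assume "l \<le> m"
      then have "H l \<le> max h1 (Max (H ` {..m}))"
        by (auto intro: max.coboundedI2)
      then have "norm (\<Sum>j\<in>{max h1 (Max (H ` {..m}))..<n}. A l j) < e / 2" by (rule H)
      then show "(\<Sum>j\<in>{max h1 (Max (H ` {..m}))..<n}. A l j) \<le> e / 2" by simp
    qed
  qed
  then obtain h where h: "\<And>m k. k \<ge> h m \<Longrightarrow> (\<Sum>j\<le>m. A k j) \<le> e / 2"
      "\<And>m l n. l \<le> m \<Longrightarrow> (\<Sum>j\<in>{h m..<n}. A l j) \<le> e / 2"
    by metis
  define r where "r = rec_nat 0 (\<lambda>_ m. max (Suc m) (h m))"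
  have r: "r (Suc i) > r i" "r (Suc i) \<ge> h (r i)" for i
    by (auto simp: r_def)
  have mono: "strict_mono r" using r(1) by (simp add: strict_mono_Suc_iff)
  have "(\<Sum>j\<in>F. A (r i) (r j)) \<le> e" if F: "finite F" "i \<notin> F" for i F
  proof -
    let ?L = "F \<inter> {..<i}" and ?U = "F \<inter> {i<..}"
    have inj: "inj_on r S" for S using strict_mono_imp_inj_on[OF mono] by (rule inj_on_subset) auto
    have "(\<Sum>j\<in>?L. A (r i) (r j)) \<le> e / 2"
    proof (cases i)
      case (Suc i')
      have "(\<Sum>j\<in>?L. A (r i) (r j)) = sum (A (r i)) (r ` ?L)"
        by (simp add: sum.reindex[OF inj])
      also have "\<dots> \<le> sum (A (r i)) {..r i'}"
        using Suc by (intro sum_mono2) (auto simp: nonneg strict_mono_less_eq[OF mono])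
      also have "\<dots> \<le> e / 2" using Suc r(2) by (intro h(1)) auto
      finally show ?thesis .
    qed (use e in auto)
    moreover have "(\<Sum>j\<in>?U. A (r i) (r j)) \<le> e / 2"
    proof -
      have "(\<Sum>j\<in>?U. A (r i) (r j)) = sum (A (r i)) (r ` ?U)"
        by (simp add: sum.reindex[OF inj])
      also have "\<dots> \<le> sum (A (r i)) {h (r i)..<Suc (Max (r ` F))}"
      proof (rule sum_mono2)
        show "r ` ?U \<subseteq> {h (r i)..<Suc (Max (r ` F))}"
        proof clarsimp
          fix j assume j: "j \<in> F" "i < j"
          then have "r (Suc i) \<le> r j" by (simp add: strict_mono_less_eq[OF mono])
          then show "h (r i) \<le> r j \<and> r j < Suc (Max (r ` F))"
            using r(2)[of i] j F by (auto simp: less_Suc_eq_le)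
        qed
      qed (auto simp: nonneg)
      also have "\<dots> \<le> e / 2" by (rule h(2)) simp
      finally show ?thesis .
    qed
    moreover have "(\<Sum>j\<in>F. A (r i) (r j)) = (\<Sum>j\<in>?L \<union> ?U. A (r i) (r j))"
      using F by (intro sum.cong) (auto simp: not_less_iff_gr_or_eq)
    moreover have "\<dots> = (\<Sum>j\<in>?L. A (r i) (r j)) + (\<Sum>j\<in>?U. A (r i) (r j))"
      using F by (intro sum.union_disjoint) auto
    ultimately show ?thesis by linarith
  qed
  then show ?thesis by (rule that[OF mono])
qed

section \<open>Bounded functionals and upper \<open>c0\<close>-estimates\<close>

context banach_over
begin

text \<open>Everything is relative to \<open>X\<close>, because the limits that serve as functionals
  exist only there. The bound \<open>K\<close> is explicit so that a sequence of functionals can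
  share it.\<close>

definition functional_on :: "'a set \<Rightarrow> real \<Rightarrow> ('a \<Rightarrow> 'k) \<Rightarrow> bool" where
  "functional_on X K \<phi> \<longleftrightarrow>
     (\<forall>x\<in>X. \<forall>y\<in>X. \<phi> (x + y) = \<phi> x + \<phi> y) \<and>
     (\<forall>c. \<forall>x\<in>X. \<phi> (c *k x) = c * \<phi> x) \<and>
     (\<forall>x\<in>X. norm (\<phi> x) \<le> K * norm x)"

lemma functional_on_add: "functional_on X K \<phi> \<Longrightarrow> x \<in> X \<Longrightarrow> y \<in> X \<Longrightarrow> \<phi> (x + y) = \<phi> x + \<phi> y"
  and functional_on_scale: "functional_on X K \<phi> \<Longrightarrow> x \<in> X \<Longrightarrow> \<phi> (c *k x) = c * \<phi> x"
  and functional_on_norm: "functional_on X K \<phi> \<Longrightarrow> x \<in> X \<Longrightarrow> norm (\<phi> x) \<le> K * norm x"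
  by (simp_all add: functional_on_def)

lemma functional_on_zero: "functional_on X K \<phi> \<Longrightarrow> subspace X \<Longrightarrow> \<phi> 0 = 0"
  using functional_on_scale[of X K \<phi> 0 0] subspace_0 by simp

lemma functional_on_diff:
  assumes "functional_on X K \<phi>" "subspace X" "x \<in> X" "y \<in> X"
  shows "\<phi> (x - y) = \<phi> x - \<phi> y"
  using functional_on_add[OF assms(1), of "x - y" y] assms by (simp add: subspace_diff)

lemma functional_on_sum:
  assumes "functional_on X K \<phi>" "subspace X" "\<And>i. i \<in> I \<Longrightarrow> x i \<in> X"
  shows "\<phi> (\<Sum>i\<in>I. c i *k x i) = (\<Sum>i\<in>I. c i * \<phi> (x i))"
  using assms(3)
proof (induction I rule: infinite_finite_induct)
  case (insert i I)
  then show ?case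
    using assms(1,2) by (simp add: functional_on_add subspace_sum subspace_scale functional_on_scale)
qed (auto simp: functional_on_zero[OF assms(1,2)])

lemma functional_on_subset: "functional_on X K \<phi> \<Longrightarrow> Y \<subseteq> X \<Longrightarrow> functional_on Y K \<phi>"
  unfolding functional_on_def by blast

lemma functional_on_limit:
  assumes \<psi>: "\<And>k. functional_on X K (\<psi> k)" and lim: "\<And>x. x \<in> X \<Longrightarrow> (\<lambda>k::nat. \<psi> k x) \<longlonglongrightarrow> \<psi>' x"
    and X: "subspace X"
  shows "functional_on X K \<psi>'"
  unfolding functional_on_def
proof (intro conjI ballI allI)
  fix x y c assume x: "x \<in> X" 
  show "norm (\<psi>' x) \<le> K * norm x"
    by (rule LIMSEQ_le_const2[OF tendsto_norm[OF lim[OF x]]]) (use functional_on_norm[OF \<psi> x] in blast)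
  have "(\<lambda>k. \<psi> k (c *k x)) \<longlonglongrightarrow> c * \<psi>' x"
    using tendsto_mult_left[OF lim[OF x]] functional_on_scale[OF \<psi> x] by simp
  then show "\<psi>' (c *k x) = c * \<psi>' x"
    using lim[OF subspace_scale[OF X x]] LIMSEQ_unique by blast
  assume y: "y \<in> X"
  have "(\<lambda>k. \<psi> k (x + y)) \<longlonglongrightarrow> \<psi>' x + \<psi>' y"
    using tendsto_add[OF lim[OF x] lim[OF y]] functional_on_add[OF \<psi> x y] by simp
  then show "\<psi>' (x + y) = \<psi>' x + \<psi>' y"
    using lim[OF subspace_add[OF X x y]] LIMSEQ_unique by blast
qed

lemma functional_on_tendsto:
  assumes \<phi>: "functional_on X K \<phi>" "subspace X" and f: "\<And>n. f n \<in> X" "x \<in> X" "f \<longlonglongrightarrow> x"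
  shows "(\<lambda>n. \<phi> (f n)) \<longlonglongrightarrow> \<phi> x"
proof -
  have "(\<lambda>n. \<phi> (f n) - \<phi> x) \<longlonglongrightarrow> 0"
  proof (rule tendsto_0_le[where K = K and f = "\<lambda>n. f n - x"])
    show "(\<lambda>n. f n - x) \<longlonglongrightarrow> 0" using f(3) by (rule LIM_zero)
    show "\<forall>\<^sub>F n in sequentially. norm (\<phi> (f n) - \<phi> x) \<le> norm (f n - x) * K"
      using functional_on_norm[OF \<phi>(1) subspace_diff[OF \<phi>(2)]] f functional_on_diff[OF \<phi>]
      by (auto simp: mult.commute)
  qed
  then show ?thesis by (simp add: LIM_zero_iff)
qed

text \<open>The upper estimate: the linear map sending the unit vectors of \<open>c0\<close> to the
  \<open>x j\<close> has norm at most \<open>D\<close> on finitely supported sequences. A free bound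
  \<open>B\<close> in place of a maximum avoids treating the empty \<open>F\<close>
  separately.\<close>

definition c0_bounded :: "real \<Rightarrow> (nat \<Rightarrow> 'a) \<Rightarrow> bool" where
  "c0_bounded D x \<longleftrightarrow>
     (\<forall>F a B. finite F \<longrightarrow> 0 \<le> B \<longrightarrow> (\<forall>j\<in>F. norm (a j) \<le> B) \<longrightarrow> norm (\<Sum>j\<in>F. a j *k x j) \<le> D * B)"

lemma c0_boundedD:
  "c0_bounded D x \<Longrightarrow> finite F \<Longrightarrow> 0 \<le> B \<Longrightarrow> (\<And>j. j \<in> F \<Longrightarrow> norm (a j) \<le> B) \<Longrightarrow> norm (\<Sum>j\<in>F. a j *k x j) \<le> D * B"
  by (auto simp: c0_bounded_def)

lemma c0_bounded_subseq:
  assumes "c0_bounded D x" "inj (r :: nat \<Rightarrow> nat)"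
  shows "c0_bounded D (x \<circ> r)"
  unfolding c0_bounded_def
proof (intro allI impI)
  fix F :: "nat set" and a B assume F: "finite F" "0 \<le> (B::real)" "\<forall>j\<in>F. norm (a j :: 'k) \<le> B"
  have "(\<Sum>j\<in>F. a j *k (x \<circ> r) j) = (\<Sum>j\<in>r ` F. a (inv r j) *k x j)"
    using assms(2) by (subst sum.reindex) (auto intro: inj_on_subset)
  moreover have "norm (\<Sum>j\<in>r ` F. a (inv r j) *k x j) \<le> D * B"
    using F inv_f_f[OF assms(2)] by (intro c0_boundedD[OF assms(1)]) auto
  ultimately show "norm (\<Sum>j\<in>F. a j *k (x \<circ> r) j) \<le> D * B" by simp
qed

text \<open>This is the duality between \<open>c0\<close> and the absolutely summable sequences:
  coefficients of modulus at most one align the values \<open>\<phi> (x j)\<close>, so that the sum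
  of their norms is the value of \<open>\<phi>\<close> at one vector of norm at most
  \<open>D\<close>.\<close>

lemma c0_bounded_summable:
  assumes x: "c0_bounded D x" "\<And>j. x j \<in> X" and \<phi>: "functional_on X K \<phi>" "subspace X" and K: "K \<ge> 0"
  shows "summable (\<lambda>j. norm (\<phi> (x j)))"
proof (rule bounded_imp_summable)
  fix n
  \<comment> \<open>Where \<open>\<phi> (x j)\<close> is 0, division by zero makes the coefficient
    0, in agreement with the norm being 0 there.\<close>
  define s where "s = (\<lambda>j. of_real (norm (\<phi> (x j))) / \<phi> (x j))"
  have "of_real (\<Sum>j\<le>n. norm (\<phi> (x j))) = \<phi> (\<Sum>j\<le>n. s j *k x j)"
    by (subst functional_on_sum[OF \<phi>]) (auto simp: s_def x intro!: sum.cong)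
  also have "norm \<dots> \<le> K * norm (\<Sum>j\<le>n. s j *k x j)"
    using x \<phi> by (intro functional_on_norm) (auto intro: subspace_sum subspace_scale)
  also have "\<dots> \<le> K * (D * 1)"
    using K by (intro mult_left_mono c0_boundedD[OF x(1)]) (auto simp: s_def norm_divide)
  finally show "(\<Sum>j\<le>n. norm (\<phi> (x j))) \<le> K * D"
    by (simp add: sum_nonneg del: of_real_sum)
qed simp

lemma c0_bounded_summable_scale:
  assumes x: "c0_bounded D x" and a: "a \<in> c0"
  shows "summable (\<lambda>j. apply_bcontfun a j *k x j)"
proof (rule summable_Cauchy[THEN iffD2], intro allI impI)
  fix e :: real assume e: "e > 0"
  \<comment> \<open>The shift by 1 keeps the denominator positive when \<open>D\<close> is 0; the
    factor 2 below makes the final inequality strict.\<close>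
  let ?D = "\<bar>D\<bar> + 1"
  obtain k where k: "\<And>n. n \<ge> k \<Longrightarrow> norm (apply_bcontfun a n) < e / (2 * ?D)"
    using LIMSEQ_D[of "apply_bcontfun a" 0 "e / (2 * ?D)"] e a by (auto simp: c0_apply)
  have "norm (\<Sum>j\<in>{m..<n}. apply_bcontfun a j *k x j) < e" if "m \<ge> k" for m n
  proof -
    have "norm (\<Sum>j\<in>{m..<n}. apply_bcontfun a j *k x j) \<le> D * (e / (2 * ?D))"
      using k that e by (intro c0_boundedD[OF x]) (auto intro!: less_imp_le)
    also have "\<dots> \<le> ?D * (e / (2 * ?D))" using e by (intro mult_right_mono) auto
    also have "\<dots> < e" using e by (simp add: field_simps add_pos_nonneg)
    finally show ?thesis .
  qed
  then show "\<exists>k. \<forall>m\<ge>k. \<forall>n. norm (\<Sum>j\<in>{m..<n}. apply_bcontfun a j *k x j) < e" by blast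
qed

end

text \<open>A Neumann series in fixed-point form: \<open>T a = b\<close> says that \<open>a\<close>
  is fixed by \<open>\<lambda>a. b - (T a - a)\<close>, a contraction with factor 1/2 on the
  complete set \<open>c0\<close>. The lower bound \<open>norm a \<le> 2 * norm (T a)\<close>, also
  from \<open>near\<close>, gives the bound on \<open>R\<close> and uniqueness, from which linearity
  of the inverse follows.\<close>

lemma c0_near_identity_inverse:
  fixes T :: "'k::{real_normed_field,banach} linf \<Rightarrow> 'k linf"
  assumes T: "\<And>a. a \<in> c0 \<Longrightarrow> T a \<in> c0"
    and add: "\<And>a b. a \<in> c0 \<Longrightarrow> b \<in> c0 \<Longrightarrow> T (a + b) = T a + T b"
    and scale: "\<And>c a. a \<in> c0 \<Longrightarrow> T (linf_scale c a) = linf_scale c (T a)"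
    and near: "\<And>a. a \<in> c0 \<Longrightarrow> norm (T a - a) \<le> norm a / 2"
  obtains R where "\<And>a. a \<in> c0 \<Longrightarrow> R a \<in> c0" "\<And>a. a \<in> c0 \<Longrightarrow> R (T a) = a"
    "\<And>a b. a \<in> c0 \<Longrightarrow> b \<in> c0 \<Longrightarrow> R (a + b) = R a + R b"
    "\<And>c a. a \<in> c0 \<Longrightarrow> R (linf_scale c a) = linf_scale c (R a)"
    "\<And>a. a \<in> c0 \<Longrightarrow> norm (R a) \<le> 2 * norm a"
proof -
  note sub = linf.subspace_diff[OF subspace_c0[where 'k = 'k]] linf.subspace_add[OF subspace_c0[where 'k = 'k]]
    linf.subspace_scale[OF subspace_c0[where 'k = 'k]] linf.subspace_0[OF subspace_c0[where 'k = 'k]]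
  have diff: "T (a - b) = T a - T b" if "a \<in> c0" "b \<in> c0" for a b
    using add[of "a - b" b] that sub by (simp add: algebra_simps)
  have ex: "\<exists>a\<in>c0. T a = b" if b: "b \<in> c0" for b
  proof -
    have "\<exists>!a\<in>c0. b - (T a - a) = a"
    proof (rule Banach_fix[where c = "1/2"])
      show "complete (c0 :: 'k linf set)" using closed_c0 by (rule complete_eq_closed[THEN iffD2])
      fix a a' :: "'k linf" assume a: "a \<in> c0" "a' \<in> c0"
      have "dist (b - (T a - a)) (b - (T a' - a')) = norm (T (a' - a) - (a' - a))"
        by (simp only: diff[OF a(2,1)] dist_norm) (simp add: algebra_simps)
      also have "\<dots> \<le> 1/2 * dist a a'"
        using near[of "a' - a"] a sub by (simp add: dist_norm norm_minus_commute)
      finally show "dist (b - (T a - a)) (b - (T a' - a')) \<le> 1/2 * dist a a'" .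
    qed (use b T sub in auto)
    then obtain a where "a \<in> c0" "b - (T a - a) = a" by blast
    then show ?thesis by (intro bexI[of _ a]) (auto simp: algebra_simps)
  qed
  define R where "R = (\<lambda>b. SOME a. a \<in> c0 \<and> T a = b)"
  have R: "R b \<in> c0" "T (R b) = b" if "b \<in> c0" for b
    using someI_ex[of "\<lambda>a. a \<in> c0 \<and> T a = b"] ex[OF that] by (auto simp: R_def)
  have low: "norm a \<le> 2 * norm (T a)" if "a \<in> c0" for a
    using near[OF that] norm_triangle_ineq2[of a "T a"] by (simp add: norm_minus_commute)
  have inj: "a = b" if "a \<in> c0" "b \<in> c0" "T a = T b" for a b
    using low[of "a - b"] that diff sub by simp
  show ?thesis
  proof (rule that[of R])
    show "R (T a) = a" if "a \<in> c0" for a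
      by (rule inj) (use that R T in auto)
    show "R (a + b) = R a + R b" if "a \<in> c0" "b \<in> c0" for a b
      by (rule inj) (use that R add sub in auto)
    show "R (linf_scale c a) = linf_scale c (R a)" if "a \<in> c0" for a c
      by (rule inj) (use that R scale sub in auto)
    show "norm (R a) \<le> 2 * norm a" if "a \<in> c0" for a
      using low[of "R a"] R that by simp
  qed (use R in auto)
qed

context banach_over
begin

lemma tendsto_scale:
  assumes "(f \<longlongrightarrow> x) F"
  shows "((\<lambda>n. c *k f n) \<longlongrightarrow> c *k x) F"
proof -
  have "((\<lambda>n. c *k (f n - x)) \<longlongrightarrow> 0) F"
    by (rule tendsto_norm_zero_cancel)
      (simp add: norm_scale tendsto_mult_right_zero LIM_zero tendsto_norm_zero assms)
  then show ?thesis
    by (simp add: scale_right_diff_distrib LIM_zero_iff)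
qed

text \<open>The matrix of \<open>VU\<close> has entries \<open>\<xi> i (z j)\<close>: ones on the
  diagonal and off it rows of absolute sum at most 1/2, so \<open>VU\<close> is within 1/2 of the
  identity for the supremum norm. That the \<open>\<xi> i\<close> tend to 0 pointwise puts
  \<open>V f\<close> into \<open>c0\<close>, where \<open>U\<close> is given by a convergent
  series.\<close>

lemma almost_biorthogonal_c0_projection:
  assumes X: "subspace X" "closed X"
    and z: "\<And>j. z j \<in> X" "c0_bounded D z"
    and \<xi>: "\<And>i. functional_on X C (\<xi> i)" "\<And>f. f \<in> X \<Longrightarrow> (\<lambda>i. \<xi> i f) \<longlonglongrightarrow> 0"
    and diag: "\<And>i. \<xi> i (z i) = 1"
    and off: "\<And>i F. finite F \<Longrightarrow> i \<notin> F \<Longrightarrow> (\<Sum>j\<in>F. norm (\<xi> i (z j))) \<le> 1 / 2"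
  obtains P where "bounded_projection X P" "infinite_dim (P ` X)"
    "P ` X \<subseteq> closure (span (range z))" "\<And>f. f \<in> X \<Longrightarrow> (\<And>i. \<xi> i f = 0) \<Longrightarrow> P f = 0"
proof -
  define U where "U = (\<lambda>a :: 'k linf. \<Sum>j. apply_bcontfun a j *k z j)"
  define V where "V = (\<lambda>f. Bcontfun (\<lambda>i. \<xi> i f) :: 'k linf)"
  note sub = linf.subspace_diff[OF subspace_c0[where 'k = 'k]] linf.subspace_add[OF subspace_c0[where 'k = 'k]]
    linf.subspace_scale[OF subspace_c0[where 'k = 'k]] linf.subspace_0[OF subspace_c0[where 'k = 'k]]
  have U_sums: "(\<lambda>j. apply_bcontfun a j *k z j) sums U a" if "a \<in> c0" for a
    unfolding U_def using c0_bounded_summable_scale[OF z(2) that] by (rule summable_sums)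
  have U_lim: "(\<lambda>n. \<Sum>j<n. apply_bcontfun a j *k z j) \<longlonglongrightarrow> U a" if "a \<in> c0" for a
    using U_sums[OF that] by (simp add: sums_def)
  have partX: "(\<Sum>j\<in>F. apply_bcontfun a j *k z j) \<in> X" for a F
    by (intro subspace_sum X subspace_scale z)
  have partS: "(\<Sum>j\<in>F. apply_bcontfun a j *k z j) \<in> span (range z)" for a F
    by (intro span_sum span_scale span_base) auto
  have U_cl: "U a \<in> closure (span (range z))" if "a \<in> c0" for a
    using U_lim[OF that]
    by (rule Lim_in_closed_set[OF closed_closure, rotated 2]) (use partS closure_subset in \<open>auto intro!: always_eventually subsetD[OF closure_subset]\<close>)
  have UX: "U a \<in> X" if "a \<in> c0" for a
    using U_lim[OF that] by (rule Lim_in_closed_set[OF X(2), rotated 2]) (auto intro!: always_eventually partX)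
  have U_add: "U (a + b) = U a + U b" if "a \<in> c0" "b \<in> c0" for a b
    using sums_add[OF U_sums[OF that(1)] U_sums[OF that(2)]] U_sums[of "a + b"] sub that
    by (auto simp: scale_left_distrib intro: sums_unique2)
  have U_scale: "U (linf_scale c a) = c *k U a" if "a \<in> c0" for a c
  proof -
    have "(\<lambda>n. c *k (\<Sum>j<n. apply_bcontfun a j *k z j)) \<longlonglongrightarrow> c *k U a"
      by (intro tendsto_scale U_lim that)
    then show ?thesis
      using U_lim[of "linf_scale c a"] that sub
      by (auto simp: scale_sum_right intro: LIMSEQ_unique)
  qed
  have U_norm: "norm (U a) \<le> D * norm a" if "a \<in> c0" for a
    by (rule LIMSEQ_le_const2[OF tendsto_norm[OF U_lim[OF that]]])
       (auto intro!: c0_boundedD[OF z(2)] norm_bounded)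
  have V_app: "apply_bcontfun (V f) = (\<lambda>i. \<xi> i f)" if "f \<in> X" for f
    unfolding V_def using functional_on_norm[OF \<xi>(1) that] by (rule Bcontfun_bounded)
  have V_c0: "V f \<in> c0" if "f \<in> X" for f
    using \<xi>(2)[OF that] by (simp add: c0_apply V_app that)
  have V_add: "V (f + g) = V f + V g" if "f \<in> X" "g \<in> X" for f g
    using that X by (intro bcontfun_eqI) (simp add: V_app subspace_add functional_on_add[OF \<xi>(1)])
  have V_scale: "V (c *k f) = linf_scale c (V f)" if "f \<in> X" for f c
    using that X by (intro bcontfun_eqI) (simp add: V_app subspace_scale functional_on_scale[OF \<xi>(1)])
  have V_norm: "norm (V f) \<le> C * norm f" if "f \<in> X" for f
    using that functional_on_norm[OF \<xi>(1)] by (intro norm_linf_leI) (simp add: V_app)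
  have near: "norm (V (U a) - a) \<le> norm a / 2" if a: "a \<in> c0" for a
  proof (rule norm_linf_leI)
    fix i
    have "(\<lambda>n. \<xi> i (\<Sum>j<n. apply_bcontfun a j *k z j)) \<longlonglongrightarrow> \<xi> i (U a)"
      by (rule functional_on_tendsto[OF \<xi>(1) X(1) partX UX[OF a] U_lim[OF a]])
    then have "(\<lambda>n. (\<Sum>j<n. apply_bcontfun a j * \<xi> i (z j)) - apply_bcontfun a i)
        \<longlonglongrightarrow> \<xi> i (U a) - apply_bcontfun a i"
      by (intro tendsto_diff) (simp_all add: functional_on_sum[OF \<xi>(1) X(1) z(1)])
    then have "norm (\<xi> i (U a) - apply_bcontfun a i) \<le> norm a / 2"
    proof (rule LIMSEQ_le_const2[OF tendsto_norm], intro exI[of _ "Suc i"] allI impI)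
      fix n assume "Suc i \<le> n"
      \<comment> \<open>Once \<open>n\<close> exceeds \<open>i\<close>, the diagonal term equals
        coordinate \<open>i\<close> of \<open>a\<close> and cancels; only off-diagonal terms
        remain.\<close>
      then have "(\<Sum>j<n. apply_bcontfun a j * \<xi> i (z j)) - apply_bcontfun a i
          = (\<Sum>j\<in>{..<n} - {i}. apply_bcontfun a j * \<xi> i (z j))"
        by (subst sum.remove[of _ i]) (auto simp: diag)
      also have "norm \<dots> \<le> (\<Sum>j\<in>{..<n} - {i}. norm a * norm (\<xi> i (z j)))"
        by (intro sum_norm_le) (auto simp: norm_mult intro!: mult_right_mono norm_bounded)
      also have "\<dots> = norm a * (\<Sum>j\<in>{..<n} - {i}. norm (\<xi> i (z j)))"
        by (simp add: sum_distrib_left)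
      also have "\<dots> \<le> norm a * (1 / 2)"
        by (intro mult_left_mono off) auto
      finally show "norm ((\<Sum>j<n. apply_bcontfun a j * \<xi> i (z j)) - apply_bcontfun a i) \<le> norm a / 2"
        by simp
    qed
    then show "norm (apply_bcontfun (V (U a) - a) i) \<le> norm a / 2"
      by (simp add: V_app UX a)
  qed
  have VU: "V (U a) \<in> c0" "V (U (linf_scale c a)) = linf_scale c (V (U a))" if "a \<in> c0" for a c
    using that by (simp_all add: V_c0 UX U_scale V_scale)
  have VU_add: "V (U (a + b)) = V (U a) + V (U b)" if "a \<in> c0" "b \<in> c0" for a b
    using that by (simp add: UX U_add V_add)
  from c0_near_identity_inverse[of "\<lambda>a. V (U a)", OF VU(1) VU_add VU(2) near]
  obtain R where R: "\<And>a. a \<in> c0 \<Longrightarrow> R a \<in> c0" "\<And>a. a \<in> c0 \<Longrightarrow> R (V (U a)) = a"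
    "\<And>a b. a \<in> c0 \<Longrightarrow> b \<in> c0 \<Longrightarrow> R (a + b) = R a + R b"
    "\<And>c a. a \<in> c0 \<Longrightarrow> R (linf_scale c a) = linf_scale c (R a)"
    "\<And>a. a \<in> c0 \<Longrightarrow> norm (R a) \<le> 2 * norm a"
    by blast
  define P where "P = (\<lambda>f. U (R (V f)))"
  have PU: "P (U a) = U a" if "a \<in> c0" for a
    using R(2)[OF that] by (simp add: P_def)
  have D0: "D \<ge> 0"
    using c0_boundedD[OF z(2), of "{}" 1] by simp
  have proj: "bounded_projection X P"
    unfolding bounded_projection_def
  proof (intro conjI ballI allI)
    show "P ` X \<subseteq> X" by (auto simp: P_def UX R V_c0)
    show "\<exists>K. \<forall>x\<in>X. norm (P x) \<le> K * norm x"
    proof (intro exI ballI)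
      fix f assume f: "f \<in> X"
      have "norm (P f) \<le> D * norm (R (V f))"
        using f by (simp add: P_def U_norm R V_c0)
      also have "\<dots> \<le> D * (2 * (C * norm f))"
        using R(5)[OF V_c0[OF f]] V_norm[OF f] by (intro mult_left_mono D0) simp
      finally show "norm (P f) \<le> (D * 2 * C) * norm f" by (simp add: mult.assoc)
    qed
    fix f assume f: "f \<in> X"
    show "P (P f) = P f" using f by (simp add: P_def R V_c0)
    show "P (c *k f) = c *k P f" for c using f by (simp add: P_def V_scale R V_c0 U_scale)
    fix g assume "g \<in> X"
    then show "P (f + g) = P f + P g" using f by (simp add: P_def V_add R V_c0 U_add)
  qed
  have inj: "a = 0" if a: "a \<in> c0" "U a = 0" for a
  proof -
    have "V (U a) = 0"
      using V_scale[of 0 0] subspace_0[OF X(1)] a(2) by simp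
    then show ?thesis using near[OF a(1)] by simp
  qed
  \<comment> \<open>The coefficients of a finite linear combination of the \<open>z j\<close>,
    packed as an element of \<open>c0\<close>: \<open>U\<close> maps it to the combination, so
    injectivity of \<open>U\<close> gives independence of the \<open>z j\<close>. Coefficients are
    indexed by vectors, as in the criterion for independence.\<close>
  define fs where "fs = (\<lambda>F u. Bcontfun (\<lambda>j. if j \<in> F then u (z j) else 0) :: 'k linf)"
  have fs_app: "apply_bcontfun (fs F u) = (\<lambda>j. if j \<in> F then u (z j) else 0)"
    if "finite F" for F u
    unfolding fs_def
    by (rule Bcontfun_bounded[of _ "\<Sum>j\<in>F. norm (u (z j))"])
       (auto simp: that sum_nonneg intro: member_le_sum)
  have fs_c0: "fs F u \<in> c0" if "finite F" for F u
  proof -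
    have "\<forall>\<^sub>F j in sequentially. (if j \<in> F then u (z j) else 0) = 0"
      unfolding cofinite_eq_sequentially[symmetric] eventually_cofinite
      by (rule finite_subset[OF _ that]) auto
    then show ?thesis
      unfolding c0_apply fs_app[OF that] by (rule tendsto_eventually)
  qed
  have U_fs: "U (fs F u) = (\<Sum>j\<in>F. u (z j) *k z j)" if "finite F" for F u
  proof -
    have "(\<lambda>j. apply_bcontfun (fs F u) j *k z j) sums (\<Sum>j\<in>F. apply_bcontfun (fs F u) j *k z j)"
      by (rule sums_finite) (use that in \<open>auto simp: fs_app\<close>)
    then show ?thesis
      using sums_unique2[OF U_sums[OF fs_c0[OF that]]] by (simp add: fs_app that)
  qed
  \<comment> \<open>Equal vectors would produce an off-diagonal entry 1, above the permitted
    1/2.\<close>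
  have z_inj: "inj z"
  proof (rule injI, rule ccontr)
    fix i j assume ij: "z i = z j" "i \<noteq> j"
    then show False using off[of "{j}" i] diag[of i] by simp
  qed
  have indep: "independent (range z)"
    unfolding independent_explicit_module
  proof (intro allI impI)
    fix t u v assume t: "finite t" "t \<subseteq> range z" "(\<Sum>v\<in>t. u v *k v) = 0" "v \<in> t"
    define F where "F = z -` t"
    have F: "finite F" "t = z ` F"
      using t(1,2) z_inj by (auto simp: F_def intro: finite_vimageI)
    have "U (fs F u) = 0"
      using t(3) F z_inj by (simp add: U_fs sum.reindex inj_on_subset)
    then have "fs F u = 0" by (intro inj fs_c0 F)
    moreover obtain j where "j \<in> F" "v = z j" using t F by auto
    ultimately show "u v = 0" using fs_app[OF F(1), of u] by (auto dest!: fun_cong[where x = j])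
  qed
  have z_range: "z j \<in> P ` X" for j
  proof -
    have "z j = U (fs {j} (\<lambda>_. 1))" by (simp add: U_fs)
    then have "z j = P (z j)" using PU[OF fs_c0[of "{j}" "\<lambda>_. 1"]] by simp
    then show ?thesis using z(1) by blast
  qed
  show ?thesis
  proof (rule that[OF proj])
    show "infinite_dim (P ` X)"
      unfolding infinite_dim_def
    proof (rule notI, elim exE conjE)
      fix B assume "finite B" "P ` X \<subseteq> span B"
      then have "finite (range z)"
        using independent_span_bound[OF _ indep, of B] z_range by blast
      then show False using z_inj by (simp add: finite_image_iff)
    qed
    show "P ` X \<subseteq> closure (span (range z))"
      by (auto simp: P_def R V_c0 U_cl)
    show "P f = 0" if f: "f \<in> X" "\<And>i. \<xi> i f = 0" for f
    proof -
      have "V f = 0" using f by (intro bcontfun_eqI) (simp add: V_app)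
      then show ?thesis
        using R(4)[OF sub(4), of 0] U_scale[OF sub(4), of 0] by (simp add: P_def)
    qed
  qed
qed

text \<open>Subtracting the limit \<open>\<psi>'\<close> makes the functionals null. It spoils the
  diagonal only finitely often, since the norms of \<open>\<psi>' (x j)\<close> are summable: past
  \<open>k0\<close> at least \<open>d / 2\<close> remains. Sparse indices then make the off-diagonal
  row sums small relative to the diagonal.\<close>

theorem c0_sequence_projection:
  assumes X: "subspace X" "closed X"
    and x: "\<And>j. x j \<in> X" "c0_bounded D x"
    and \<psi>: "\<And>k. functional_on X K (\<psi> k)" "\<And>f. f \<in> X \<Longrightarrow> convergent (\<lambda>k. \<psi> k f)"
    and d: "d > 0" "\<And>k. d \<le> norm (\<psi> k (x k))"
  obtains P where "bounded_projection X P" "infinite_dim (P ` X)"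
    "P ` X \<subseteq> closure (span (range x))" "\<And>f. f \<in> X \<Longrightarrow> (\<And>k. \<psi> k f = 0) \<Longrightarrow> P f = 0"
proof -
  define \<psi>' where "\<psi>' = (\<lambda>f. lim (\<lambda>k. \<psi> k f))"
  have lim: "(\<lambda>k. \<psi> k f) \<longlonglongrightarrow> \<psi>' f" if "f \<in> X" for f
    using \<psi>(2)[OF that] by (simp add: \<psi>'_def convergent_LIMSEQ_iff)
  have \<psi>': "functional_on X K \<psi>'"
    using \<psi>(1) lim X(1) by (rule functional_on_limit)
  \<comment> \<open>A negative \<open>K\<close> would force \<open>X\<close> to be trivial, whereas
    \<open>\<psi> 0\<close> is nonzero at \<open>x 0\<close>.\<close>
  have K: "K \<ge> 0"
  proof (rule ccontr)
    assume "\<not> K \<ge> 0"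
    moreover have "x 0 \<noteq> 0" using d functional_on_zero[OF \<psi>(1)[of 0] X(1)] by (metis norm_zero not_le)
    ultimately have "K * norm (x 0) < 0" by (simp add: mult_neg_pos)
    then show False using functional_on_norm[OF \<psi>(1)[of 0] x(1)[of 0]] by (smt (verit) norm_ge_zero)
  qed
  have "(\<lambda>j. norm (\<psi>' (x j))) \<longlonglongrightarrow> 0"
    using c0_bounded_summable[OF x(2,1) \<psi>' X(1) K] by (rule summable_LIMSEQ_zero)
  then obtain k0 where k0: "\<And>j. j \<ge> k0 \<Longrightarrow> norm (\<psi>' (x j)) < d / 2"
    using LIMSEQ_D[of "\<lambda>j. norm (\<psi>' (x j))" 0 "d/2"] d by auto
  define \<phi> where "\<phi> = (\<lambda>k f. \<psi> (k + k0) f - \<psi>' f)"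
  define y where "y = (\<lambda>j. x (j + k0))"
  have \<phi>: "functional_on X (2 * K) (\<phi> k)" for k
    unfolding functional_on_def
  proof (intro conjI ballI allI)
    fix f assume f: "f \<in> X"
    have "norm (\<phi> k f) \<le> norm (\<psi> (k + k0) f) + norm (\<psi>' f)"
      unfolding \<phi>_def by (rule norm_triangle_ineq4)
    then show "norm (\<phi> k f) \<le> 2 * K * norm f"
      using functional_on_norm[OF \<psi>(1) f, of "k + k0"] functional_on_norm[OF \<psi>' f] by simp
  qed (simp_all add: \<phi>_def functional_on_add[OF \<psi>(1)] functional_on_add[OF \<psi>']
      functional_on_scale[OF \<psi>(1)] functional_on_scale[OF \<psi>'] algebra_simps)
  have \<phi>_null: "(\<lambda>k. \<phi> k f) \<longlonglongrightarrow> 0" if "f \<in> X" for f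
    unfolding \<phi>_def using LIMSEQ_ignore_initial_segment[OF lim[OF that], of k0] by (rule LIM_zero)
  have y: "y j \<in> X" "c0_bounded D y" for j
    using x(1) c0_bounded_subseq[OF x(2), of "\<lambda>j. j + k0"]
    by (auto simp: y_def o_def inj_def)
  have diag: "norm (\<phi> k (y k)) \<ge> d / 2" for k
    using d(2)[of "k + k0"] k0[of "k + k0"] norm_triangle_ineq2[of "\<psi> (k + k0) (y k)" "\<psi>' (y k)"]
    by (simp add: \<phi>_def y_def)
  have column: "(\<lambda>k. norm (\<phi> k (y j))) \<longlonglongrightarrow> 0" for j
    using \<phi>_null[OF y(1)] by (rule tendsto_norm_zero)
  have row: "summable (\<lambda>j. norm (\<phi> k (y j)))" for k
    using K by (intro c0_bounded_summable[OF y(2,1) \<phi> X(1)]) simp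
  \<comment> \<open>Dividing by diagonal entries of size at least \<open>d / 2\<close> turns a row
    sum of \<open>d / 4\<close> into the required 1/2.\<close>
  have "d / 4 > 0" using d(1) by simp
  with column row obtain r :: "nat \<Rightarrow> nat" where r: "strict_mono r"
    "\<And>i F. finite F \<Longrightarrow> i \<notin> F \<Longrightarrow> (\<Sum>j\<in>F. norm (\<phi> (r i) (y (r j)))) \<le> d / 4"
    by (rule off_diagonal_subsequence[of "\<lambda>k j. norm (\<phi> k (y j))" "d / 4", OF norm_ge_zero]) (rule that)
  define \<xi> where "\<xi> = (\<lambda>i f. \<phi> (r i) f / \<phi> (r i) (y (r i)))"
  have ne: "\<phi> k (y k) \<noteq> 0" for k
    using diag[of k] d(1) by auto
  have div: "norm (\<xi> i f) \<le> norm (\<phi> (r i) f) * (2 / d)" for i f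
  proof -
    have "norm (\<xi> i f) \<le> norm (\<phi> (r i) f) / (d / 2)"
      unfolding \<xi>_def norm_divide using diag[of "r i"] d(1) ne[of "r i"]
      by (intro divide_left_mono mult_pos_pos) auto
    then show ?thesis by simp
  qed
  have \<xi>: "functional_on X (2 * K * (2 / d)) (\<xi> i)" for i
    unfolding functional_on_def
  proof (intro conjI ballI allI)
    fix f assume f: "f \<in> X"
    have "norm (\<xi> i f) \<le> (2 * K * norm f) * (2 / d)"
      using div[of i f] functional_on_norm[OF \<phi> f, of "r i"] d(1)
      by (meson mult_right_mono order_trans divide_nonneg_pos zero_le_numeral)
    then show "norm (\<xi> i f) \<le> 2 * K * (2 / d) * norm f" by (simp add: mult_ac)
  qed (simp_all add: \<xi>_def functional_on_add[OF \<phi>] functional_on_scale[OF \<phi>] add_divide_distrib)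
  have yr: "(y \<circ> r) j \<in> X" "c0_bounded D (y \<circ> r)" for j
    using y(1) c0_bounded_subseq[OF y(2) strict_mono_imp_inj_on[OF r(1)]] by auto
  have \<xi>_null: "(\<lambda>i. \<xi> i f) \<longlonglongrightarrow> 0" if "f \<in> X" for f
  proof (rule tendsto_0_le[OF LIMSEQ_subseq_LIMSEQ[OF \<phi>_null[OF that] r(1)]])
    show "\<forall>\<^sub>F i in sequentially. norm (\<xi> i f) \<le> norm (((\<lambda>k. \<phi> k f) \<circ> r) i) * (2 / d)"
      using div by (simp add: o_def)
  qed
  have off: "(\<Sum>j\<in>F. norm (\<xi> i ((y \<circ> r) j))) \<le> 1 / 2" if "finite F" "i \<notin> F" for i F
  proof -
    have "(\<Sum>j\<in>F. norm (\<xi> i ((y \<circ> r) j))) \<le> (\<Sum>j\<in>F. norm (\<phi> (r i) (y (r j))) * (2 / d))"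
      using div by (intro sum_mono) (auto simp del: times_divide_eq_right)
    also have "\<dots> = (\<Sum>j\<in>F. norm (\<phi> (r i) (y (r j)))) * (2 / d)"
      by (simp only: sum_distrib_right)
    also have "\<dots> \<le> d / 4 * (2 / d)"
      using r(2)[OF that] d(1) by (intro mult_right_mono) auto
    finally show ?thesis using d(1) by simp
  qed
  have "\<xi> i ((y \<circ> r) i) = 1" for i using ne by (simp add: \<xi>_def)
  from almost_biorthogonal_c0_projection[OF X yr \<xi> \<xi>_null this off]
  obtain P where P: "bounded_projection X P" "infinite_dim (P ` X)"
    "P ` X \<subseteq> closure (span (range (y \<circ> r)))" "\<And>f. f \<in> X \<Longrightarrow> (\<And>i. \<xi> i f = 0) \<Longrightarrow> P f = 0"
    by blast
  show ?thesis
  proof (rule that[OF P(1,2)])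
    have "range (y \<circ> r) \<subseteq> range x" by (auto simp: y_def)
    then show "P ` X \<subseteq> closure (span (range x))"
      using P(3) closure_mono span_mono by blast
    fix f assume f: "f \<in> X" "\<And>k. \<psi> k f = 0"
    then have "\<psi>' f = 0" using lim[OF f(1)] by (simp add: LIMSEQ_const_iff)
    then show "P f = 0" using f by (intro P(4)) (auto simp: \<xi>_def \<phi>_def)
  qed
qed

end

section \<open>Gliding humps\<close>

lemma sum_geometric_le:
  assumes "finite F"
  shows "(\<Sum>j\<in>F. (1 / 2 :: real) ^ (j + 2)) \<le> 1 / 2"
proof -
  have "(\<lambda>j. (1 / 2 :: real) ^ j * (1 / 4)) sums (2 * (1 / 4))"
    using geometric_sums[of "1 / 2 :: real"] by (intro sums_mult2) simp
  then have s: "(\<lambda>j. (1 / 2 :: real) ^ (j + 2)) sums (1 / 2)"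
    by (simp add: power_add power2_eq_square)
  show ?thesis
    using sum_le_suminf[OF sums_summable[OF s] assms] sums_unique[OF s] by simp
qed

text \<open>\<open>G k\<close> collects the finitely many indices at which some earlier
  \<open>x j\<close> exceeds its threshold \<open>e j\<close>, and \<open>x k\<close> is chosen to
  vanish there. A fixed \<open>s\<close> thus sees only values within the thresholds until it enters
  some \<open>G k\<close>, one value at most 1 on entry, and zeros afterwards.\<close>

lemma gliding_hump:
  fixes \<tau> :: "'i \<Rightarrow> 'a \<Rightarrow> 'k::real_normed_vector"
  assumes hump: "\<And>e G. e > 0 \<Longrightarrow> finite G \<Longrightarrow> G \<subseteq> T \<Longrightarrow>
    \<exists>x\<in>M. (\<forall>t\<in>G. \<tau> t x = 0) \<and> (\<forall>t\<in>T. norm (\<tau> t x) \<le> 1) \<and>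
      (\<exists>t\<in>T. norm (\<tau> t x) \<ge> 1 / 2) \<and> finite {t\<in>T. norm (\<tau> t x) > e}"
  shows "\<exists>(x :: nat \<Rightarrow> 'a) (t :: nat \<Rightarrow> 'i).
    (\<forall>k. x k \<in> M \<and> t k \<in> T \<and> norm (\<tau> (t k) (x k)) \<ge> 1 / 2) \<and> inj t \<and>
    (\<forall>s\<in>T. \<forall>F. finite F \<longrightarrow> (\<Sum>k\<in>F. norm (\<tau> s (x k))) \<le> 2)"
proof -
  define good where "good = (\<lambda>e G x. x \<in> M \<and> (\<forall>t\<in>G. \<tau> t x = 0) \<and> (\<forall>t\<in>T. norm (\<tau> t x) \<le> 1) \<and>
      (\<exists>t\<in>T. norm (\<tau> t x) \<ge> 1 / 2) \<and> finite {t\<in>T. norm (\<tau> t x) > e})"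
  define f where "f = (\<lambda>e G. SOME x. good e G x)"
  have f: "good e G (f e G)" if "e > 0" "finite G" "G \<subseteq> T" for e G
  proof -
    have "\<exists>x. good e G x" using hump[OF that] unfolding good_def by blast
    then show ?thesis unfolding f_def by (rule someI_ex)
  qed
  \<comment> \<open>The thresholds add up to 1/2. Each is below 1/2, so \<open>t k\<close> itself
    belongs to \<open>G (Suc k)\<close>, which makes \<open>t\<close> injective.\<close>
  define e where "e = (\<lambda>k::nat. (1 / 2 :: real) ^ (k + 2))"
  have e: "e k > 0" "e k < 1 / 2" for k
    using power_le_one[of "1 / 2 :: real" k] by (auto simp: e_def power_add power2_eq_square)
  define G where "G = rec_nat {} (\<lambda>k G. G \<union> {t\<in>T. norm (\<tau> t (f (e k) G)) > e k})"
  define x where "x = (\<lambda>k. f (e k) (G k))"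
  have G_Suc: "G (Suc k) = G k \<union> {t\<in>T. norm (\<tau> t (x k)) > e k}" and G_0: "G 0 = {}" for k
    by (simp_all add: G_def x_def)
  have "finite (G k) \<and> G k \<subseteq> T" for k
  proof (induction k)
    case (Suc k)
    then show ?case using f[OF e(1)[of k], of "G k"] by (auto simp: G_Suc x_def good_def)
  qed (simp add: G_0)
  then have x: "x k \<in> M" "\<And>t. t \<in> G k \<Longrightarrow> \<tau> t (x k) = 0" "\<And>t. t \<in> T \<Longrightarrow> norm (\<tau> t (x k)) \<le> 1"
    "\<exists>t\<in>T. norm (\<tau> t (x k)) \<ge> 1 / 2" for k
    using f[OF e(1), of "G k" k] by (auto simp: x_def good_def)
  have G_mono: "G i \<subseteq> G j" if "i \<le> j" for i j
    using that by (rule lift_Suc_mono_le[rotated]) (auto simp: G_Suc)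
  obtain t where t: "\<And>k. t k \<in> T" "\<And>k. norm (\<tau> (t k) (x k)) \<ge> 1 / 2"
    using x(4) by metis
  have "t i \<noteq> t j" if "i < j" for i j
  proof
    assume "t i = t j"
    moreover have "t i \<in> G (Suc i)"
      using t[of i] e(2)[of i] by (auto simp: G_Suc)
    ultimately have "t j \<in> G j" using G_mono[of "Suc i" j] that by auto
    then show False using x(2)[of "t j" j] t(2)[of j] by simp
  qed
  then have inj: "inj t" by (metis injI linorder_neqE_nat)
  have sum: "(\<Sum>k\<in>F. norm (\<tau> s (x k))) \<le> 2" if s: "s \<in> T" and F: "finite F" for s F
  proof -
    have "\<exists>m. \<forall>j. norm (\<tau> s (x j)) \<le> e j + (if j = m then 1 else 0)"
    proof (cases "\<exists>k. s \<in> G k")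
      case True
      \<comment> \<open>The first stage containing \<open>s\<close>; its predecessor
        \<open>m\<close> is the only index at which the value at \<open>s\<close> can exceed the
        threshold.\<close>
      define k where "k = (LEAST k. s \<in> G k)"
      have k2: "s \<notin> G j" if "j < k" for j
        using that unfolding k_def by (rule not_less_Least)
      have k1: "s \<in> G k" unfolding k_def using True by (rule LeastI_ex)
      then obtain m where m: "k = Suc m" using G_0 by (cases k) auto
      have "norm (\<tau> s (x j)) \<le> e j + (if j = m then 1 else 0)" for j
      proof (cases j m rule: linorder_cases)
        case less
        then have "s \<notin> G (Suc j)" using k2[of "Suc j"] m by simp
        then show ?thesis using s less by (auto simp: G_Suc)
      next
        case equal
        then show ?thesis using x(3)[OF s, of j] e(1)[of j] by simp
      next
        case greater
        then have "s \<in> G j" using k1 G_mono[of k j] m by auto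
        then show ?thesis using x(2) e(1)[of j] greater by simp
      qed
      then show ?thesis by blast
    next
      case False
      then have "norm (\<tau> s (x j)) \<le> e j" for j
        using s G_Suc[of j] by (metis (mono_tags, lifting) UnI2 mem_Collect_eq not_less)
      then show ?thesis by (metis add_increasing2 zero_le_one order_refl add_0_right)
    qed
    then obtain m where m: "\<And>j. norm (\<tau> s (x j)) \<le> e j + (if j = m then 1 else 0)" by blast
    have "(\<Sum>k\<in>F. norm (\<tau> s (x k))) \<le> (\<Sum>j\<in>F. e j + (if j = m then 1 else 0))"
      by (intro sum_mono m)
    also have "\<dots> = (\<Sum>j\<in>F. e j) + (if m \<in> F then 1 else 0)"
      using F by (simp add: sum.distrib)
    also have "\<dots> \<le> 2"
      using sum_geometric_le[OF F] by (simp add: e_def)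
    finally show ?thesis .
  qed
  show ?thesis
    by (intro exI[of _ x] exI[of _ t] conjI allI ballI impI x(1) t inj sum)
qed

section \<open>Subspaces of finite dimension and codimension\<close>

context banach_over
begin

lemma subspace_kernel:
  assumes "subspace M" "functional_on M K \<phi>"
  shows "subspace {x\<in>M. \<phi> x = 0}"
  using assms functional_on_zero[OF assms(2,1)]
  by (auto intro!: subspaceI simp: functional_on_add functional_on_scale subspace_0 subspace_add subspace_scale)

lemma infinite_dim_kernel:
  assumes M: "subspace M" "infinite_dim M" and \<phi>: "functional_on M K \<phi>"
  shows "infinite_dim {x\<in>M. \<phi> x = 0}"
  unfolding infinite_dim_def
proof (rule notI, elim exE conjE)
  fix B assume B: "finite B" "{x\<in>M. \<phi> x = 0} \<subseteq> span B"
  show False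
  proof (cases "\<exists>y\<in>M. \<phi> y \<noteq> 0")
    case True
    then obtain y where y: "y \<in> M" "\<phi> y \<noteq> 0" by blast
    have "x \<in> span (insert y B)" if x: "x \<in> M" for x
    proof -
      have "x - (\<phi> x / \<phi> y) *k y \<in> {x\<in>M. \<phi> x = 0}"
        using x y M(1) by (simp add: functional_on_diff[OF \<phi> M(1)] functional_on_scale[OF \<phi>]
            subspace_diff subspace_scale)
      then show ?thesis using B(2) by (auto simp: span_breakdown_eq)
    qed
    then have "M \<subseteq> span (insert y B)" by blast
    moreover have "finite (insert y B)" using B(1) by simp
    ultimately show False using M(2) unfolding infinite_dim_def by blast
  next
    case False
    then show False using M(2) B by (auto simp: infinite_dim_def)
  qed
qed

lemma infinite_dim_kernels:
  assumes "finite I" and M: "subspace M" "infinite_dim M" and "\<And>i. i \<in> I \<Longrightarrow> functional_on M K (\<phi> i)"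
  shows "subspace {x\<in>M. \<forall>i\<in>I. \<phi> i x = 0} \<and> infinite_dim {x\<in>M. \<forall>i\<in>I. \<phi> i x = 0}"
  using assms(1,4)
proof (induction I)
  case (insert i I)
  let ?N = "{x\<in>M. \<forall>i\<in>I. \<phi> i x = 0}"
  have N: "subspace ?N" "infinite_dim ?N" using insert by auto
  have \<phi>: "functional_on ?N K (\<phi> i)"
    using insert.prems by (auto intro: functional_on_subset)
  have "{x\<in>M. \<forall>i\<in>insert i I. \<phi> i x = 0} = {x\<in>?N. \<phi> i x = 0}" by auto
  then show ?case using subspace_kernel[OF N(1) \<phi>] infinite_dim_kernel[OF N \<phi>] by simp
qed (use M in simp)

lemma infinite_dim_nonzero: "infinite_dim M \<Longrightarrow> \<exists>x\<in>M. x \<noteq> 0"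
  unfolding infinite_dim_def by (metis finite.emptyI singletonI span_empty subsetI)

text \<open>If \<open>b\<close> is outside \<open>W\<close>, its distance \<open>d\<close> to
  \<open>W\<close> controls the coefficient: \<open>norm c * d \<le> norm (c *k b + w)\<close>.
  Coefficients along a convergent sequence are therefore Cauchy, and completeness of the scalar
  field provides their limit.\<close>

lemma closed_span_insert:
  assumes W: "subspace W" "closed W"
  shows "closed (span (insert b W))"
proof (cases "b \<in> W")
  case True
  then show ?thesis using W by (simp add: insert_absorb span_eq_iff[THEN iffD2])
next
  case False
  have ne: "W \<noteq> {}" using subspace_0[OF W(1)] by auto
  define d where "d = infdist b W"
  have d: "d > 0"
    using False W ne in_closed_iff_infdist_zero[of W b] infdist_nonneg[of b W] by (auto simp: d_def)
  have low: "norm c * d \<le> norm (c *k b + w)" if w: "w \<in> W" for c w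
  proof (cases "c = 0")
    case False
    have "d \<le> dist b (- (inverse c *k w))"
      unfolding d_def using W(1) w by (intro infdist_le subspace_neg subspace_scale)
    also have "\<dots> = norm (inverse c *k (c *k b + w))"
      using False by (simp add: dist_norm scale_right_distrib)
    also have "\<dots> = norm (c *k b + w) / norm c"
      by (simp add: norm_scale norm_inverse divide_inverse mult.commute)
    finally show ?thesis using False by (simp add: field_simps)
  qed simp
  show ?thesis
    unfolding closed_sequential_limits
  proof (intro allI impI, elim conjE)
    fix f y assume f: "\<forall>n. f n \<in> span (insert b W)" and lim: "f \<longlonglongrightarrow> y"
    have "\<forall>n. \<exists>c. f n - c *k b \<in> W"
      using f W(1) by (simp add: span_breakdown_eq span_eq_iff[THEN iffD2])
    then obtain c where c: "\<And>n. f n - c n *k b \<in> W" by metis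
    have "norm (c m - c n) * d \<le> dist (f m) (f n)" for m n
    proof -
      have "norm (c m - c n) * d \<le> norm ((c m - c n) *k b + ((f m - c m *k b) - (f n - c n *k b)))"
        by (intro low subspace_diff W c)
      then show ?thesis by (simp add: dist_norm scale_left_diff_distrib)
    qed
    then have le: "dist (c m) (c n) \<le> dist (f m) (f n) / d" for m n
      using d by (simp add: dist_norm field_simps)
    have "Cauchy c"
    proof (rule metric_CauchyI)
      fix e :: real assume "e > 0"
      then obtain k where "\<And>m n. m \<ge> k \<Longrightarrow> n \<ge> k \<Longrightarrow> dist (f m) (f n) < e * d"
        using metric_CauchyD[OF LIMSEQ_imp_Cauchy[OF lim], of "e * d"] d by auto
      then have "dist (c m) (c n) < e" if "m \<ge> k" "n \<ge> k" for m n
        using le[of m n] that d by (smt (verit) pos_divide_less_eq)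
      then show "\<exists>k. \<forall>m\<ge>k. \<forall>n\<ge>k. dist (c m) (c n) < e" by blast
    qed
    then obtain l where l: "c \<longlonglongrightarrow> l"
      using Cauchy_convergent convergent_def by blast
    have "(\<lambda>n. c n *k b) \<longlonglongrightarrow> l *k b"
    proof -
      have "(\<lambda>n. (c n - l) *k b) \<longlonglongrightarrow> 0"
        by (rule tendsto_norm_zero_cancel)
          (simp add: norm_scale tendsto_mult_left_zero LIM_zero tendsto_norm_zero l)
      then show ?thesis by (simp add: scale_left_diff_distrib LIM_zero_iff)
    qed
    then have "(\<lambda>n. f n - c n *k b) \<longlonglongrightarrow> y - l *k b"
      by (intro tendsto_diff lim)
    then have "y - l *k b \<in> W"
      by (rule Lim_in_closed_set[OF W(2), rotated 2]) (use c in auto)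
    then show "y \<in> span (insert b W)"
      using W(1) by (auto simp: span_breakdown_eq span_eq_iff[THEN iffD2])
  qed
qed

lemma closed_span_Un_finite:
  assumes M: "subspace M" "closed M" and "finite B"
  shows "closed (span (M \<union> B))"
  using assms(3)
proof (induction B)
  case empty
  then show ?case using M by (simp add: span_eq_iff[THEN iffD2])
next
  case (insert b B)
  have "span (M \<union> insert b B) = span (insert b (span (M \<union> B)))"
    by (auto simp: span_breakdown_eq span_span)
  then show ?case using closed_span_insert[OF _ insert.IH] by simp
qed

text \<open>Moving \<open>f\<close> by an element of \<open>W\<close> keeps its distance to
  \<open>W\<close>, so the hypothesis applied to \<open>f - w\<close> bounds that distance by half
  of \<open>norm (f - w)\<close> for every \<open>w\<close>. The distance is then at most half of
  itself.\<close>

lemma half_dense_subspace: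
  assumes X: "subspace X" and W: "subspace W" "closed W" "W \<subseteq> X"
    and half: "\<And>f. f \<in> X \<Longrightarrow> \<exists>w\<in>W. norm (f - w) \<le> norm f / 2"
  shows "X \<subseteq> W"
proof
  fix f assume f: "f \<in> X"
  have ne: "W \<noteq> {}" using subspace_0[OF W(1)] by auto
  have le: "infdist f W \<le> norm (f - w) / 2" if w: "w \<in> W" for w
  proof -
    obtain w' where w': "w' \<in> W" "norm (f - w - w') \<le> norm (f - w) / 2"
      using half[of "f - w"] f w W X subspace_diff by blast
    have "infdist f W \<le> dist f (w + w')"
      using w w' W by (intro infdist_le subspace_add)
    then show ?thesis using w' by (simp add: dist_norm algebra_simps)
  qed
  have "infdist f W = 0"
  proof (rule ccontr)
    assume "infdist f W \<noteq> 0"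
    then have "infdist f W > 0" using infdist_nonneg[of f W] by simp
    then obtain w where "w \<in> W" "dist f w < infdist f W + infdist f W"
      using infdist_approx[OF ne] by blast
    then show False using le[of w] by (simp add: dist_norm)
  qed
  then show "f \<in> W" using in_closed_iff_infdist_zero[OF W(2) ne] by simp
qed


end

section \<open>Complemented subspaces from sequences\<close>

context banach_over begin
text \<open>\<open>subprojective_JL\<close> uses this with two families \<open>\<tau>\<close>: the
  evaluations and the limits along the branches. That \<open>\<tau>\<close> norms \<open>N\<close>
  up to the factor \<open>C\<close> turns the bound 2 of \<open>gliding_hump\<close> into an upper
  \<open>c0\<close>-estimate. The humps are sought in \<open>N\<close>; closedness is asked of
  \<open>M\<close>, which receives the closed span.\<close>

lemma complemented_in_subspace:
  assumes X: "subspace X" "closed X" and M: "subspace M" "closed M" "M \<subseteq> X" and N: "N \<subseteq> M" "subspace N"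
    and \<tau>: "\<And>t. t \<in> T \<Longrightarrow> functional_on X K (\<tau> t)"
    and norming: "\<And>x B. x \<in> N \<Longrightarrow> (\<And>t. t \<in> T \<Longrightarrow> norm (\<tau> t x) \<le> B) \<Longrightarrow> norm x \<le> C * B"
    and hump: "\<And>e G. e > 0 \<Longrightarrow> finite G \<Longrightarrow> G \<subseteq> T \<Longrightarrow>
    \<exists>x\<in>N. (\<forall>t\<in>G. \<tau> t x = 0) \<and> (\<forall>t\<in>T. norm (\<tau> t x) \<le> 1) \<and>
      (\<exists>t\<in>T. norm (\<tau> t x) \<ge> 1 / 2) \<and> finite {t\<in>T. norm (\<tau> t x) > e}"
    and conv: "\<And>t::nat \<Rightarrow> 'i. inj t \<Longrightarrow> range t \<subseteq> T \<Longrightarrow>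
      \<exists>r. strict_mono r \<and> (\<forall>f\<in>X. convergent (\<lambda>k. \<tau> (t (r k)) f))"
  shows "\<exists>L. L \<subseteq> M \<and> infinite_dim L \<and> complemented X L"
proof -
  have "\<exists>(x :: nat \<Rightarrow> 'a) (t :: nat \<Rightarrow> 'i).
    (\<forall>k. x k \<in> N \<and> t k \<in> T \<and> norm (\<tau> (t k) (x k)) \<ge> 1 / 2) \<and> inj t \<and>
    (\<forall>s\<in>T. \<forall>F. finite F \<longrightarrow> (\<Sum>k\<in>F. norm (\<tau> s (x k))) \<le> 2)"
    by (rule gliding_hump[OF hump])
  then obtain x and t :: "nat \<Rightarrow> 'i" where xt': "\<forall>k. x k \<in> N \<and> t k \<in> T \<and> norm (\<tau> (t k) (x k)) \<ge> 1 / 2" "inj t"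
    "\<forall>s\<in>T. \<forall>F. finite F \<longrightarrow> (\<Sum>k\<in>F. norm (\<tau> s (x k))) \<le> 2"
    by (elim exE conjE)
  have xt: "x k \<in> N" "t k \<in> T" "norm (\<tau> (t k) (x k)) \<ge> 1 / 2" "inj t" for k
    using xt' by auto
  have sum: "(\<Sum>k\<in>F. norm (\<tau> s (x k))) \<le> 2" if "s \<in> T" "finite F" for s F
    using xt' that by auto
  have NX: "N \<subseteq> X" using N M by blast
  have bdd: "c0_bounded (C * 2) x"
    unfolding c0_bounded_def
  proof (intro allI impI)
    fix F and a :: "nat \<Rightarrow> 'k" and B :: real
    assume F: "finite F" "0 \<le> B" "\<forall>j\<in>F. norm (a j) \<le> B"
    have "norm (\<Sum>j\<in>F. a j *k x j) \<le> C * (B * 2)"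
    proof (rule norming)
      show "(\<Sum>j\<in>F. a j *k x j) \<in> N" by (intro subspace_sum N subspace_scale xt)
      fix s assume s: "s \<in> T"
      have "norm (\<tau> s (\<Sum>j\<in>F. a j *k x j)) = norm (\<Sum>j\<in>F. a j * \<tau> s (x j))"
        using xt(1) NX by (subst functional_on_sum[OF \<tau>[OF s] X(1)]) auto
      also have "\<dots> \<le> (\<Sum>j\<in>F. B * norm (\<tau> s (x j)))"
        using F by (intro sum_norm_le) (auto simp: norm_mult intro: mult_right_mono)
      also have "\<dots> = B * (\<Sum>j\<in>F. norm (\<tau> s (x j)))" by (simp add: sum_distrib_left)
      also have "\<dots> \<le> B * 2" using F sum[OF s] by (intro mult_left_mono) auto
      finally show "norm (\<tau> s (\<Sum>j\<in>F. a j *k x j)) \<le> B * 2" .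
    qed
    then show "norm (\<Sum>j\<in>F. a j *k x j) \<le> C * 2 * B" by (simp add: mult_ac)
  qed
  obtain r where r: "strict_mono r" "\<And>f. f \<in> X \<Longrightarrow> convergent (\<lambda>k. \<tau> (t (r k)) f)"
    using conv[OF xt(4)] xt(2) by blast
  have xr: "(x \<circ> r) j \<in> X" "c0_bounded (C * 2) (x \<circ> r)" for j
    using xt(1) NX c0_bounded_subseq[OF bdd strict_mono_imp_inj_on[OF r(1)]] by auto
  have \<tau>r: "functional_on X K (\<tau> (t (r k)))" "1 / 2 \<le> norm (\<tau> (t (r k)) ((x \<circ> r) k))" for k
    using \<tau> xt by auto
  obtain P where P: "bounded_projection X P" "infinite_dim (P ` X)"
    "P ` X \<subseteq> closure (span (range (x \<circ> r)))"
    by (rule c0_sequence_projection[OF X xr \<tau>r(1) r(2) _ \<tau>r(2)]) (auto intro: that)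
  have "span (range (x \<circ> r)) \<subseteq> M"
    using xt(1) N(1) by (intro span_minimal M) auto
  then have "P ` X \<subseteq> M" using P(3) closure_minimal[OF _ M(2)] by blast
  then show ?thesis using P by (auto simp: complemented_def)
qed

text \<open>The complemented space is the kernel \<open>L\<close> of the projection, that is, the
  range of \<open>\<lambda>f. f - P f\<close>. Finitely many vectors spanning \<open>X\<close>
  together with \<open>L\<close> would have images spanning the range of \<open>P\<close>, which has
  infinite dimension.\<close>

lemma complemented_containing_subspace:
  assumes X: "subspace X" "closed X" and M: "M \<subseteq> X"
    and x: "\<And>j. x j \<in> X" "c0_bounded D x"
    and \<psi>: "\<And>k. functional_on X K (\<psi> k)" "\<And>k m. m \<in> M \<Longrightarrow> \<psi> k m = 0"
    and d: "d > 0" "\<And>k. d \<le> norm (\<psi> k (x k))"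
    and r: "strict_mono r" "\<And>f. f \<in> X \<Longrightarrow> convergent (\<lambda>k. \<psi> (r k) f)"
  shows "\<exists>L. M \<subseteq> L \<and> infinite_codim X L \<and> complemented X L"
proof -
  have xr: "(x \<circ> r) j \<in> X" "c0_bounded D (x \<circ> r)" for j
    using x c0_bounded_subseq[OF x(2) strict_mono_imp_inj_on[OF r(1)]] by auto
  have d': "d \<le> norm (\<psi> (r k) ((x \<circ> r) k))" for k
    using d(2) by simp
  obtain P where P: "bounded_projection X P" "infinite_dim (P ` X)"
    "\<And>f. f \<in> X \<Longrightarrow> (\<And>k. \<psi> (r k) f = 0) \<Longrightarrow> P f = 0"
    by (rule c0_sequence_projection[OF X xr \<psi>(1) r(2) d(1) d']) (auto intro: that)
  have PX: "P f \<in> X" "P (P f) = P f" if "f \<in> X" for f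
    using P(1) that by (auto simp: bounded_projection_def)
  have P_add: "P (f + g) = P f + P g" if "f \<in> X" "g \<in> X" for f g
    using P(1) that by (auto simp: bounded_projection_def)
  have P_scale: "P (c *k f) = c *k P f" if "f \<in> X" for f c
    using P(1) that by (auto simp: bounded_projection_def)
  have P_diff: "P (f - g) = P f - P g" if "f \<in> X" "g \<in> X" for f g
    using P_add[of "f - g" g] that X(1) by (simp add: subspace_diff algebra_simps)
  have P0: "P 0 = 0" using P_scale[of 0 0] subspace_0[OF X(1)] by simp
  obtain C where C: "\<And>f. f \<in> X \<Longrightarrow> norm (P f) \<le> C * norm f"
    using P(1) unfolding bounded_projection_def by blast
  define L where "L = {f\<in>X. P f = 0}"
  have "bounded_projection X (\<lambda>f. f - P f)"
    unfolding bounded_projection_def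
  proof (intro conjI ballI allI)
    show "\<exists>K. \<forall>f\<in>X. norm (f - P f) \<le> K * norm f"
    proof (intro exI ballI)
      fix f assume "f \<in> X"
      then show "norm (f - P f) \<le> (1 + C) * norm f"
        using norm_triangle_ineq4[of f "P f"] C[of f] by (simp add: distrib_right)
    qed
  qed (use X PX P0 in \<open>auto simp: P_add P_scale P_diff scale_right_diff_distrib subspace_diff\<close>)
  moreover have "(\<lambda>f. f - P f) ` X = L"
  proof
    show "(\<lambda>f. f - P f) ` X \<subseteq> L"
      using X PX by (auto simp: L_def P_diff subspace_diff)
    show "L \<subseteq> (\<lambda>f. f - P f) ` X"
    proof
      fix f assume "f \<in> L"
      then show "f \<in> (\<lambda>f. f - P f) ` X"
        by (intro image_eqI[of _ _ f]) (auto simp: L_def)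
    qed
  qed
  ultimately have "complemented X L" unfolding complemented_def by blast
  moreover have "M \<subseteq> L" using M P(3) \<psi>(2) by (auto simp: L_def)
  moreover have "infinite_codim X L"
    unfolding infinite_codim_def
  proof (rule notI, elim exE conjE)
    fix B assume B: "finite B" "B \<subseteq> X" "X \<subseteq> span (L \<union> B)"
    have "subspace {f\<in>X. P f \<in> span (P ` B)}"
      using X(1) P0 by (auto intro!: subspaceI simp: subspace_0 subspace_add subspace_scale P_add P_scale
          span_zero span_add span_scale)
    moreover have "L \<union> B \<subseteq> {f\<in>X. P f \<in> span (P ` B)}"
      using B(2) by (auto simp: L_def span_zero intro: span_base)
    ultimately have "X \<subseteq> {f\<in>X. P f \<in> span (P ` B)}"
      using B(3) span_minimal by blast
    then have "P ` X \<subseteq> span (P ` B)" by blast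
    then show False using P(2) B(1) by (auto simp: infinite_dim_def)
  qed
  ultimately show ?thesis by blast
qed

end

text \<open>Bounded scalar sequences have convergent subsequences by the Heine-Borel property, and a
  diagonal sequence serves all of \<open>S\<close> at once. On the common kernel convergence is
  trivial, and the common bound \<open>K\<close> carries it from the generated subspace to the
  closure.\<close>

lemma convergent_subsequence_functionals:
  fixes \<psi> :: "nat \<Rightarrow> 'k::{real_normed_field,banach,heine_borel} linf \<Rightarrow> 'k"
  assumes X: "linf.subspace X" and \<psi>: "\<And>k. linf.functional_on X K (\<psi> k)"
    and S: "countable S" "S \<subseteq> X"
    and dense: "X \<subseteq> closure (linf.span ({z\<in>X. \<forall>k. \<psi> k z = 0} \<union> S))"
  obtains r where "strict_mono r" "\<And>f. f \<in> X \<Longrightarrow> convergent (\<lambda>k. \<psi> (r k) f)"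
proof -
  \<comment> \<open>Adding 0 makes the set nonempty, so that the enumeration has exactly this
    range.\<close>
  define s where "s = from_nat_into (insert 0 S)"
  have s: "range s = insert 0 S"
    unfolding s_def using S(1) by (intro range_from_nat_into) auto
  have sX: "s n \<in> X" for n
    using rangeI[of s n] S(2) linf.subspace_0[OF X] unfolding s by auto
  interpret subseqs "\<lambda>n r. convergent (\<lambda>k. \<psi> (r k) (s n))"
  proof
    fix n and \<sigma> :: "nat \<Rightarrow> nat"
    have "bounded (range (\<lambda>k. \<psi> (\<sigma> k) (s n)))"
      using linf.functional_on_norm[OF \<psi> sX] by (auto simp: bounded_iff)
    then obtain l r' where "strict_mono r'" "((\<lambda>k. \<psi> (\<sigma> k) (s n)) \<circ> r') \<longlonglongrightarrow> l"
      using bounded_imp_convergent_subsequence by blast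
    then show "\<exists>r'. strict_mono r' \<and> convergent (\<lambda>k. \<psi> ((\<sigma> \<circ> r') k) (s n))"
      by (auto simp: o_def convergent_def)
  qed
  define r where "r = diagseq"
  have r: "strict_mono r" unfolding r_def by (rule subseq_diagseq)
  have conv_s: "convergent (\<lambda>k. \<psi> (r k) (s n))" for n
  proof -
    \<comment> \<open>The diagonal sequence is known to refine the subsequence chosen for
      \<open>s n\<close> only from \<open>Suc n\<close> on, hence the detour through a tail.\<close>
    have "convergent (\<lambda>k. \<psi> ((diagseq \<circ> (+) (Suc n)) k) (s n))"
    proof (rule diagseq_holds)
      fix r s' :: "nat \<Rightarrow> nat" and n assume "strict_mono r" "convergent (\<lambda>k. \<psi> (s' k) (s n))"
      then show "convergent (\<lambda>k. \<psi> ((s' \<circ> r) k) (s n))"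
        using convergent_subseq_convergent[of "\<lambda>k. \<psi> (s' k) (s n)" r] by (simp add: o_def)
    qed
    then show ?thesis
      using convergent_ignore_initial_segment[of "\<lambda>k. \<psi> (r k) (s n)" "Suc n"]
      by (simp add: r_def o_def add.commute)
  qed
  define A where "A = {f\<in>X. Cauchy (\<lambda>k. \<psi> (r k) f)}"
  have "linf.subspace A"
  proof (rule linf.subspaceI)
    show "0 \<in> A"
      using linf.functional_on_zero[OF \<psi> X] linf.subspace_0[OF X] by (simp add: A_def Cauchy_def)
    fix f g c assume f: "f \<in> A"
    then have fX: "f \<in> X" "convergent (\<lambda>k. \<psi> (r k) f)"
      by (auto simp: A_def Cauchy_convergent)
    show "linf_scale c f \<in> A"
      using convergent_mult[OF convergent_const[of c] fX(2)] linf.functional_on_scale[OF \<psi> fX(1)]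
        linf.subspace_scale[OF X fX(1)] by (auto simp: A_def convergent_Cauchy)
    assume "g \<in> A"
    then have gX: "g \<in> X" "convergent (\<lambda>k. \<psi> (r k) g)"
      by (auto simp: A_def Cauchy_convergent)
    show "f + g \<in> A"
      using convergent_add[OF fX(2) gX(2)] linf.functional_on_add[OF \<psi> fX(1) gX(1)]
        linf.subspace_add[OF X fX(1) gX(1)] by (auto simp: A_def convergent_Cauchy)
  qed
  moreover have "{z\<in>X. \<forall>k. \<psi> k z = 0} \<union> S \<subseteq> A"
  proof -
    have "f \<in> A" if f: "f \<in> S" for f
    proof -
      obtain n where "f = s n" using s f by (metis insertI2 rangeE)
      then show ?thesis using conv_s[of n] sX by (simp add: A_def convergent_Cauchy)
    qed
    then show ?thesis by (auto simp: A_def Cauchy_def)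
  qed
  ultimately have "linf.span ({z\<in>X. \<forall>k. \<psi> k z = 0} \<union> S) \<subseteq> A"
    by (intro linf.span_minimal)
  from closure_mono[OF this] have XA: "X \<subseteq> closure A" using dense by blast
  have "convergent (\<lambda>k. \<psi> (r k) f)" if f: "f \<in> X" for f
  proof (rule Cauchy_convergent, rule metric_CauchyI)
    fix e :: real assume e: "e > 0"
    let ?K = "\<bar>K\<bar> + 1"
    have "e / (3 * ?K) > 0" using e by (intro divide_pos_pos mult_pos_pos) auto
    then obtain g where g: "g \<in> A" "dist g f < e / (3 * ?K)"
      using XA f closure_approachable[of f A] by blast
    then have gX: "g \<in> X" "Cauchy (\<lambda>k. \<psi> (r k) g)" by (auto simp: A_def)
    obtain N where N: "\<And>m n. m \<ge> N \<Longrightarrow> n \<ge> N \<Longrightarrow> dist (\<psi> (r m) g) (\<psi> (r n) g) < e / 3"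
      using metric_CauchyD[OF gX(2), of "e / 3"] e by auto
    have close: "dist (\<psi> k f) (\<psi> k g) < e / 3" for k
    proof -
      have "dist (\<psi> k f) (\<psi> k g) = norm (\<psi> k (f - g))"
        using linf.functional_on_diff[OF \<psi> X f gX(1)] by (simp add: dist_norm)
      also have "\<dots> \<le> K * norm (f - g)"
        using linf.functional_on_norm[OF \<psi>] linf.subspace_diff[OF X f gX(1)] by blast
      also have "\<dots> \<le> ?K * norm (f - g)" by (intro mult_right_mono) auto
      also have "\<dots> < e / 3"
        using g(2) by (simp add: dist_norm norm_minus_commute field_simps add_nonneg_pos)
      finally show ?thesis .
    qed
    have "dist (\<psi> (r m) f) (\<psi> (r n) f) < e" if "m \<ge> N" "n \<ge> N" for m n
      using close[of "r m"] close[of "r n"] N[OF that]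
        dist_triangle[of "\<psi> (r m) f" "\<psi> (r n) f" "\<psi> (r m) g"]
        dist_triangle[of "\<psi> (r m) g" "\<psi> (r n) f" "\<psi> (r n) g"]
      by (simp add: dist_commute)
    then show "\<exists>N. \<forall>m\<ge>N. \<forall>n\<ge>N. dist (\<psi> (r m) f) (\<psi> (r n) f) < e" by blast
  qed
  then show ?thesis by (rule that[OF r])
qed

section \<open>Bounded sequences\<close>

context
  includes bcontfun.lifting
begin

lift_definition linf_restrict :: "nat set \<Rightarrow> 'k::real_normed_field linf \<Rightarrow> 'k linf" is
  "\<lambda>A f n. if n \<in> A then f n else 0"
proof -
  fix A :: "nat set" and f :: "nat \<Rightarrow> 'k" assume "f \<in> bcontfun"
  then obtain b where b: "\<And>n. norm (f n) \<le> b"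
    by (auto simp: bcontfun_def bounded_iff)
  then have "b \<ge> 0" by (meson norm_ge_zero order_trans)
  then show "(\<lambda>n. if n \<in> A then f n else 0) \<in> bcontfun"
    using b by (intro bcontfun_normI[where b = b]) auto
qed

end

lemma apply_linf_restrict [simp]:
  "apply_bcontfun (linf_restrict A f) n = (if n \<in> A then apply_bcontfun f n else 0)"
  by (simp add: linf_restrict.rep_eq)

lemma linf_restrict_in_c0:
  fixes f :: "'k::{real_normed_field,banach} linf"
  assumes "(apply_bcontfun f \<longlongrightarrow> 0) (inf sequentially (principal A))"
  shows "linf_restrict A f \<in> c0"
  unfolding c0_apply
proof (rule tendstoI)
  fix e :: real assume "e > 0"
  then show "\<forall>\<^sub>F n in sequentially. dist (apply_bcontfun (linf_restrict A f) n) 0 < e"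
    using tendstoD[OF assms, of e] unfolding eventually_inf_principal
    by (auto elim: eventually_mono)
qed

lemma finite_support_in_c0:
  fixes f :: "'k::{real_normed_field,banach} linf"
  assumes "finite {n. apply_bcontfun f n \<noteq> 0}"
  shows "f \<in> c0"
  unfolding c0_apply
proof (rule tendsto_eventually)
  show "\<forall>\<^sub>F n in sequentially. apply_bcontfun f n = 0"
    using assms by (simp add: cofinite_eq_sequentially[symmetric] eventually_cofinite)
qed

lemma finite_restrict_sum:
  assumes "finite A"
  shows "linf_restrict A f = (\<Sum>n\<in>A. linf_scale (apply_bcontfun f n) (char_seq {n}))"
proof (rule bcontfun_eqI)
  fix m
  have "(\<Sum>n\<in>A. apply_bcontfun f n * (if m \<in> {n} then 1 else 0)) = (\<Sum>n\<in>A. if n = m then apply_bcontfun f m else 0)"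
    by (intro sum.cong) auto
  then show "apply_bcontfun (linf_restrict A f) m =
      apply_bcontfun (\<Sum>n\<in>A. linf_scale (apply_bcontfun f n) (char_seq {n})) m"
    using assms by simp
qed

lemma c0_tail_finite:
  assumes "f \<in> c0" "e > 0"
  shows "finite {n. norm (apply_bcontfun f n) \<ge> e}"
proof -
  have "\<forall>\<^sub>F n in sequentially. norm (apply_bcontfun f n) < e"
    using tendstoD[of "apply_bcontfun f" 0 sequentially e] assms by (simp add: c0_apply)
  then show ?thesis
    by (simp add: cofinite_eq_sequentially[symmetric] eventually_cofinite not_less)
qed

lemma c0_finite_approx:
  fixes f :: "'k::{real_normed_field,banach} linf"
  assumes "f \<in> c0" "e > 0"
  obtains A where "finite A" "norm (f - linf_restrict A f) \<le> e"
proof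
  let ?A = "{n. norm (apply_bcontfun f n) \<ge> e}"
  show "finite ?A" using assms by (rule c0_tail_finite)
  show "norm (f - linf_restrict ?A f) \<le> e"
    using assms(2) by (intro norm_linf_leI) auto
qed

text \<open>Separability of \<open>c0\<close>, in the form in which
  \<open>superprojective_JL\<close> uses it to find a countable deciding set.\<close>

lemma c0_subset_closure_span:
  "(c0 :: 'k::{real_normed_field,banach} linf set) \<subseteq> closure (linf.span (range (\<lambda>n. char_seq {n})))"
proof
  fix f :: "'k linf" assume f: "f \<in> c0"
  show "f \<in> closure (linf.span (range (\<lambda>n. char_seq {n})))"
    unfolding closure_approachable
  proof (intro allI impI)
    fix e :: real assume "e > 0"
    then obtain A where A: "finite A" "norm (f - linf_restrict A f) \<le> e / 2"
      using c0_finite_approx[OF f, of "e / 2"] by auto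
    have "linf_restrict A f \<in> linf.span (range (\<lambda>n. char_seq {n}))"
      unfolding finite_restrict_sum[OF A(1)]
      by (intro linf.span_sum linf.span_scale linf.span_base) auto
    moreover have "dist (linf_restrict A f) f < e"
      using A(2) \<open>e > 0\<close> by (simp add: dist_norm norm_minus_commute)
    ultimately show "\<exists>y\<in>linf.span (range (\<lambda>n. char_seq {n})). dist y f < e" by blast
  qed
qed

lemma subspace_convergent_along:
  "linf.subspace {f :: 'k::{real_normed_field,banach} linf. \<exists>l. (apply_bcontfun f \<longlongrightarrow> l) F}"
proof (rule linf.subspaceI)
  show "0 \<in> {f :: 'k linf. \<exists>l. (apply_bcontfun f \<longlongrightarrow> l) F}"
    by (auto intro: tendsto_const)
  fix f g :: "'k linf" and c assume f: "f \<in> {f. \<exists>l. (apply_bcontfun f \<longlongrightarrow> l) F}"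
  then show "linf_scale c f \<in> {f. \<exists>l. (apply_bcontfun f \<longlongrightarrow> l) F}"
    by (auto simp: linf_scale.rep_eq intro: tendsto_mult_left)
  assume "g \<in> {f. \<exists>l. (apply_bcontfun f \<longlongrightarrow> l) F}"
  with f show "f + g \<in> {f. \<exists>l. (apply_bcontfun f \<longlongrightarrow> l) F}"
    by (auto intro: tendsto_add)
qed

lemma norm_limit_le:
  fixes f :: "'k::real_normed_field linf"
  assumes "(apply_bcontfun f \<longlongrightarrow> l) F" "F \<noteq> bot"
  shows "norm l \<le> norm f"
  using tendsto_upperbound[OF tendsto_norm[OF assms(1)] _ assms(2), of "norm f"]
  by (simp add: norm_bounded)

text \<open>Limits along \<open>F\<close> depend on the sequence with Lipschitz constant 1, so the
  limits of an approximating sequence are themselves Cauchy. This allows convergence on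
  \<open>X_JL\<close> to be checked on generators only.\<close>

lemma closed_convergent_along:
  assumes F: "F \<noteq> bot"
  shows "closed {f :: 'k::{real_normed_field,banach} linf. \<exists>l. (apply_bcontfun f \<longlongrightarrow> l) F}"
  unfolding closed_sequential_limits
proof (intro allI impI, elim conjE)
  fix f and g :: "'k linf"
  assume "\<forall>n. f n \<in> {f. \<exists>l. (apply_bcontfun f \<longlongrightarrow> l) F}" and lim: "f \<longlonglongrightarrow> g"
  then obtain l where l: "\<And>n. (apply_bcontfun (f n) \<longlongrightarrow> l n) F" by simp metis
  have le: "dist (l m) (l n) \<le> dist (f m) (f n)" for m n
    using norm_limit_le[of "f m - f n" "l m - l n", OF _ F] tendsto_diff[OF l[of m] l[of n]]
    by (simp add: dist_norm)
  have "Cauchy l"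
  proof (rule metric_CauchyI)
    fix e :: real assume "e > 0"
    then obtain k where "\<And>m n. m \<ge> k \<Longrightarrow> n \<ge> k \<Longrightarrow> dist (f m) (f n) < e"
      using metric_CauchyD[OF LIMSEQ_imp_Cauchy[OF lim]] by blast
    then show "\<exists>k. \<forall>m\<ge>k. \<forall>n\<ge>k. dist (l m) (l n) < e"
      using le by (meson order_le_less_trans)
  qed
  then obtain l' where l': "l \<longlonglongrightarrow> l'"
    using Cauchy_convergent convergent_def by blast
  have "(apply_bcontfun g \<longlongrightarrow> l') F"
  proof (rule tendstoI)
    fix e :: real assume e: "e > 0"
    have "\<forall>\<^sub>F n in sequentially. dist (f n) g < e / 3 \<and> dist (l n) l' < e / 3"
      using tendstoD[OF lim, of "e / 3"] tendstoD[OF l', of "e / 3"] e by (simp add: eventually_conj)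
    then obtain m where m: "dist (f m) g < e / 3" "dist (l m) l' < e / 3"
      by (auto simp: eventually_sequentially)
    have "\<forall>\<^sub>F n in F. dist (apply_bcontfun (f m) n) (l m) < e / 3"
      using e by (intro tendstoD[OF l]) simp
    then show "\<forall>\<^sub>F n in F. dist (apply_bcontfun g n) l' < e"
    proof (rule eventually_mono)
      fix n assume n: "dist (apply_bcontfun (f m) n) (l m) < e / 3"
      have "dist (apply_bcontfun (f m) n) (apply_bcontfun g n) < e / 3"
        using dist_bounded[of "f m" n g] m(1) by linarith
      then show "dist (apply_bcontfun g n) l' < e"
        using n m(2) dist_triangle[of "apply_bcontfun g n" l' "apply_bcontfun (f m) n"]
          dist_triangle[of "apply_bcontfun (f m) n" l' "l m"]
        by (simp add: dist_commute)
    qed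
  qed
  then show "g \<in> {f. \<exists>l. (apply_bcontfun f \<longlongrightarrow> l) F}" by blast
qed

text \<open>\<open>Lim\<close> is unspecified where no limit exists; linearity is therefore claimed
  only on sets all of whose members converge along \<open>F\<close>.\<close>

definition lim_along :: "nat filter \<Rightarrow> 'k::real_normed_field linf \<Rightarrow> 'k" where
  "lim_along F f = Lim F (apply_bcontfun f)"

lemma lim_along_eq: "F \<noteq> bot \<Longrightarrow> (apply_bcontfun f \<longlongrightarrow> l) F \<Longrightarrow> lim_along F f = l"
  by (simp add: lim_along_def tendsto_Lim)

lemma functional_on_lim_along:
  fixes X :: "'k::{real_normed_field,banach} linf set"
  assumes F: "F \<noteq> bot" and lim: "\<And>f. f \<in> X \<Longrightarrow> (apply_bcontfun f \<longlongrightarrow> lim_along F f) F"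
  shows "linf.functional_on X 1 (lim_along F)"
  unfolding linf.functional_on_def
proof (intro conjI ballI allI)
  fix f c assume f: "f \<in> X"
  show "norm (lim_along F f) \<le> 1 * norm f"
    using norm_limit_le[OF lim[OF f] F] by simp
  show "lim_along F (linf_scale c f) = c * lim_along F f"
    by (rule lim_along_eq[OF F]) (simp add: linf_scale.rep_eq tendsto_mult_left lim f)
  fix g assume g: "g \<in> X"
  show "lim_along F (f + g) = lim_along F f + lim_along F g"
    by (rule lim_along_eq[OF F]) (simp add: tendsto_add lim f g)
qed

lemma functional_on_apply:
  "linf.functional_on X 1 (\<lambda>f :: 'k::{real_normed_field,banach} linf. apply_bcontfun f n)"
  by (simp add: linf.functional_on_def norm_bounded)

text \<open>At each coordinate at most one summand is nonzero, so a single coefficient governs the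
  combination there.\<close>

lemma disjoint_c0_bounded:
  fixes x :: "nat \<Rightarrow> 'k::{real_normed_field,banach} linf"
  assumes norm: "\<And>k. norm (x k) \<le> 1"
    and disj: "\<And>i j n. i \<noteq> j \<Longrightarrow> apply_bcontfun (x i) n = 0 \<or> apply_bcontfun (x j) n = 0"
  shows "linf.c0_bounded 1 x"
  unfolding linf.c0_bounded_def
proof (intro allI impI)
  fix F and a :: "nat \<Rightarrow> 'k" and B :: real
  assume F: "finite F" "0 \<le> B" "\<forall>j\<in>F. norm (a j) \<le> B"
  show "norm (\<Sum>j\<in>F. linf_scale (a j) (x j)) \<le> 1 * B"
  proof (rule norm_linf_leI)
    fix n
    show "norm (apply_bcontfun (\<Sum>j\<in>F. linf_scale (a j) (x j)) n) \<le> 1 * B"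
    proof (cases "\<exists>i\<in>F. apply_bcontfun (x i) n \<noteq> 0")
      case True
      then obtain i where i: "i \<in> F" "apply_bcontfun (x i) n \<noteq> 0" by blast
      have "(\<Sum>j\<in>F. a j * apply_bcontfun (x j) n) = (\<Sum>j\<in>{i}. a j * apply_bcontfun (x j) n)"
        using disj[of i _ n] i F by (intro sum.mono_neutral_right) auto
      also have "norm \<dots> \<le> B * 1"
        using F i order_trans[OF norm_bounded norm, of i n]
        by (simp add: norm_mult del: mult_1_right) (intro mult_mono, auto)
      finally show ?thesis by simp
    next
      case False
      then show ?thesis using F by simp
    qed
  qed
qed

text \<open>In the recursion \<open>B\<close> runs through the unions of earlier supports. As each
  chosen \<open>x\<close> vanishes eventually along \<open>F\<close>, such a union is still avoided
  eventually and the recursion can continue. The filter is a parameter because both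
  \<open>sequentially\<close> and \<open>infty\<close> are used.\<close>

lemma disjoint_sequence:
  fixes X :: "'k::{real_normed_field,banach} linf set"
  assumes ex: "\<And>B. \<forall>\<^sub>F n in F. n \<notin> B \<Longrightarrow>
    \<exists>x\<in>X. Q x \<and> (\<forall>\<^sub>F n in F. apply_bcontfun x n = 0) \<and> (\<forall>n\<in>B. apply_bcontfun x n = 0)"
  shows "\<exists>x :: nat \<Rightarrow> 'k linf. (\<forall>k. x k \<in> X \<and> Q (x k)) \<and>
    (\<forall>i j n. i \<noteq> j \<longrightarrow> apply_bcontfun (x i) n = 0 \<or> apply_bcontfun (x j) n = 0)"
proof -
  define good where "good = (\<lambda>B x. x \<in> X \<and> Q x \<and> (\<forall>\<^sub>F n in F. apply_bcontfun x n = 0) \<and>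
    (\<forall>n\<in>B. apply_bcontfun x n = 0))"
  define f where "f = (\<lambda>B. SOME x. good B x)"
  have f: "good B (f B)" if "\<forall>\<^sub>F n in F. n \<notin> B" for B
  proof -
    have "\<exists>x. good B x" using ex[OF that] unfolding good_def by blast
    then show ?thesis unfolding f_def by (rule someI_ex)
  qed
  define B where "B = rec_nat {} (\<lambda>_ B. B \<union> {n. apply_bcontfun (f B) n \<noteq> 0})"
  have B_Suc: "B (Suc k) = B k \<union> {n. apply_bcontfun (f (B k)) n \<noteq> 0}" and B_0: "B 0 = {}" for k
    by (simp_all add: B_def)
  have evB: "\<forall>\<^sub>F n in F. n \<notin> B k" for k
  proof (induction k)
    case (Suc k)
    then have "\<forall>\<^sub>F n in F. apply_bcontfun (f (B k)) n = 0"
      using f[OF Suc] by (simp add: good_def)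
    with Suc show ?case by (simp add: B_Suc eventually_conj)
  qed (simp add: B_0)
  have x: "good (B k) (f (B k))" for k using evB by (rule f)
  have B_mono: "B i \<subseteq> B j" if "i \<le> j" for i j
    using that by (rule lift_Suc_mono_le[rotated]) (auto simp: B_Suc)
  have lt: "apply_bcontfun (f (B i)) n = 0 \<or> apply_bcontfun (f (B j)) n = 0" if "i < j" for i j n
    using x[of j] B_mono[of "Suc i" j] that by (auto simp: good_def B_Suc)
  then have "\<forall>i j n. i \<noteq> j \<longrightarrow> apply_bcontfun (f (B i)) n = 0 \<or> apply_bcontfun (f (B j)) n = 0"
    by (metis linorder_neqE_nat)
  then show ?thesis using x by (intro exI[of _ "\<lambda>k. f (B k)"]) (auto simp: good_def)
qed

section \<open>Almost disjoint families\<close>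

locale almost_disjoint_family =
  fixes \<Gamma> :: "'g set" and N :: "'g \<Rightarrow> nat set"
  assumes infinite_index: "infinite \<Gamma>"
    and infinite_member: "\<And>\<gamma>. \<gamma> \<in> \<Gamma> \<Longrightarrow> infinite (N \<gamma>)"
    and almost_disjoint: "\<And>\<gamma> \<gamma>'. \<gamma> \<in> \<Gamma> \<Longrightarrow> \<gamma>' \<in> \<Gamma> \<Longrightarrow> \<gamma> \<noteq> \<gamma>' \<Longrightarrow> finite (N \<gamma> \<inter> N \<gamma>')"
begin

text \<open>The characters of the algebra \<open>X_JL\<close> are the evaluations at the points of \<open>nat\<close>, the limits
  along the filters \<open>branch \<gamma>\<close>, and the limit along \<open>infty\<close>.\<close>

definition branch :: "'g \<Rightarrow> nat filter" where
  "branch \<gamma> = inf sequentially (principal (N \<gamma>))"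

text \<open>The trace on the naturals of the neighbourhoods of the point at infinity: the failures
  of \<open>P\<close> must be covered by finitely many \<open>N \<gamma>\<close> and a finite
  set.\<close>

definition infty :: "nat filter" where
  "infty = Abs_filter (\<lambda>P. \<exists>G\<subseteq>\<Gamma>. finite G \<and> finite ({n. \<not> P n} - \<Union> (N ` G)))"

lemma eventually_branch: "eventually P (branch \<gamma>) \<longleftrightarrow> finite {n\<in>N \<gamma>. \<not> P n}"
proof -
  have "{n. \<not> (n \<in> N \<gamma> \<longrightarrow> P n)} = {n\<in>N \<gamma>. \<not> P n}" by auto
  then show ?thesis
    unfolding branch_def cofinite_eq_sequentially[symmetric] eventually_inf_principal eventually_cofinite
    by simp
qed

lemma eventually_infty:
  "eventually P infty \<longleftrightarrow> (\<exists>G\<subseteq>\<Gamma>. finite G \<and> finite ({n. \<not> P n} - \<Union> (N ` G)))"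
  unfolding infty_def
proof (rule eventually_Abs_filter, rule is_filter.intro)
  show "\<exists>G\<subseteq>\<Gamma>. finite G \<and> finite ({n. \<not> True} - \<Union> (N ` G))" by (auto intro: exI[of _ "{}"])
next
  fix P Q
  assume "\<exists>G\<subseteq>\<Gamma>. finite G \<and> finite ({n. \<not> P n} - \<Union> (N ` G))"
    "\<exists>G\<subseteq>\<Gamma>. finite G \<and> finite ({n. \<not> Q n} - \<Union> (N ` G))"
  then obtain G H where G: "G \<subseteq> \<Gamma>" "finite G" "finite ({n. \<not> P n} - \<Union> (N ` G))"
    and H: "H \<subseteq> \<Gamma>" "finite H" "finite ({n. \<not> Q n} - \<Union> (N ` H))" by blast
  have "finite ({n. \<not> (P n \<and> Q n)} - \<Union> (N ` (G \<union> H)))"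
    by (rule finite_subset[OF _ finite_UnI[OF G(3) H(3)]]) auto
  then show "\<exists>G\<subseteq>\<Gamma>. finite G \<and> finite ({n. \<not> (P n \<and> Q n)} - \<Union> (N ` G))"
    using G(1,2) H(1,2) by (intro exI[of _ "G \<union> H"]) auto
next
  fix P Q :: "nat \<Rightarrow> bool"
  assume PQ: "\<forall>n. P n \<longrightarrow> Q n" and "\<exists>G\<subseteq>\<Gamma>. finite G \<and> finite ({n. \<not> P n} - \<Union> (N ` G))"
  then obtain G where G: "G \<subseteq> \<Gamma>" "finite G" "finite ({n. \<not> P n} - \<Union> (N ` G))" by blast
  have "finite ({n. \<not> Q n} - \<Union> (N ` G))"
    by (rule finite_subset[OF _ G(3)]) (use PQ in auto)
  then show "\<exists>G\<subseteq>\<Gamma>. finite G \<and> finite ({n. \<not> Q n} - \<Union> (N ` G))" using G by blast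
qed

lemma branch_neq_bot: "\<gamma> \<in> \<Gamma> \<Longrightarrow> branch \<gamma> \<noteq> bot"
  using infinite_member[of \<gamma>] by (auto simp: trivial_limit_def eventually_branch)

lemma finite_Int_Union:
  assumes "\<gamma> \<in> \<Gamma>" "G \<subseteq> \<Gamma>" "finite G" "\<gamma> \<notin> G"
  shows "finite (N \<gamma> \<inter> \<Union> (N ` G))"
proof -
  have "finite (\<Union>\<gamma>'\<in>G. N \<gamma> \<inter> N \<gamma>')"
    using assms by (intro finite_UN_I almost_disjoint) auto
  then show ?thesis by (simp only: Int_UN_distrib)
qed

text \<open>A branch outside \<open>G\<close> meets the union of the members in \<open>G\<close> in
  a finite set, by almost disjointness. Topologically, a neighbourhood of infinity contains all but
  finitely many of the points given by branches.\<close>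

lemma eventually_infty_imp_branch:
  assumes "eventually P infty"
  obtains G where "finite G" "G \<subseteq> \<Gamma>" "\<And>\<gamma>. \<gamma> \<in> \<Gamma> - G \<Longrightarrow> eventually P (branch \<gamma>)"
proof -
  obtain G where G: "G \<subseteq> \<Gamma>" "finite G" "finite ({n. \<not> P n} - \<Union> (N ` G))"
    using assms unfolding eventually_infty by blast
  have "eventually P (branch \<gamma>)" if "\<gamma> \<in> \<Gamma> - G" for \<gamma>
    unfolding eventually_branch
  proof (rule finite_subset)
    show "{n\<in>N \<gamma>. \<not> P n} \<subseteq> ({n. \<not> P n} - \<Union> (N ` G)) \<union> (N \<gamma> \<inter> \<Union> (N ` G))" by auto
    show "finite \<dots>" using G that finite_Int_Union by auto
  qed
  then show ?thesis using that G by blast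
qed

text \<open>Finitely many members and a finite set cannot cover the naturals, because a further
  member, which exists as \<Gamma> is infinite, is almost disjoint from them.\<close>

lemma infty_neq_bot: "infty \<noteq> bot"
proof
  assume "infty = bot"
  then have "eventually (\<lambda>_. False) infty" by simp
  then obtain G where G: "finite G" "\<And>\<gamma>. \<gamma> \<in> \<Gamma> - G \<Longrightarrow> eventually (\<lambda>_. False) (branch \<gamma>)"
    by (rule eventually_infty_imp_branch) blast
  obtain \<gamma> where "\<gamma> \<in> \<Gamma> - G"
    using infinite_index G(1) by (metis Diff_infinite_finite ex_in_conv finite.emptyI)
  then show False using G(2) branch_neq_bot by (auto simp: trivial_limit_def)
qed

lemma branch_le_sequentially: "branch \<gamma> \<le> sequentially"
  by (simp add: branch_def)

lemma infty_le_sequentially: "infty \<le> sequentially"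
  unfolding le_filter_def cofinite_eq_sequentially[symmetric] eventually_cofinite eventually_infty
  by (auto intro!: exI[of _ "{}"])

lemma eventually_infty_not_member: "\<gamma> \<in> \<Gamma> \<Longrightarrow> \<forall>\<^sub>F n in infty. n \<notin> N \<gamma>"
  unfolding eventually_infty by (intro exI[of _ "{\<gamma>}"]) auto

section \<open>Limits of elements of \<open>X_JL\<close> along branches and at infinity\<close>

abbreviation JL :: "'k::{real_normed_field,banach} linf set" where
  "JL \<equiv> X_JL \<Gamma> N"

lemma subspace_JL: "linf.subspace JL" and closed_JL: "closed JL"
  using closed_subspace_X_JL[of \<Gamma> N] by (auto simp: linf.closed_subspace_def)

lemma generators_in_JL: "c0 \<union> {char_seq (N \<gamma>) | \<gamma>. \<gamma> \<in> \<Gamma>} \<union> {const_bcontfun 1} \<subseteq> JL"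
  unfolding X_JL_def using closure_subset linf.span_superset by fast

lemma c0_subset_JL: "c0 \<subseteq> JL"
  and char_seq_in_JL: "\<gamma> \<in> \<Gamma> \<Longrightarrow> char_seq (N \<gamma>) \<in> JL"
  and const_in_JL: "const_bcontfun 1 \<in> JL"
  using generators_in_JL by blast+

lemma char_seq_tendsto_branch:
  assumes "\<gamma> \<in> \<Gamma>" "\<gamma>' \<in> \<Gamma>"
  shows "(apply_bcontfun (char_seq (N \<gamma>') :: 'k::{real_normed_field,banach} linf) \<longlongrightarrow>
    (if \<gamma>' = \<gamma> then 1 else 0)) (branch \<gamma>)"
proof (rule tendsto_eventually)
  have "{n\<in>N \<gamma>. \<not> apply_bcontfun (char_seq (N \<gamma>') :: 'k linf) n = (if \<gamma>' = \<gamma> then 1 else 0)}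
      \<subseteq> (if \<gamma>' = \<gamma> then {} else N \<gamma> \<inter> N \<gamma>')" by auto
  moreover have "finite (if \<gamma>' = \<gamma> then {} else N \<gamma> \<inter> N \<gamma>')"
    using almost_disjoint[OF assms] by auto
  ultimately show "\<forall>\<^sub>F n in branch \<gamma>. apply_bcontfun (char_seq (N \<gamma>') :: 'k linf) n = (if \<gamma>' = \<gamma> then 1 else 0)"
    unfolding eventually_branch by (rule finite_subset)
qed

lemma char_seq_tendsto_infty:
  assumes "\<gamma> \<in> \<Gamma>"
  shows "(apply_bcontfun (char_seq (N \<gamma>) :: 'k::{real_normed_field,banach} linf) \<longlongrightarrow> 0) infty"
  using eventually_infty_not_member[OF assms] by (intro tendsto_eventually) (auto elim: eventually_mono)

text \<open>Sequences convergent along \<open>F\<close> form a closed subspace, so it is enough to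
  test the generators: \<open>c0\<close>, where \<open>F \<le> sequentially\<close> decides, the
  constant, and the characteristic sequences.\<close>

lemma JL_convergent_along:
  assumes F: "F \<noteq> bot" "F \<le> sequentially"
    and char: "\<And>\<gamma>. \<gamma> \<in> \<Gamma> \<Longrightarrow> \<exists>l. (apply_bcontfun (char_seq (N \<gamma>) :: 'k::{real_normed_field,banach} linf) \<longlongrightarrow> l) F"
    and f: "f \<in> (JL :: 'k linf set)"
  shows "(apply_bcontfun f \<longlongrightarrow> lim_along F f) F"
proof -
  let ?C = "{f :: 'k linf. \<exists>l. (apply_bcontfun f \<longlongrightarrow> l) F}"
  have "c0 \<subseteq> ?C"
    using tendsto_mono[OF F(2)] unfolding c0_def by blast
  moreover have "const_bcontfun 1 \<in> ?C" by (auto intro!: tendsto_const)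
  moreover have "{char_seq (N \<gamma>) | \<gamma>. \<gamma> \<in> \<Gamma>} \<subseteq> ?C" using char by blast
  ultimately have "linf.span (c0 \<union> {char_seq (N \<gamma>) | \<gamma>. \<gamma> \<in> \<Gamma>} \<union> {const_bcontfun 1}) \<subseteq> ?C"
    by (intro linf.span_minimal subspace_convergent_along) blast
  then have "JL \<subseteq> ?C"
    unfolding X_JL_def by (rule closure_minimal[OF _ closed_convergent_along[OF F(1)]])
  then obtain l where "(apply_bcontfun f \<longlongrightarrow> l) F" using f by blast
  then show ?thesis using lim_along_eq[OF F(1)] by metis
qed

lemma JL_tendsto_branch:
  assumes "\<gamma> \<in> \<Gamma>" "f \<in> JL"
  shows "(apply_bcontfun f \<longlongrightarrow> lim_along (branch \<gamma>) f) (branch \<gamma>)"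
  by (rule JL_convergent_along[OF branch_neq_bot[OF assms(1)] branch_le_sequentially _ assms(2)])
     (use char_seq_tendsto_branch[OF assms(1)] in blast)

lemma JL_tendsto_infty:
  assumes "f \<in> JL"
  shows "(apply_bcontfun f \<longlongrightarrow> lim_along infty f) infty"
  by (rule JL_convergent_along[OF infty_neq_bot infty_le_sequentially _ assms])
     (use char_seq_tendsto_infty in blast)

lemma functional_on_branch: "\<gamma> \<in> \<Gamma> \<Longrightarrow> linf.functional_on JL 1 (lim_along (branch \<gamma>))"
  by (intro functional_on_lim_along branch_neq_bot JL_tendsto_branch)

lemma functional_on_infty: "linf.functional_on JL 1 (lim_along infty)"
  by (intro functional_on_lim_along infty_neq_bot JL_tendsto_infty)

text \<open>The branch limits minus the limit at infinity thus form a null family on \<Gamma>. The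
  reason is that \<open>f\<close> is close to its limit eventually along \<open>infty\<close>, hence
  eventually along all but finitely many branches.\<close>

lemma finite_branch_far_from_infty:
  assumes f: "f \<in> JL" and e: "e > 0"
  shows "finite {\<gamma>\<in>\<Gamma>. dist (lim_along (branch \<gamma>) f) (lim_along infty f) > e}"
proof -
  have "\<forall>\<^sub>F n in infty. dist (apply_bcontfun f n) (lim_along infty f) < e"
    using JL_tendsto_infty[OF f] e by (rule tendstoD)
  then obtain G where G: "finite G" "\<And>\<gamma>. \<gamma> \<in> \<Gamma> - G \<Longrightarrow>
      \<forall>\<^sub>F n in branch \<gamma>. dist (apply_bcontfun f n) (lim_along infty f) < e"
    by (rule eventually_infty_imp_branch) blast
  have "dist (lim_along (branch \<gamma>) f) (lim_along infty f) \<le> e" if "\<gamma> \<in> \<Gamma> - G" for \<gamma>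
    using that eventually_mono[OF G(2)[OF that] less_imp_le]
    by (intro tendsto_upperbound[OF tendsto_dist[OF JL_tendsto_branch[of \<gamma> f] tendsto_const] _ branch_neq_bot])
       (auto simp: f)
  then have "{\<gamma>\<in>\<Gamma>. dist (lim_along (branch \<gamma>) f) (lim_along infty f) > e} \<subseteq> G"
    by (auto simp: not_less[symmetric])
  then show ?thesis using G(1) finite_subset by blast
qed

text \<open>Compactness in contrapositive form: if the limits along all branches and at infinity are
  below \<open>e\<close> in norm, the coordinates of size at least \<open>e\<close> lie in finitely
  many \<open>N \<gamma>\<close> and a finite set, and each of these \<open>N \<gamma>\<close> holds
  only finitely many of them.\<close>

lemma infinite_large_imp_branch_large:
  assumes f: "f \<in> JL" and inf: "infinite {n. norm (apply_bcontfun f n) > e}"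
    and e: "norm (lim_along infty f) < e"
  shows "\<exists>\<gamma>\<in>\<Gamma>. norm (lim_along (branch \<gamma>) f) \<ge> e"
proof (rule ccontr)
  assume no: "\<not> (\<exists>\<gamma>\<in>\<Gamma>. norm (lim_along (branch \<gamma>) f) \<ge> e)"
  have "\<forall>\<^sub>F n in infty. norm (apply_bcontfun f n) < e"
    using tendsto_norm[OF JL_tendsto_infty[OF f]] e by (rule order_tendstoD(2))
  then obtain G where G: "G \<subseteq> \<Gamma>" "finite G" "finite ({n. \<not> norm (apply_bcontfun f n) < e} - \<Union> (N ` G))"
    unfolding eventually_infty by blast
  have "finite {n\<in>N \<gamma>. \<not> norm (apply_bcontfun f n) < e}" if "\<gamma> \<in> G" for \<gamma>
  proof -
    have "\<gamma> \<in> \<Gamma>" using that G(1) by blast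
    then have "\<forall>\<^sub>F n in branch \<gamma>. norm (apply_bcontfun f n) < e"
      using no by (intro order_tendstoD(2)[OF tendsto_norm[OF JL_tendsto_branch[OF _ f]]]) (auto simp: not_le)
    then show ?thesis by (simp add: eventually_branch)
  qed
  then have "finite (({n. \<not> norm (apply_bcontfun f n) < e} - \<Union> (N ` G)) \<union>
      (\<Union>\<gamma>\<in>G. {n\<in>N \<gamma>. \<not> norm (apply_bcontfun f n) < e}))"
    using G by blast
  then have "finite {n. norm (apply_bcontfun f n) > e}" by (rule finite_subset[rotated]) auto
  then show False using inf by blast
qed

text \<open>Either infinitely many terms lie in one \<open>N \<gamma>\<close>, and they tend to
  \<open>branch \<gamma>\<close>, or each member contains only finitely many terms, and the whole
  sequence tends to \<open>infty\<close>. Injectivity makes preimages of finite sets finite.\<close>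

lemma evaluations_convergent_subsequence:
  fixes t :: "nat \<Rightarrow> nat"
  assumes t: "inj t"
  shows "\<exists>r. strict_mono r \<and> (\<forall>f\<in>(JL :: 'k::{real_normed_field,banach} linf set).
    convergent (\<lambda>k. apply_bcontfun f (t (r k))))"
proof (cases "\<exists>\<gamma>\<in>\<Gamma>. infinite {k. t k \<in> N \<gamma>}")
  case True
  then obtain \<gamma> where \<gamma>: "\<gamma> \<in> \<Gamma>" "infinite {k. t k \<in> N \<gamma>}" by blast
  define r where "r = enumerate {k. t k \<in> N \<gamma>}"
  have r: "strict_mono r" "t (r k) \<in> N \<gamma>" for k
    using strict_mono_enumerate[OF \<gamma>(2)] enumerate_in_set[OF \<gamma>(2), of k] by (auto simp: r_def)
  have "filterlim (\<lambda>k. t (r k)) (branch \<gamma>) sequentially"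
    unfolding filterlim_iff
  proof (intro allI impI)
    fix P assume "eventually P (branch \<gamma>)"
    then have "finite ((t \<circ> r) -` {n\<in>N \<gamma>. \<not> P n})"
      unfolding eventually_branch
      using inj_compose[OF t strict_mono_imp_inj_on[OF r(1)]] by (intro finite_vimageI)
    moreover have "(t \<circ> r) -` {n\<in>N \<gamma>. \<not> P n} = {k. \<not> P (t (r k))}" using r(2) by auto
    ultimately show "\<forall>\<^sub>F k in sequentially. P (t (r k))"
      by (simp add: cofinite_eq_sequentially[symmetric] eventually_cofinite)
  qed
  then have "convergent (\<lambda>k. apply_bcontfun f (t (r k)))" if "f \<in> JL" for f :: "'k linf"
    using filterlim_compose[OF JL_tendsto_branch[OF \<gamma>(1) that]] by (auto simp: convergent_def)
  then show ?thesis using r(1) by blast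
next
  case False
  have "filterlim t infty sequentially"
    unfolding filterlim_iff
  proof (intro allI impI)
    fix P assume "eventually P infty"
    then obtain G where G: "G \<subseteq> \<Gamma>" "finite G" "finite ({n. \<not> P n} - \<Union> (N ` G))"
      unfolding eventually_infty by blast
    have "finite (t -` ({n. \<not> P n} - \<Union> (N ` G)) \<union> (\<Union>\<gamma>\<in>G. {k. t k \<in> N \<gamma>}))"
      using G False t by (auto intro: finite_vimageI)
    then have "finite {k. \<not> P (t k)}" by (rule finite_subset[rotated]) auto
    then show "\<forall>\<^sub>F k in sequentially. P (t k)"
      by (simp add: cofinite_eq_sequentially[symmetric] eventually_cofinite)
  qed
  then have "convergent (\<lambda>k. apply_bcontfun f (t (id k)))" if "f \<in> JL" for f :: "'k linf"
    using filterlim_compose[OF JL_tendsto_infty[OF that]] by (auto simp: convergent_def)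
  then show ?thesis using strict_mono_id by blast
qed

lemma branch_limits_tendsto_infty:
  fixes t :: "nat \<Rightarrow> 'g"
  assumes t: "inj t" "range t \<subseteq> \<Gamma>" and f: "f \<in> JL"
  shows "(\<lambda>k. lim_along (branch (t k)) f) \<longlonglongrightarrow> lim_along infty f"
proof (rule tendstoI)
  fix e :: real assume e: "e > 0"
  have "finite (t -` {\<gamma>\<in>\<Gamma>. dist (lim_along (branch \<gamma>) f) (lim_along infty f) > e / 2})"
    using e by (intro finite_vimageI t(1) finite_branch_far_from_infty f) simp
  then have "finite {k. \<not> dist (lim_along (branch (t k)) f) (lim_along infty f) < e}"
    by (rule finite_subset[rotated]) (use t(2) e in auto)
  then show "\<forall>\<^sub>F k in sequentially. dist (lim_along (branch (t k)) f) (lim_along infty f) < e"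
    by (simp add: cofinite_eq_sequentially[symmetric] eventually_cofinite)
qed

section \<open>Subprojectivity\<close>

theorem subprojective_JL: "linf.subprojective (JL :: 'k::{real_normed_field,banach} linf set)"
  unfolding linf.subprojective_def
proof (intro allI impI, elim conjE)
  fix M :: "'k linf set"
  assume M: "linf.closed_subspace JL M" and inf: "linf.infinite_dim M"
  have M': "linf.subspace M" "closed M" "M \<subseteq> JL" using M by (auto simp: linf.closed_subspace_def)
  define small where "small = (\<lambda>e G x. x \<in> M \<and> (\<forall>n\<in>G. apply_bcontfun x n = 0) \<and>
    (\<forall>n. norm (apply_bcontfun x n) \<le> 1) \<and> (\<exists>n. norm (apply_bcontfun x n) \<ge> 1 / 2) \<and>
    finite {n. norm (apply_bcontfun x n) > e})"
  show "\<exists>L. L \<subseteq> M \<and> linf.infinite_dim L \<and> linf.complemented JL L"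
  proof (cases "\<forall>e>0. \<forall>G. finite G \<longrightarrow> (\<exists>x. small e G x)")
    case True
    show ?thesis
    proof (rule linf.complemented_in_subspace[OF subspace_JL closed_JL M' subset_refl M'(1)])
      show "linf.functional_on JL 1 (\<lambda>f :: 'k linf. apply_bcontfun f n)" for n
        by (rule functional_on_apply)
      show "norm x \<le> 1 * B" if "\<And>n. n \<in> UNIV \<Longrightarrow> norm (apply_bcontfun x n) \<le> B" for x :: "'k linf" and B
        using that by (intro norm_linf_leI) simp
      show "\<exists>x\<in>M. (\<forall>n\<in>G. apply_bcontfun x n = 0) \<and> (\<forall>n\<in>UNIV. norm (apply_bcontfun x n) \<le> 1) \<and>
          (\<exists>n\<in>UNIV. norm (apply_bcontfun x n) \<ge> 1 / 2) \<and> finite {n\<in>UNIV. norm (apply_bcontfun x n) > e}"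
        if eG: "e > 0" "finite G" for e G
      proof -
        obtain x where "small e G x" using True eG by blast
        then show ?thesis by (intro bexI[of _ x]) (simp_all add: small_def)
      qed
      show "\<exists>r. strict_mono r \<and> (\<forall>f\<in>(JL :: 'k linf set). convergent (\<lambda>k. apply_bcontfun f (t (r k))))"
        if "inj t" for t :: "nat \<Rightarrow> nat"
        using that by (rule evaluations_convergent_subsequence)
    qed
  next
    case False
    then obtain e0 G0 where e0: "e0 > 0" "finite G0" "\<And>x. \<not> small e0 G0 x" by blast
    define M1 where "M1 = {x\<in>M. \<forall>n\<in>G0. apply_bcontfun x n = 0}"
    \<comment> \<open>With limit 0 at infinity, infinitely many coordinates above \<open>e0\<close>
      force a branch limit of size at least \<open>e0\<close>; moreover the branch limits form a
      null family, as the finiteness condition on humps requires.\<close>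
    define M2 where "M2 = {x\<in>M1. lim_along infty x = 0}"
    have M1: "linf.subspace M1" "linf.infinite_dim M1"
      using linf.infinite_dim_kernels[OF e0(2) M'(1) inf functional_on_apply] by (auto simp: M1_def)
    have "M1 \<subseteq> JL" using M' by (auto simp: M1_def)
    then have \<phi>: "linf.functional_on M1 1 (lim_along infty)"
      by (rule linf.functional_on_subset[OF functional_on_infty])
    have M2: "linf.subspace M2" "linf.infinite_dim M2" "M2 \<subseteq> M"
      unfolding M2_def using linf.subspace_kernel[OF M1(1) \<phi>] linf.infinite_dim_kernel[OF M1 \<phi>]
      by (auto simp: M1_def)
    have M2_JL: "M2 \<subseteq> JL" using M2 M' by blast
    have large: "\<exists>\<gamma>\<in>\<Gamma>. norm (lim_along (branch \<gamma>) x) \<ge> e0 * norm x" if x: "x \<in> M2" "x \<noteq> 0" for x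
    proof -
      define c where "c = (of_real (inverse (norm x)) :: 'k)"
      define y where "y = linf_scale c x"
      have c: "norm c = inverse (norm x)" by (simp add: c_def norm_inverse)
      have y: "y \<in> M2" unfolding y_def using x M2(1) by (simp add: linf.subspace_scale)
      have ny: "norm y = 1" unfolding y_def using x by (simp add: linf.norm_scale c)
      have "\<exists>n. norm (apply_bcontfun y n) \<ge> 1 / 2"
      proof (rule ccontr)
        assume "\<not> (\<exists>n. norm (apply_bcontfun y n) \<ge> 1 / 2)"
        then have "norm y \<le> 1 / 2" by (intro norm_linf_leI) (auto simp: not_le less_imp_le)
        then show False using ny by simp
      qed
      moreover have "norm (apply_bcontfun y n) \<le> 1" for n
        using norm_bounded[of y n] ny by simp
      moreover have "y \<in> M" "\<forall>n\<in>G0. apply_bcontfun y n = 0"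
        using y by (auto simp: M2_def M1_def)
      ultimately have "infinite {n. norm (apply_bcontfun y n) > e0}"
        using e0(3)[of y] by (auto simp: small_def)
      moreover have yJL: "y \<in> JL" using y M2_JL by blast
      moreover have "norm (lim_along infty y) < e0" using y e0(1) by (simp add: M2_def)
      ultimately obtain \<gamma> where \<gamma>: "\<gamma> \<in> \<Gamma>" "norm (lim_along (branch \<gamma>) y) \<ge> e0"
        using infinite_large_imp_branch_large by blast
      have "lim_along (branch \<gamma>) y = c * lim_along (branch \<gamma>) x"
        unfolding y_def using x M2_JL by (intro linf.functional_on_scale[OF functional_on_branch[OF \<gamma>(1)]]) auto
      then show ?thesis using \<gamma> x(2) by (intro bexI[of _ \<gamma>]) (auto simp: norm_mult c field_simps)
    qed
    show ?thesis
    proof (rule linf.complemented_in_subspace[OF subspace_JL closed_JL M' M2(3,1), of \<Gamma> 1 "\<lambda>\<gamma>. lim_along (branch \<gamma>)" "1 / e0"])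
      show "linf.functional_on JL 1 (lim_along (branch \<gamma>) :: 'k linf \<Rightarrow> 'k)" if "\<gamma> \<in> \<Gamma>" for \<gamma>
        using that by (rule functional_on_branch)
      show norming: "norm x \<le> 1 / e0 * B"
        if x: "x \<in> M2" and B: "\<And>\<gamma>. \<gamma> \<in> \<Gamma> \<Longrightarrow> norm (lim_along (branch \<gamma>) x) \<le> B" for x B
      proof (cases "x = 0")
        case True
        obtain \<gamma> where "\<gamma> \<in> \<Gamma>" using infinite_index by (metis ex_in_conv finite.emptyI)
        then have "B \<ge> 0" using B by (meson norm_ge_zero order_trans)
        then show ?thesis using True e0(1) by simp
      next
        case False
        then obtain \<gamma> where "\<gamma> \<in> \<Gamma>" "norm (lim_along (branch \<gamma>) x) \<ge> e0 * norm x"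
          using large x by blast
        then have "e0 * norm x \<le> B" using B by (meson order_trans)
        then show ?thesis using e0(1) by (simp add: field_simps)
      qed
      show "\<exists>r. strict_mono r \<and> (\<forall>f\<in>JL. convergent (\<lambda>k. lim_along (branch (t (r k))) f :: 'k))"
        if "inj t" "range t \<subseteq> \<Gamma>" for t :: "nat \<Rightarrow> 'g"
        using branch_limits_tendsto_infty[OF that] strict_mono_id
        by (intro exI[of _ id]) (auto simp: convergent_def)
      fix e :: real and H assume e: "e > 0" and H: "finite H" "H \<subseteq> \<Gamma>"
      have "linf.functional_on M2 1 (lim_along (branch \<gamma>))" if "\<gamma> \<in> H" for \<gamma>
        using that H by (intro linf.functional_on_subset[OF functional_on_branch M2_JL]) auto
      then have "linf.infinite_dim {x\<in>M2. \<forall>\<gamma>\<in>H. lim_along (branch \<gamma>) x = 0}"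
        using linf.infinite_dim_kernels[OF H(1) M2(1,2), where K = 1 and \<phi> = "\<lambda>\<gamma>. lim_along (branch \<gamma>)"]
        by blast
      then obtain x where x: "x \<in> M2" "x \<noteq> 0" "\<And>\<gamma>. \<gamma> \<in> H \<Longrightarrow> lim_along (branch \<gamma>) x = 0"
        using linf.infinite_dim_nonzero by blast
      \<comment> \<open>Dividing by the supremum of the branch limits instead of the norm gives
        values at most 1, one of them at least 1/2. The supremum is positive because the branch
        limits are norming on \<open>M2\<close>.\<close>
      define s where "s = (SUP \<gamma>\<in>\<Gamma>. norm (lim_along (branch \<gamma>) x))"
      have bdd: "bdd_above ((\<lambda>\<gamma>. norm (lim_along (branch \<gamma>) x)) ` \<Gamma>)"
        using linf.functional_on_norm[OF functional_on_branch] x(1) M2_JL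
        by (intro bdd_aboveI2[where M = "norm x"]) force
      have ne: "\<Gamma> \<noteq> {}" using infinite_index by auto
      obtain \<gamma>0 where \<gamma>0: "\<gamma>0 \<in> \<Gamma>" "norm (lim_along (branch \<gamma>0) x) \<ge> e0 * norm x"
        using large x by blast
      have s: "s > 0" "\<And>\<gamma>. \<gamma> \<in> \<Gamma> \<Longrightarrow> norm (lim_along (branch \<gamma>) x) \<le> s"
      proof -
        show up: "norm (lim_along (branch \<gamma>) x) \<le> s" if "\<gamma> \<in> \<Gamma>" for \<gamma>
          unfolding s_def using that bdd by (rule cSUP_upper)
        have "0 < e0 * norm x" using e0(1) x(2) by simp
        then show "s > 0" using \<gamma>0 up[of \<gamma>0] by linarith
      qed
      define c where "c = (of_real (inverse s) :: 'k)"
      define y where "y = linf_scale c x"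
      have y: "y \<in> M2" unfolding y_def using x M2(1) by (simp add: linf.subspace_scale)
      have Ly: "lim_along (branch \<gamma>) y = c * lim_along (branch \<gamma>) x" if "\<gamma> \<in> \<Gamma>" for \<gamma>
        unfolding y_def using x M2_JL by (intro linf.functional_on_scale[OF functional_on_branch[OF that]]) auto
      have Lyn: "norm (lim_along (branch \<gamma>) y) = norm (lim_along (branch \<gamma>) x) / s" if "\<gamma> \<in> \<Gamma>" for \<gamma>
        using s(1) by (simp add: Ly[OF that] norm_mult c_def norm_inverse divide_inverse mult.commute)
      show "\<exists>x\<in>M2. (\<forall>\<gamma>\<in>H. lim_along (branch \<gamma>) x = 0) \<and> (\<forall>\<gamma>\<in>\<Gamma>. norm (lim_along (branch \<gamma>) x) \<le> 1) \<and>
          (\<exists>\<gamma>\<in>\<Gamma>. norm (lim_along (branch \<gamma>) x) \<ge> 1 / 2) \<and>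
          finite {\<gamma>\<in>\<Gamma>. norm (lim_along (branch \<gamma>) x) > e}"
      proof (intro bexI[of _ y] conjI ballI y)
        fix \<gamma> assume "\<gamma> \<in> H"
        then show "lim_along (branch \<gamma>) y = 0" using Ly x(3) H by auto
      next
        fix \<gamma> assume "\<gamma> \<in> \<Gamma>"
        then show "norm (lim_along (branch \<gamma>) y) \<le> 1" using s by (simp add: Lyn)
      next
        have "s / 2 < s" using s(1) by simp
        then obtain \<gamma> where "\<gamma> \<in> \<Gamma>" "s / 2 < norm (lim_along (branch \<gamma>) x)"
          unfolding s_def less_cSUP_iff[OF ne bdd] by (auto simp: s_def)
        then show "\<exists>\<gamma>\<in>\<Gamma>. norm (lim_along (branch \<gamma>) y) \<ge> 1 / 2"
          using s(1) by (intro bexI[of _ \<gamma>]) (auto simp: Lyn field_simps)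
      next
        have "y \<in> JL" "lim_along infty y = 0" using y M2_JL by (auto simp: M2_def)
        then show "finite {\<gamma>\<in>\<Gamma>. norm (lim_along (branch \<gamma>) y) > e}"
          using finite_branch_far_from_infty[of y e] e by simp
      qed
    qed
  qed
qed

end

section \<open>Subspaces of infinite codimension\<close>

lemma norm_linf_restrict_le: "norm (linf_restrict A f) \<le> norm f"
  by (intro norm_linf_leI) (simp add: norm_bounded)

lemma linf_restrict_Diff: "linf_restrict (A - B) f = linf_restrict A f - linf_restrict B (linf_restrict A f)"
  by (rule bcontfun_eqI) simp

lemma linf_restrict_Un: "linf_restrict (A \<union> B) f = linf_restrict A f + linf_restrict (B - A) f"
  by (rule bcontfun_eqI) simp

section \<open>Restrictions to finite unions of members, and approximation from a subspace\<close>

context almost_disjoint_family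
begin

lemma restrict_finite_in_JL: "finite A \<Longrightarrow> linf_restrict A f \<in> JL"
  by (intro subsetD[OF c0_subset_JL] finite_support_in_c0) (auto elim: rev_finite_subset)

text \<open>After subtraction of its limit along \<open>N \<gamma>\<close>, \<open>f\<close> is null
  there and its restriction lies in \<open>c0\<close>; the subtracted constant returns as a multiple
  of \<open>char_seq (N \<gamma>)\<close>.\<close>

lemma restrict_member_in_JL:
  fixes f :: "'k::{real_normed_field,banach} linf"
  assumes \<gamma>: "\<gamma> \<in> \<Gamma>" and f: "f \<in> JL"
  shows "linf_restrict (N \<gamma>) f \<in> JL"
proof -
  let ?l = "lim_along (branch \<gamma>) f"
  let ?g = "f - linf_scale ?l (const_bcontfun 1)"
  have "((\<lambda>n. apply_bcontfun f n - ?l) \<longlongrightarrow> 0) (branch \<gamma>)"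
    using JL_tendsto_branch[OF \<gamma> f] by (rule LIM_zero)
  moreover have "apply_bcontfun ?g = (\<lambda>n. apply_bcontfun f n - ?l)"
    by (rule ext) simp
  ultimately have "linf_restrict (N \<gamma>) ?g \<in> JL"
    unfolding branch_def by (intro subsetD[OF c0_subset_JL] linf_restrict_in_c0) simp
  then have "linf_restrict (N \<gamma>) ?g + linf_scale ?l (char_seq (N \<gamma>)) \<in> JL"
    using \<gamma> by (intro linf.subspace_add linf.subspace_scale subspace_JL char_seq_in_JL)
  moreover have "linf_restrict (N \<gamma>) f = linf_restrict (N \<gamma>) ?g + linf_scale ?l (char_seq (N \<gamma>))"
    by (rule bcontfun_eqI) simp
  ultimately show ?thesis by simp
qed

lemma restrict_Diff_in_JL:
  fixes f :: "'k::{real_normed_field,banach} linf"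
  assumes "\<And>f :: 'k linf. f \<in> JL \<Longrightarrow> linf_restrict A f \<in> JL"
    and "\<And>f :: 'k linf. f \<in> JL \<Longrightarrow> linf_restrict B f \<in> JL" and "f \<in> JL"
  shows "linf_restrict (A - B) f \<in> JL"
  unfolding linf_restrict_Diff by (intro linf.subspace_diff subspace_JL assms)

lemma restrict_Un_in_JL:
  fixes f :: "'k::{real_normed_field,banach} linf"
  assumes "\<And>f :: 'k linf. f \<in> JL \<Longrightarrow> linf_restrict A f \<in> JL"
    and "\<And>f :: 'k linf. f \<in> JL \<Longrightarrow> linf_restrict B f \<in> JL" and "f \<in> JL"
  shows "linf_restrict (A \<union> B) f \<in> JL"
  unfolding linf_restrict_Un by (intro linf.subspace_add subspace_JL restrict_Diff_in_JL assms)

lemma restrict_Union_in_JL: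
  assumes "finite G" "G \<subseteq> \<Gamma>" "f \<in> JL"
  shows "linf_restrict (\<Union> (N ` G)) f \<in> JL"
  using assms
proof (induction G arbitrary: f)
  case (insert \<gamma> G)
  have "linf_restrict (N \<gamma> \<union> \<Union> (N ` G)) f \<in> JL"
    using insert by (intro restrict_Un_in_JL restrict_member_in_JL) auto
  then show ?case by simp
qed (simp add: restrict_finite_in_JL)

lemma restrict_Union_Un_in_JL:
  assumes "finite G" "G \<subseteq> \<Gamma>" "finite P" "f \<in> JL"
  shows "linf_restrict (\<Union> (N ` G) \<union> P) f \<in> JL"
  using assms by (intro restrict_Un_in_JL restrict_Union_in_JL restrict_finite_in_JL)

text \<open>The exceptional set \<open>P\<close> contains the pairwise intersections, so that off \<open>P\<close> the function
  below differs from \<open>f\<close> by a single branch limit and its norm is independent of \<open>G\<close>.\<close>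

lemma restrict_minus_branch_limits:
  fixes f :: "'k::{real_normed_field,banach} linf"
  assumes G: "finite G" "G \<subseteq> \<Gamma>" and f: "f \<in> JL"
    and P: "\<And>\<gamma> \<gamma>'. \<gamma> \<in> G \<Longrightarrow> \<gamma>' \<in> G \<Longrightarrow> \<gamma> \<noteq> \<gamma>' \<Longrightarrow> N \<gamma> \<inter> N \<gamma>' \<subseteq> P"
  defines "h \<equiv> linf_restrict (- P) (linf_restrict (\<Union> (N ` G) \<union> P) f
    - (\<Sum>\<gamma>\<in>G. linf_scale (lim_along (branch \<gamma>) f) (char_seq (N \<gamma>))))"
  shows "h \<in> c0" and "norm h \<le> 2 * norm f"
proof -
  have val: "apply_bcontfun h n = apply_bcontfun f n - lim_along (branch \<gamma>) f"
    if n: "n \<notin> P" "n \<in> N \<gamma>" "\<gamma> \<in> G" for n \<gamma>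
  proof -
    have "(\<Sum>\<gamma>'\<in>G. lim_along (branch \<gamma>') f * (if n \<in> N \<gamma>' then 1 else 0)) =
        (\<Sum>\<gamma>'\<in>G. if \<gamma>' = \<gamma> then lim_along (branch \<gamma>) f else 0)"
      using P[of _ \<gamma>] n by (intro sum.cong) auto
    then show ?thesis using n G(1) by (auto simp: h_def)
  qed
  have zero: "apply_bcontfun h n = 0" if "n \<in> P \<or> n \<notin> \<Union> (N ` G)" for n
    using that by (auto simp: h_def intro!: sum.neutral)
  show "norm h \<le> 2 * norm f"
  proof (rule norm_linf_leI)
    fix n
    show "norm (apply_bcontfun h n) \<le> 2 * norm f"
    proof (cases "n \<in> P \<or> n \<notin> \<Union> (N ` G)")
      case False
      then obtain \<gamma> where \<gamma>: "n \<notin> P" "n \<in> N \<gamma>" "\<gamma> \<in> G" by blast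
      then have "\<gamma> \<in> \<Gamma>" using G by blast
      then show ?thesis
        using val[OF \<gamma>] norm_triangle_ineq4[of "apply_bcontfun f n" "lim_along (branch \<gamma>) f"]
          norm_bounded[of f n] linf.functional_on_norm[OF functional_on_branch f] by fastforce
    qed (simp add: zero)
  qed
  show "h \<in> c0"
    unfolding c0_apply
  proof (rule tendstoI)
    fix e :: real assume e: "e > 0"
    have "finite {n\<in>N \<gamma>. \<not> dist (apply_bcontfun f n) (lim_along (branch \<gamma>) f) < e}" if "\<gamma> \<in> G" for \<gamma>
    proof -
      have "\<gamma> \<in> \<Gamma>" using that G by blast
      from tendstoD[OF JL_tendsto_branch[OF this f] e] show ?thesis by (simp add: eventually_branch)
    qed
    then have "finite (\<Union>\<gamma>\<in>G. {n\<in>N \<gamma>. \<not> dist (apply_bcontfun f n) (lim_along (branch \<gamma>) f) < e})"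
      using G by blast
    moreover have "{n. \<not> dist (apply_bcontfun h n) 0 < e} \<subseteq>
        (\<Union>\<gamma>\<in>G. {n\<in>N \<gamma>. \<not> dist (apply_bcontfun f n) (lim_along (branch \<gamma>) f) < e})"
    proof
      fix n assume n: "n \<in> {n. \<not> dist (apply_bcontfun h n) 0 < e}"
      then have "apply_bcontfun h n \<noteq> 0" using e by auto
      then have "\<not> (n \<in> P \<or> n \<notin> \<Union> (N ` G))" using zero[of n] by blast
      then obtain \<gamma> where "n \<notin> P" "n \<in> N \<gamma>" "\<gamma> \<in> G" by blast
      then show "n \<in> (\<Union>\<gamma>\<in>G. {n\<in>N \<gamma>. \<not> dist (apply_bcontfun f n) (lim_along (branch \<gamma>) f) < e})"
        using n val[of n \<gamma>] by (auto simp: dist_norm)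
    qed
    ultimately have "finite {n. \<not> dist (apply_bcontfun h n) 0 < e}" by (rule finite_subset[rotated])
    then show "\<forall>\<^sub>F n in sequentially. dist (apply_bcontfun h n) 0 < e"
      by (simp add: cofinite_eq_sequentially[symmetric] eventually_cofinite)
  qed
qed

text \<open>\<open>f\<close> is cut into its parts on \<open>?A\<close> and on \<open>C\<close> and
  a remainder of size at most 1/20. The part on \<open>C\<close> vanishes eventually along
  \<open>infty\<close>, so \<open>near_infty\<close> applies at a cost of 1/20. The part on
  \<open>?A\<close> is a combination of the added generators plus \<open>h\<close> in
  \<open>c0\<close>, which costs 1/20 for truncation and twice 1/20 for \<open>near_c0\<close>. The
  total is five times 1/20.\<close>

lemma quarter_approximation:
  fixes f :: "'k::{real_normed_field,banach} linf"
  assumes M: "linf.subspace M"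
    and G: "finite G" "G \<subseteq> \<Gamma>" and P: "finite P"
      "\<And>\<gamma> \<gamma>'. \<gamma> \<in> G \<Longrightarrow> \<gamma>' \<in> G \<Longrightarrow> \<gamma> \<noteq> \<gamma>' \<Longrightarrow> N \<gamma> \<inter> N \<gamma>' \<subseteq> P"
    and near_c0: "\<And>x. x \<in> JL \<Longrightarrow> norm x \<le> 1 \<Longrightarrow> finite {n. apply_bcontfun x n \<noteq> 0} \<Longrightarrow>
      (\<And>n. n \<in> P \<Longrightarrow> apply_bcontfun x n = 0) \<Longrightarrow> \<exists>m\<in>M. norm (x - m) \<le> 1 / 20"
    and near_infty: "\<And>x. x \<in> JL \<Longrightarrow> norm x \<le> 1 \<Longrightarrow> \<forall>\<^sub>F n in infty. apply_bcontfun x n = 0 \<Longrightarrow>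
      (\<And>n. n \<in> \<Union> (N ` G) \<union> P \<Longrightarrow> apply_bcontfun x n = 0) \<Longrightarrow> \<exists>m\<in>M. norm (x - m) \<le> 1 / 20"
    and f: "f \<in> JL" "norm f \<le> 1" "lim_along infty f = 0"
  shows "\<exists>w\<in>linf.span (M \<union> ((\<lambda>\<gamma>. char_seq (N \<gamma>)) ` G \<union> (\<lambda>n. char_seq {n}) ` P)). norm (f - w) \<le> 1 / 4"
proof -
  let ?W = "linf.span (M \<union> ((\<lambda>\<gamma>. char_seq (N \<gamma>)) ` G \<union> (\<lambda>n. char_seq {n}) ` P))"
  let ?A = "\<Union> (N ` G) \<union> P"
  define s where "s = (\<Sum>\<gamma>\<in>G. linf_scale (lim_along (branch \<gamma>) f) (char_seq (N \<gamma>)))"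
  define g where "g = linf_restrict ?A f - s"
  define h where "h = linf_restrict (- P) g"
  have h: "h \<in> c0" "norm h \<le> 2"
    using restrict_minus_branch_limits[OF G f(1) P(2)] f(2) by (simp_all add: h_def g_def s_def)
  have "\<forall>\<^sub>F n in infty. norm (apply_bcontfun f n) < 1 / 20"
    using tendsto_norm[OF JL_tendsto_infty[OF f(1)]] by (rule order_tendstoD(2)) (simp add: f)
  then obtain H where H: "H \<subseteq> \<Gamma>" "finite H" "finite ({n. \<not> norm (apply_bcontfun f n) < 1 / 20} - \<Union> (N ` H))"
    unfolding eventually_infty by blast
  define Q where "Q = {n. \<not> norm (apply_bcontfun f n) < 1 / 20} - \<Union> (N ` H)"
  define C where "C = (\<Union> (N ` H) \<union> Q) - ?A"
  define x where "x = linf_restrict C f"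
  have Q: "finite Q" using H(3) by (simp add: Q_def)
  have "x \<in> JL"
    unfolding x_def C_def using H(1,2) Q G P(1) f(1)
    by (intro restrict_Diff_in_JL restrict_Union_Un_in_JL)
  moreover have "norm x \<le> 1"
    using norm_linf_restrict_le[of C f] f(2) by (simp add: x_def)
  moreover have "\<forall>\<^sub>F n in infty. apply_bcontfun x n = 0"
    unfolding eventually_infty
  proof (intro exI conjI)
    have "{n. apply_bcontfun x n \<noteq> 0} - \<Union> (N ` H) \<subseteq> Q" by (auto simp: x_def C_def)
    then show "finite ({n. apply_bcontfun x n \<noteq> 0} - \<Union> (N ` H))" using Q by (rule finite_subset)
  qed (use H in auto)
  moreover have "apply_bcontfun x n = 0" if "n \<in> ?A" for n
    using that by (simp add: x_def C_def)
  ultimately obtain m where m: "m \<in> M" "norm (x - m) \<le> 1 / 20"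
    using near_infty by blast
  obtain A where A: "finite A" "norm (h - linf_restrict A h) \<le> 1 / 20"
    using c0_finite_approx[OF h(1), of "1 / 20"] by auto
  \<comment> \<open>\<open>near_c0\<close> speaks of the unit ball while \<open>h\<close> may have
    norm up to 2; \<open>yh\<close> undoes the halving.\<close>
  define y where "y = linf_scale (1 / 2) (linf_restrict A h)"
  have y0: "apply_bcontfun y n = 0" if "n \<notin> A \<or> n \<in> P" for n
    using that by (auto simp: y_def h_def)
  have "finite {n. apply_bcontfun y n \<noteq> 0}"
    by (rule finite_subset[OF _ A(1)]) (use y0 in auto)
  moreover from this have "y \<in> JL" using finite_support_in_c0 c0_subset_JL by blast
  moreover have "norm y \<le> 1"
    using norm_linf_restrict_le[of A h] h(2) by (simp add: y_def linf.norm_scale norm_divide)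
  ultimately obtain m' where m': "m' \<in> M" "norm (y - m') \<le> 1 / 20"
    using near_c0 y0 by blast
  have yh: "linf_scale 2 y = linf_restrict A h"
    unfolding y_def by simp
  have "norm (linf_restrict A h - linf_scale 2 m') = 2 * norm (y - m')"
    unfolding yh[symmetric] linf.scale_right_diff_distrib[symmetric] linf.norm_scale by simp
  then have m'2: "norm (linf_restrict A h - linf_scale 2 m') \<le> 1 / 10" using m'(2) by simp
  let ?w = "m + linf_scale 2 m' + s + linf_restrict P g"
  have "linf_restrict P g \<in> ?W"
    unfolding finite_restrict_sum[OF P(1)]
    by (intro linf.span_sum linf.span_scale linf.span_base) auto
  moreover have "s \<in> ?W"
    unfolding s_def by (intro linf.span_sum linf.span_scale linf.span_base) auto
  ultimately have "?w \<in> ?W"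
    using m(1) m'(1) by (intro linf.span_add linf.span_scale) (auto intro: linf.span_base)
  moreover have "norm (f - ?w) \<le> 1 / 4"
  proof -
    let ?rest = "linf_restrict (- (?A \<union> C)) f"
    have rest: "norm ?rest \<le> 1 / 20"
      by (rule norm_linf_leI) (auto simp: C_def Q_def)
    have "f - ?w = ?rest + (x - m) + (h - linf_restrict A h) + (linf_restrict A h - linf_scale 2 m')"
      by (rule bcontfun_eqI) (auto simp: x_def h_def g_def C_def)
    also have "norm \<dots> \<le> norm ?rest + norm (x - m) + norm (h - linf_restrict A h) + norm (linf_restrict A h - linf_scale 2 m')"
      by (intro norm_triangle_mono order_refl)
    finally show ?thesis using rest m(2) A(2) m'2 by simp
  qed
  ultimately show ?thesis by blast
qed

text \<open>If there were no such sequence, the hypothesis of \<open>disjoint_sequence\<close> would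
  fail for both \<open>sequentially\<close> and \<open>infty\<close>. Each failure yields an
  exceptional set off which the eventually vanishing elements of the unit ball lie within 1/20 of
  \<open>M\<close>. Finitely many vectors absorb these sets, and together with \<open>M\<close> they
  span a closed \<open>?W\<close> to which \<open>half_dense_subspace\<close> applies, against
  infinite codimension.\<close>

lemma distant_disjoint_sequence:
  fixes M :: "'k::{real_normed_field,banach} linf set"
  assumes M: "linf.closed_subspace JL M" and codim: "linf.infinite_codim JL M"
  shows "\<exists>x :: nat \<Rightarrow> 'k linf. (\<forall>k. x k \<in> JL \<and> norm (x k) \<le> 1 \<and> infdist (x k) M \<ge> 1 / 20) \<and>
    (\<forall>i j n. i \<noteq> j \<longrightarrow> apply_bcontfun (x i) n = 0 \<or> apply_bcontfun (x j) n = 0)"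
proof (rule ccontr)
  assume no: "\<not> ?thesis"
  have M': "linf.subspace M" "closed M" "M \<subseteq> JL" using M by (auto simp: linf.closed_subspace_def)
  have Mne: "M \<noteq> {}" using linf.subspace_0[OF M'(1)] by blast
  have near: "\<exists>m\<in>M. norm (x - m) \<le> 1 / 20" if x: "\<not> infdist x M \<ge> 1 / 20" for x
  proof -
    obtain m where "m \<in> M" "dist x m < infdist x M + (1 / 20 - infdist x M)"
      using infdist_approx[OF Mne, of "1 / 20 - infdist x M" x] x by auto
    then show ?thesis by (intro bexI[of _ m]) (auto simp: dist_norm)
  qed
  have fail: "\<exists>B. (\<forall>\<^sub>F n in F. n \<notin> B) \<and> (\<forall>x\<in>JL. norm x \<le> 1 \<longrightarrow> (\<forall>\<^sub>F n in F. apply_bcontfun x n = 0) \<longrightarrow>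
      (\<forall>n\<in>B. apply_bcontfun x n = 0) \<longrightarrow> \<not> infdist (x :: 'k linf) M \<ge> 1 / 20)" for F
  proof (rule ccontr)
    assume "\<not> ?thesis"
    then have "\<exists>x\<in>JL. (norm x \<le> 1 \<and> infdist (x :: 'k linf) M \<ge> 1 / 20) \<and> (\<forall>\<^sub>F n in F. apply_bcontfun x n = 0) \<and>
        (\<forall>n\<in>B. apply_bcontfun x n = 0)" if "\<forall>\<^sub>F n in F. n \<notin> B" for B
      using that by blast
    from disjoint_sequence[where Q = "\<lambda>x. norm x \<le> 1 \<and> infdist x M \<ge> 1 / 20", OF this]
    show False using no by blast
  qed
  obtain B1 where B1: "\<forall>\<^sub>F n in sequentially. n \<notin> B1"
    "\<And>x :: 'k linf. x \<in> JL \<Longrightarrow> norm x \<le> 1 \<Longrightarrow> \<forall>\<^sub>F n in sequentially. apply_bcontfun x n = 0 \<Longrightarrow>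
      (\<forall>n\<in>B1. apply_bcontfun x n = 0) \<Longrightarrow> \<not> infdist x M \<ge> 1 / 20"
    using fail[of sequentially] by blast
  obtain B2 where B2: "\<forall>\<^sub>F n in infty. n \<notin> B2"
    "\<And>x :: 'k linf. x \<in> JL \<Longrightarrow> norm x \<le> 1 \<Longrightarrow> \<forall>\<^sub>F n in infty. apply_bcontfun x n = 0 \<Longrightarrow>
      (\<forall>n\<in>B2. apply_bcontfun x n = 0) \<Longrightarrow> \<not> infdist x M \<ge> 1 / 20"
    using fail[of infty] by blast
  have B1_fin: "finite B1"
    using B1(1) by (simp add: cofinite_eq_sequentially[symmetric] eventually_cofinite)
  obtain G where G: "G \<subseteq> \<Gamma>" "finite G" "finite (B2 - \<Union> (N ` G))"
    using B2(1) by (auto simp: eventually_infty)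
  \<comment> \<open>\<open>B2\<close> may be infinite, but being avoided along \<open>infty\<close>
    places all but finitely many of its points in the members indexed by \<open>G\<close>, so
    \<open>P\<close> is finite. Including the pairwise intersections makes these members disjoint
    off \<open>P\<close>.\<close>
  define P where "P = B1 \<union> (B2 - \<Union> (N ` G)) \<union> (\<Union>\<gamma>\<in>G. \<Union>\<gamma>'\<in>G - {\<gamma>}. N \<gamma> \<inter> N \<gamma>')"
  have "finite (\<Union>\<gamma>\<in>G. \<Union>\<gamma>'\<in>G - {\<gamma>}. N \<gamma> \<inter> N \<gamma>')"
    using G(1,2) by (intro finite_UN_I almost_disjoint) auto
  then have P: "finite P" using B1_fin G(3) by (simp add: P_def)
  define S where "S = (\<lambda>\<gamma>. char_seq (N \<gamma>)) ` G \<union> (\<lambda>n. char_seq {n} :: 'k linf) ` P"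
  have quarter: "\<exists>w\<in>linf.span (M \<union> S). norm (f - w) \<le> 1 / 4"
    if f: "f \<in> JL" "norm f \<le> 1" "lim_along infty f = 0" for f
    unfolding S_def
  proof (rule quarter_approximation[OF M'(1) G(2,1) P _ _ _ f])
    show "N \<gamma> \<inter> N \<gamma>' \<subseteq> P" if "\<gamma> \<in> G" "\<gamma>' \<in> G" "\<gamma> \<noteq> \<gamma>'" for \<gamma> \<gamma>'
      using that by (auto simp: P_def)
  next
    fix x :: "'k linf"
    assume x: "x \<in> JL" "norm x \<le> 1" "finite {n. apply_bcontfun x n \<noteq> 0}" "\<And>n. n \<in> P \<Longrightarrow> apply_bcontfun x n = 0"
    have "\<forall>\<^sub>F n in sequentially. apply_bcontfun x n = 0"
      using x(3) by (simp add: cofinite_eq_sequentially[symmetric] eventually_cofinite)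
    then show "\<exists>m\<in>M. norm (x - m) \<le> 1 / 20"
      using x by (intro near B1(2)) (auto simp: P_def)
  next
    fix x :: "'k linf"
    assume x: "x \<in> JL" "norm x \<le> 1" "\<forall>\<^sub>F n in infty. apply_bcontfun x n = 0"
      "\<And>n. n \<in> \<Union> (N ` G) \<union> P \<Longrightarrow> apply_bcontfun x n = 0"
    have "\<forall>n\<in>B2. apply_bcontfun x n = 0" using x(4) by (auto simp: P_def)
    then show "\<exists>m\<in>M. norm (x - m) \<le> 1 / 20"
      using x by (intro near B2(2))
  qed
  define T where "T = insert (const_bcontfun 1) S"
  have "char_seq {n} \<in> (JL :: 'k linf set)" for n
    by (intro subsetD[OF c0_subset_JL] finite_support_in_c0) simp
  then have T: "finite T" "T \<subseteq> JL"
    using G P char_seq_in_JL const_in_JL by (auto simp: T_def S_def)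
  let ?W = "linf.span (M \<union> T)"
  have W: "linf.subspace ?W" "closed ?W" "?W \<subseteq> JL"
    using linf.closed_span_Un_finite[OF M'(1,2) T(1)] T(2) M'(3)
    by (auto intro: linf.span_minimal[THEN subsetD, rotated 2] subspace_JL)
  have SW: "linf.span (M \<union> S) \<subseteq> ?W" by (intro linf.span_mono) (auto simp: T_def)
  have "\<exists>w\<in>?W. norm (f - w) \<le> norm f / 2" if f: "f \<in> JL" for f
  proof (cases "f = 0")
    case True
    then show ?thesis using linf.span_zero by (intro bexI[of _ 0]) auto
  next
    case False
    define l where "l = lim_along infty f"
    define g where "g = f - linf_scale l (const_bcontfun 1)"
    \<comment> \<open>Subtracting the limit at infinity can double the norm; scaling by
      \<open>2 * norm f\<close> then turns the error 1/4 into \<open>norm f / 2\<close>.\<close>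
    define c where "c = (of_real (2 * norm f) :: 'k)"
    have c: "c \<noteq> 0" "norm c = 2 * norm f" using False by (simp_all add: c_def norm_mult)
    have g: "g \<in> JL"
      unfolding g_def by (intro linf.subspace_diff linf.subspace_scale subspace_JL f const_in_JL)
    have "lim_along infty g = 0"
    proof (rule lim_along_eq[OF infty_neq_bot])
      have "((\<lambda>n. apply_bcontfun f n - l) \<longlongrightarrow> 0) infty"
        unfolding l_def using JL_tendsto_infty[OF f] by (rule LIM_zero)
      moreover have "apply_bcontfun g = (\<lambda>n. apply_bcontfun f n - l)" by (rule ext) (simp add: g_def)
      ultimately show "(apply_bcontfun g \<longlongrightarrow> 0) infty" by simp
    qed
    then have "lim_along infty (linf_scale (inverse c) g) = 0"
      using linf.functional_on_scale[OF functional_on_infty g] by simp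
    moreover have "norm g \<le> 2 * norm f"
    proof (rule norm_linf_leI)
      fix n
      have "norm l \<le> norm f"
        unfolding l_def using linf.functional_on_norm[OF functional_on_infty f] by simp
      then show "norm (apply_bcontfun g n) \<le> 2 * norm f"
        using norm_triangle_ineq4[of "apply_bcontfun f n" l] norm_bounded[of f n] by (simp add: g_def)
    qed
    then have "norm g / (2 * norm f) \<le> 1" using False by (simp add: divide_le_eq)
    then have "norm (linf_scale (inverse c) g) \<le> 1"
      unfolding linf.norm_scale norm_inverse c(2) by (simp only: divide_inverse mult.commute)
    moreover have "linf_scale (inverse c) g \<in> JL" by (intro linf.subspace_scale subspace_JL g)
    ultimately obtain w where w: "w \<in> linf.span (M \<union> S)" "norm (linf_scale (inverse c) g - w) \<le> 1 / 4"
      using quarter by blast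
    let ?w = "linf_scale l (const_bcontfun 1) + linf_scale c w"
    have "?w \<in> ?W"
      using w(1) SW by (intro linf.span_add linf.span_scale) (auto simp: T_def intro: linf.span_base)
    moreover have "f - ?w = linf_scale c (linf_scale (inverse c) g - w)"
      using c(1) by (simp add: linf.scale_right_diff_distrib g_def)
    then have "norm (f - ?w) \<le> norm f / 2"
      using w(2) c(2) mult_left_mono[OF w(2), of "2 * norm f"] by (simp add: linf.norm_scale)
    ultimately show ?thesis by blast
  qed
  then have "JL \<subseteq> ?W" using linf.half_dense_subspace[OF subspace_JL W] by blast
  then show False using codim T by (auto simp: linf.infinite_codim_def)
qed

text \<open>The common part of the two cases of \<open>superprojective_JL\<close>, which differ in
  the subspace and in the countable set that decides pointwise convergence. \<open>hb\<close> is a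
  premise because the Hahn-Banach functional is built differently over the real and the complex
  numbers.\<close>

lemma superprojective_step:
  fixes M :: "'k::{real_normed_field,banach,heine_borel} linf set"
  assumes hb: "\<And>(M :: 'k linf set) x. linf.subspace M \<Longrightarrow>
      \<exists>\<psi>. linf.functional_on UNIV 2 \<psi> \<and> (\<forall>m\<in>M. \<psi> m = 0) \<and> infdist x M \<le> norm (\<psi> x)"
    and M: "linf.closed_subspace JL M" and codim: "linf.infinite_codim JL M"
    and countable: "\<And>\<psi> :: nat \<Rightarrow> 'k linf \<Rightarrow> 'k. (\<And>k. linf.functional_on JL 2 (\<psi> k)) \<Longrightarrow> (\<And>k m. m \<in> M \<Longrightarrow> \<psi> k m = 0) \<Longrightarrow>
      \<exists>S. countable S \<and> S \<subseteq> JL \<and> JL \<subseteq> closure (linf.span ({z\<in>JL. \<forall>k. \<psi> k z = 0} \<union> S))"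
  shows "\<exists>L. M \<subseteq> L \<and> linf.infinite_codim JL L \<and> linf.complemented JL L"
proof -
  have M': "linf.subspace M" "M \<subseteq> JL" using M by (auto simp: linf.closed_subspace_def)
  obtain x :: "nat \<Rightarrow> 'k linf" where x: "\<forall>k. x k \<in> JL \<and> norm (x k) \<le> 1 \<and> infdist (x k) M \<ge> 1 / 20"
    and disj: "\<forall>i j n. i \<noteq> j \<longrightarrow> apply_bcontfun (x i) n = 0 \<or> apply_bcontfun (x j) n = 0"
    using distant_disjoint_sequence[OF M codim] by blast
  have "\<forall>k. \<exists>\<psi>. linf.functional_on UNIV 2 \<psi> \<and> (\<forall>m\<in>M. \<psi> m = 0) \<and> infdist (x k) M \<le> norm (\<psi> (x k))"
    using hb[OF M'(1)] by blast
  then obtain \<psi> where \<psi>: "\<forall>k. linf.functional_on UNIV 2 (\<psi> k) \<and> (\<forall>m\<in>M. \<psi> k m = 0) \<and> infdist (x k) M \<le> norm (\<psi> k (x k))"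
    by (rule choice[THEN exE])
  have \<psi>_JL: "linf.functional_on JL 2 (\<psi> k)" for k
    using \<psi> by (blast intro: linf.functional_on_subset)
  have \<psi>_M: "\<psi> k m = 0" if "m \<in> M" for k m using \<psi> that by blast
  obtain S where S: "countable S" "S \<subseteq> JL" "JL \<subseteq> closure (linf.span ({z\<in>JL. \<forall>k. \<psi> k z = 0} \<union> S))"
    using countable[of \<psi>, OF \<psi>_JL \<psi>_M] by blast
  obtain r where r: "strict_mono r" "\<And>f. f \<in> JL \<Longrightarrow> convergent (\<lambda>k. \<psi> (r k) f)"
    using convergent_subsequence_functionals[OF subspace_JL \<psi>_JL S] by blast
  have xJL: "x k \<in> JL" for k using x by blast
  have bdd: "linf.c0_bounded 1 x" using x disj by (intro disjoint_c0_bounded) blast+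
  have low: "1 / 20 \<le> norm (\<psi> k (x k))" for k using x \<psi> by (meson order_trans)
  show ?thesis
    by (rule linf.complemented_containing_subspace[OF subspace_JL closed_JL M'(2) xJL bdd \<psi>_JL \<psi>_M _ low r]) auto
qed

text \<open>Modulo \<open>c0\<close>, the characteristic sequences behave like the unit vectors of
  the null families on \<Gamma>, on which functionals are absolutely summable. Hence only finitely
  many values exceed a given \<open>1 / Suc m\<close>.\<close>

lemma countable_nonzero_on_char:
  fixes \<psi> :: "'k::{real_normed_field,banach} linf \<Rightarrow> 'k"
  assumes \<psi>: "linf.functional_on JL 2 \<psi>" and c0: "\<And>f. f \<in> c0 \<Longrightarrow> \<psi> f = 0"
  shows "countable {\<gamma>\<in>\<Gamma>. \<psi> (char_seq (N \<gamma>)) \<noteq> 0}"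
proof -
  have fin: "finite {\<gamma>\<in>\<Gamma>. norm (\<psi> (char_seq (N \<gamma>))) > 1 / Suc m}" (is "finite ?A") for m
  proof (rule ccontr)
    assume "infinite ?A"
    then obtain t :: "nat \<Rightarrow> 'g" where t: "inj t" "range t \<subseteq> ?A"
      using infinite_countable_subset by blast
    then have t\<Gamma>: "t j \<in> \<Gamma>" for j by blast
    \<comment> \<open>Deleting the earlier members makes the supports disjoint. By almost
      disjointness only finitely many coordinates change, which \<open>\<psi>\<close> does not
      notice as it vanishes on \<open>c0\<close>.\<close>
    define y where "y = (\<lambda>j. char_seq (N (t j) - \<Union> (N ` t ` {..<j})) :: 'k linf)"
    have y: "y j \<in> JL" "\<psi> (y j) = \<psi> (char_seq (N (t j)))" for j
    proof -
      have "t j \<notin> t ` {..<j}" using t(1) by (auto simp: inj_eq)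
      then have "finite (N (t j) \<inter> \<Union> (N ` t ` {..<j}))"
        using t\<Gamma> by (intro finite_Int_Union) auto
      moreover have "{n. apply_bcontfun (char_seq (N (t j)) - y j) n \<noteq> 0} \<subseteq> N (t j) \<inter> \<Union> (N ` t ` {..<j})"
        by (auto simp: y_def)
      ultimately have d: "char_seq (N (t j)) - y j \<in> c0"
        by (intro finite_support_in_c0) (rule finite_subset)
      have "char_seq (N (t j)) - (char_seq (N (t j)) - y j) \<in> JL"
        by (rule linf.subspace_diff[OF subspace_JL char_seq_in_JL[OF t\<Gamma>] subsetD[OF c0_subset_JL d]])
      then show yJL: "y j \<in> JL" by simp
      show "\<psi> (y j) = \<psi> (char_seq (N (t j)))"
        using c0[OF d] linf.functional_on_diff[OF \<psi> subspace_JL char_seq_in_JL[OF t\<Gamma>] yJL] by simp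
    qed
    have "linf.c0_bounded 1 y"
    proof (rule disjoint_c0_bounded)
      show "norm (y k) \<le> 1" for k by (rule norm_linf_leI) (simp add: y_def)
      have lt: "apply_bcontfun (y i) n = 0 \<or> apply_bcontfun (y j) n = 0" if "i < j" for i j n
        using that by (auto simp: y_def)
      then show "apply_bcontfun (y i) n = 0 \<or> apply_bcontfun (y j) n = 0" if "i \<noteq> j" for i j n
        using that by (metis linorder_neqE_nat)
    qed
    then have "summable (\<lambda>j. norm (\<psi> (y j)))"
      using y(1) by (intro linf.c0_bounded_summable[OF _ _ \<psi> subspace_JL]) auto
    then have "(\<lambda>j. norm (\<psi> (char_seq (N (t j))))) \<longlonglongrightarrow> 0"
      using summable_LIMSEQ_zero by (simp add: y(2))
    then have "\<forall>\<^sub>F j in sequentially. norm (\<psi> (char_seq (N (t j)))) < 1 / Suc m"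
      by (rule order_tendstoD(2)) simp
    then obtain j where "norm (\<psi> (char_seq (N (t j)))) < 1 / Suc m"
      by (auto simp: eventually_sequentially)
    moreover have "t j \<in> ?A" using t(2) by blast
    ultimately show False by simp
  qed
  have "{\<gamma>\<in>\<Gamma>. \<psi> (char_seq (N \<gamma>)) \<noteq> 0} \<subseteq> (\<Union>m. {\<gamma>\<in>\<Gamma>. norm (\<psi> (char_seq (N \<gamma>))) > 1 / Suc m})"
  proof
    fix \<gamma> assume "\<gamma> \<in> {\<gamma>\<in>\<Gamma>. \<psi> (char_seq (N \<gamma>)) \<noteq> 0}"
    then show "\<gamma> \<in> (\<Union>m. {\<gamma>\<in>\<Gamma>. norm (\<psi> (char_seq (N \<gamma>))) > 1 / Suc m})"
      using nat_approx_posE[of "norm (\<psi> (char_seq (N \<gamma>)))"] by auto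
  qed
  then show ?thesis
    by (rule countable_subset) (intro countable_UN countable_finite fin countableI_type)
qed

theorem superprojective_JL:
  assumes hb: "\<And>(M :: 'k::{real_normed_field,banach,heine_borel} linf set) x. linf.subspace M \<Longrightarrow>
      \<exists>\<psi>. linf.functional_on UNIV 2 \<psi> \<and> (\<forall>m\<in>M. \<psi> m = 0) \<and> infdist x M \<le> norm (\<psi> x)"
  shows "linf.superprojective (JL :: 'k linf set)"
  unfolding linf.superprojective_def
proof (intro allI impI, elim conjE)
  fix M :: "'k linf set"
  assume M: "linf.closed_subspace JL M" and codim: "linf.infinite_codim JL M"
  have M': "linf.subspace M" "closed M" "M \<subseteq> JL" using M by (auto simp: linf.closed_subspace_def)
  define M1 where "M1 = closure (linf.span (c0 \<union> M))"
  have M1: "linf.subspace M1" "closed M1"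
    using linf.closed_subspace_closure_span[of "c0 \<union> M"] by (auto simp: M1_def linf.closed_subspace_def)
  have "linf.span (c0 \<union> M) \<subseteq> JL" using c0_subset_JL M'(3) by (intro linf.span_minimal subspace_JL) auto
  then have M1_JL: "M1 \<subseteq> JL" unfolding M1_def using closed_JL by (rule closure_minimal)
  have sub: "c0 \<union> M \<subseteq> M1"
    unfolding M1_def using closure_subset linf.span_superset by fast
  show "\<exists>L. M \<subseteq> L \<and> linf.infinite_codim JL L \<and> linf.complemented JL L"
  proof (cases "linf.infinite_codim JL M1")
    case True
    have "\<exists>L. M1 \<subseteq> L \<and> linf.infinite_codim JL L \<and> linf.complemented JL L"
    proof (rule superprojective_step[OF hb _ True])
      show "linf.closed_subspace JL M1" using M1 M1_JL by (simp add: linf.closed_subspace_def)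
      fix \<psi> :: "nat \<Rightarrow> 'k linf \<Rightarrow> 'k"
      assume \<psi>: "\<And>k. linf.functional_on JL 2 (\<psi> k)" "\<And>k m. m \<in> M1 \<Longrightarrow> \<psi> k m = 0"
      \<comment> \<open>For \<gamma> outside this countable set,
        \<open>char_seq (N \<gamma>)\<close> lies in the common kernel, as does \<open>c0\<close>;
        the remaining generators are countably many.\<close>
      define G where "G = (\<Union>k. {\<gamma>\<in>\<Gamma>. \<psi> k (char_seq (N \<gamma>)) \<noteq> 0})"
      have "countable G"
        unfolding G_def using \<psi>(2) sub
        by (intro countable_UN countable_nonzero_on_char \<psi>(1) countableI_type) auto
      define S where "S = insert (const_bcontfun 1) ((\<lambda>\<gamma>. char_seq (N \<gamma>) :: 'k linf) ` G)"
      have S: "countable S" "S \<subseteq> JL"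
        using \<open>countable G\<close> char_seq_in_JL const_in_JL by (auto simp: S_def G_def)
      have Z: "char_seq (N \<gamma>) \<in> {z\<in>JL. \<forall>k. \<psi> k z = 0} \<union> S" if "\<gamma> \<in> \<Gamma>" for \<gamma>
      proof (cases "\<gamma> \<in> G")
        case False
        then have "\<forall>k. \<psi> k (char_seq (N \<gamma>)) = 0" using that unfolding G_def by blast
        then show ?thesis using char_seq_in_JL[OF that] by blast
      qed (simp add: S_def)
      have "c0 \<union> {char_seq (N \<gamma>) | \<gamma>. \<gamma> \<in> \<Gamma>} \<union> {const_bcontfun 1} \<subseteq> {z\<in>JL. \<forall>k. \<psi> k z = 0} \<union> S"
        using Z \<psi>(2) sub c0_subset_JL by (auto simp: S_def)
      then have "JL \<subseteq> closure (linf.span ({z\<in>JL. \<forall>k. \<psi> k z = 0} \<union> S))"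
        unfolding X_JL_def[of \<Gamma> N] by (intro closure_mono linf.span_mono)
      then show "\<exists>S. countable S \<and> S \<subseteq> JL \<and> JL \<subseteq> closure (linf.span ({z\<in>JL. \<forall>k. \<psi> k z = 0} \<union> S))"
        using S by blast
    qed
    then show ?thesis using sub by blast
  next
    case False
    then obtain B where B: "finite B" "B \<subseteq> JL" "JL \<subseteq> linf.span (M1 \<union> B)"
      by (auto simp: linf.infinite_codim_def)
    show ?thesis
    proof (rule superprojective_step[OF hb M codim])
      fix \<psi> :: "nat \<Rightarrow> 'k linf \<Rightarrow> 'k"
      assume \<psi>: "\<And>k. linf.functional_on JL 2 (\<psi> k)" "\<And>k m. m \<in> M \<Longrightarrow> \<psi> k m = 0"
      \<comment> \<open>Here \<open>M1\<close> and \<open>B\<close> span everything, and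
        \<open>M1\<close> is the closed span of \<open>c0\<close> and \<open>M\<close>. As
        \<open>M\<close> lies in the common kernel, only \<open>B\<close> and the unit vectors
        generating \<open>c0\<close> remain.\<close>
      define S where "S = B \<union> range (\<lambda>n. char_seq {n} :: 'k linf)"
      have "char_seq {n} \<in> (JL :: 'k linf set)" for n
        by (intro subsetD[OF c0_subset_JL] finite_support_in_c0) simp
      then have S: "countable S" "S \<subseteq> JL"
        using B by (auto simp: S_def intro: countable_finite)
      let ?T = "closure (linf.span ({z\<in>JL. \<forall>k. \<psi> k z = 0} \<union> S))"
      have T: "linf.subspace ?T" "closed ?T"
        using linf.closed_subspace_closure_span by (auto simp: linf.closed_subspace_def)
      have ZT: "{z\<in>JL. \<forall>k. \<psi> k z = 0} \<union> S \<subseteq> ?T"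
        using closure_subset linf.span_superset by fast
      have "c0 \<subseteq> ?T"
        by (rule order_trans[OF c0_subset_closure_span], intro closure_mono linf.span_mono) (auto simp: S_def)
      moreover have "M \<subseteq> ?T" using ZT \<psi>(2) M'(3) by blast
      ultimately have "linf.span (c0 \<union> M) \<subseteq> ?T" by (intro linf.span_minimal T) auto
      then have "M1 \<subseteq> ?T" unfolding M1_def using T(2) by (rule closure_minimal)
      moreover have "B \<subseteq> ?T" using ZT by (auto simp: S_def)
      ultimately have "linf.span (M1 \<union> B) \<subseteq> ?T" by (intro linf.span_minimal T) auto
      then have "JL \<subseteq> ?T" using B(3) by blast
      then show "\<exists>S. countable S \<and> S \<subseteq> JL \<and> JL \<subseteq> closure (linf.span ({z\<in>JL. \<forall>k. \<psi> k z = 0} \<union> S))"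
        using S by blast
    qed
  qed
qed

end

section \<open>Hahn-Banach functionals over the real and the complex field\<close>

lemma linf_scaleR_subspace:
  fixes M :: "'k::{real_normed_field,banach} linf set"
  assumes "linf.subspace M"
  shows "subspace M"
  using linf.subspace_0[OF assms] linf.subspace_add[OF assms] linf.subspace_scale[OF assms]
  by (auto intro!: subspaceI simp flip: linf.scale_of_real)

lemma Hahn_Banach_real_linf:
  fixes M :: "real linf set"
  assumes M: "linf.subspace M"
  shows "\<exists>\<psi>. linf.functional_on UNIV 2 \<psi> \<and> (\<forall>m\<in>M. \<psi> m = 0) \<and> infdist x M \<le> norm (\<psi> x)"
proof -
  obtain u where u: "linear u" "\<And>y. \<bar>u y\<bar> \<le> norm y" "\<And>m. m \<in> M \<Longrightarrow> u m = 0" "u x = infdist x M"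
    using Hahn_Banach_infdist[OF linf_scaleR_subspace[OF M]] by blast
  have "linf.functional_on UNIV 2 u"
    unfolding linf.functional_on_def
  proof (intro conjI ballI allI)
    show "u (linf_scale c y) = c * u y" for c y
      using linear_scale[OF u(1), of c y] linf.scale_of_real[of c y] by simp
    show "norm (u y) \<le> 2 * norm y" for y using u(2)[of y] norm_ge_zero[of y] by simp
  qed (simp add: linear_add[OF u(1)])
  then show ?thesis using u by (intro exI[of _ u]) auto
qed

text \<open>A real-linear functional is the real part of a complex-linear one, with values
  \<open>u y - \<i> * u (\<i> y)\<close>. Adding the bounds for real and imaginary part yields the
  constant 2 and spares the rotation argument that would give 1; the lower bound at \<open>x\<close>
  comes from the real part.\<close>

lemma Hahn_Banach_complex_linf:
  fixes M :: "complex linf set"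
  assumes M: "linf.subspace M"
  shows "\<exists>\<psi>. linf.functional_on UNIV 2 \<psi> \<and> (\<forall>m\<in>M. \<psi> m = 0) \<and> infdist x M \<le> norm (\<psi> x)"
proof -
  obtain u where u: "linear u" "\<And>y. \<bar>u y\<bar> \<le> norm y" "\<And>m. m \<in> M \<Longrightarrow> u m = 0" "u x = infdist x M"
    using Hahn_Banach_infdist[OF linf_scaleR_subspace[OF M]] by blast
  define \<psi> where "\<psi> = (\<lambda>y. Complex (u y) (- u (linf_scale \<i> y)))"
  have sc: "linf_scale c y = Re c *\<^sub>R y + Im c *\<^sub>R linf_scale \<i> y" for c and y :: "complex linf"
    by (rule bcontfun_eqI) (simp add: scaleR_bcontfun.rep_eq complex_eq_iff)
  have usc: "u (linf_scale c y) = Re c * u y + Im c * u (linf_scale \<i> y)" for c y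
    by (subst sc) (simp add: linear_add[OF u(1)] linear_scale[OF u(1)])
  have "linf.functional_on UNIV 2 \<psi>"
    unfolding linf.functional_on_def
  proof (intro conjI ballI allI)
    show "\<psi> (y + z) = \<psi> y + \<psi> z" for y z
      by (simp add: \<psi>_def linear_add[OF u(1)] linf.scale_right_distrib complex_eq_iff)
    \<comment> \<open>The instance at \<open>\<i> * c\<close> computes the imaginary part of the
      left-hand side.\<close>
    show "\<psi> (linf_scale c y) = c * \<psi> y" for c y
      using usc[of c y] usc[of "\<i> * c" y] by (simp add: \<psi>_def complex_eq_iff algebra_simps)
    show "norm (\<psi> y) \<le> 2 * norm y" for y
    proof -
      have "norm (\<psi> y) \<le> \<bar>u y\<bar> + \<bar>u (linf_scale \<i> y)\<bar>"
        using cmod_le[of "\<psi> y"] by (simp add: \<psi>_def)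
      then show ?thesis using u(2)[of y] u(2)[of "linf_scale \<i> y"] by (simp add: linf.norm_scale)
    qed
  qed
  moreover have "\<psi> m = 0" if "m \<in> M" for m
    using u(3)[OF that] u(3)[OF linf.subspace_scale[OF M that]] by (simp add: \<psi>_def complex_eq_iff)
  moreover have "infdist x M \<le> norm (\<psi> x)"
    using abs_Re_le_cmod[of "\<psi> x"] u(4) by (simp add: \<psi>_def)
  ultimately show ?thesis by blast
qed

theorem proposition3p6:
  fixes \<Gamma> :: "'g set" and N :: "'g \<Rightarrow> nat set"
  assumes "\<Gamma> \<approx> (UNIV :: real set)"
    and "\<And>\<gamma>. \<gamma> \<in> \<Gamma> \<Longrightarrow> infinite (N \<gamma>)"
    and "\<And>\<gamma> \<gamma>'. \<gamma> \<in> \<Gamma> \<Longrightarrow> \<gamma>' \<in> \<Gamma> \<Longrightarrow> \<gamma> \<noteq> \<gamma>' \<Longrightarrow> finite (N \<gamma> \<inter> N \<gamma>')"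
  shows "linf.subprojective (X_JL \<Gamma> N :: real linf set) \<and>
         linf.superprojective (X_JL \<Gamma> N :: real linf set) \<and>
         linf.subprojective (X_JL \<Gamma> N :: complex linf set) \<and>
         linf.superprojective (X_JL \<Gamma> N :: complex linf set)"
proof -
  have "infinite \<Gamma>"
    using eqpoll_finite_iff[OF assms(1)] infinite_UNIV_char_0 by blast
  then interpret almost_disjoint_family \<Gamma> N
    using assms by unfold_locales
  show ?thesis
    by (intro conjI subprojective_JL superprojective_JL[OF Hahn_Banach_real_linf]
        superprojective_JL[OF Hahn_Banach_complex_linf])
qed

end
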